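(* Let $H$ be a finitely generated infinite Abelian group which is not isomorphic to $\mathbb Z$. Let $G=H(S)$ be the Cayley graph of $H$ with respect to some finite symmetric set of generators $S$ (not containing the identity). Let $k\in\mathbb N=\{1,2,\dots\}$. Then the following are equivalent: (i) the simple random walk on $G$ is recurrent; (ii) the edge $k$-NBRW on $G$ is recurrent; (iii) the vertex $k$-NBRW on $G$ is recurrent.
   Context: A set $S\subset H$ is symmetric if $S=S^{-1}$. The (right) Cayley graph is $H(S)=(H,E(S))$ with $E(S)=\{\{h,hs\}:h\in H,\ s\in S\}$. $x\sim y$ means that $x$ and $y$ are adjacent. The simple random walk (SRW) is the Markov chain on the vertex set with $P(x,y)=\mathbf 1\{x\sim y\}/\deg(x)$. Edge $k$-NBRW ($k$ non-backtracking random walk) $(X_t)_{t\ge0}$ started from a vertex: given $(X_i)_{i=0}^t$, $X_{t+1}$ is uniform on the set of $z\sim X_t$ such that $\{z,X_t\}\notin\{\{X_{i-1},X_i\}: t-k<i\le t,\ i\ge 1\}$. Vertex $k$-NBRW: given $(X_i)_{i=0}^t$, $X_{t+1}$ is uniform on the set of $z\sim X_t$ such that $z\notin\{X_i: t-k\le i\le t,\ i\ge 0\}$. In either case, if this set is empty, then $X_{t+1}$ is uniform over all neighbors of $X_t$. A vertex $v$ is recurrent for a given type of walk if the walk started from $v$ returns to $v$ infinitely often almost surely; otherwise it is transient. The walk on $G$ is recurrent (respectively, transient) if all vertices are recurrent (respectively, transient) for it. *)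

theory Defs
  imports "HOL-Probability.Probability" "HOL-Algebra.Elementary_Groups"
begin

section \<open>Graphs and Cayley graphs\<close>

text \<open>An undirected graph is a vertex set together with a set of edges, each edge being an
  unordered pair \<open>{x, y}\<close> of vertices.\<close>

type_synonym 'a ugraph = "'a set \<times> 'a set set"

abbreviation verts :: "'a ugraph \<Rightarrow> 'a set" where "verts \<equiv> fst"
abbreviation edges :: "'a ugraph \<Rightarrow> 'a set set" where "edges \<equiv> snd"

definition adjacent :: "'a ugraph \<Rightarrow> 'a \<Rightarrow> 'a \<Rightarrow> bool" where
  "adjacent G x y \<longleftrightarrow> {x, y} \<in> edges G"

definition neighbors :: "'a ugraph \<Rightarrow> 'a \<Rightarrow> 'a set" where
  "neighbors G x = {y. adjacent G x y}"

definition cayley_graph :: "('a, 'b) monoid_scheme \<Rightarrow> 'a set \<Rightarrow> 'a ugraph" where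
  "cayley_graph H S = (carrier H, {{h, h \<otimes>\<^bsub>H\<^esub> s} | h s. h \<in> carrier H \<and> s \<in> S})"


section \<open>Random walks with memory\<close>

text \<open>\<open>K t X\<close> is the conditional distribution of the position at time \<open>Suc t\<close> when the
  trajectory up to time \<open>t\<close> is \<open>X 0, \<dots>, X t\<close>; only these values of \<open>X\<close> may be used.\<close>

type_synonym 'a kernel = "nat \<Rightarrow> (nat \<Rightarrow> 'a) \<Rightarrow> 'a pmf"

text \<open>\<open>pmf_of_set\<close> is the uniform distribution only on finite nonempty sets. In a locally
  finite graph without isolated vertices every use below is of this kind.\<close>

definition srw_kernel :: "'a ugraph \<Rightarrow> 'a kernel" where
  "srw_kernel G t X = pmf_of_set (neighbors G (X t))"

definition uniform_or_neighbor :: "'a ugraph \<Rightarrow> 'a \<Rightarrow> 'a set \<Rightarrow> 'a pmf" where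
  "uniform_or_neighbor G x A = pmf_of_set (if A = {} then neighbors G x else A)"

text \<open>In the following two kernels, \<open>t < i + k\<close> and \<open>t \<le> i + k\<close> stand for \<open>t - k < i\<close> and
  \<open>t - k \<le> i\<close> with subtraction in the integers.\<close>

definition edge_nbrw_kernel :: "nat \<Rightarrow> 'a ugraph \<Rightarrow> 'a kernel" where
  "edge_nbrw_kernel k G t X = uniform_or_neighbor G (X t)
     {z \<in> neighbors G (X t). {z, X t} \<notin> {{X (i - 1), X i} | i. t < i + k \<and> i \<le> t \<and> 1 \<le> i}}"

definition vertex_nbrw_kernel :: "nat \<Rightarrow> 'a ugraph \<Rightarrow> 'a kernel" where
  "vertex_nbrw_kernel k G t X = uniform_or_neighbor G (X t)
     {z \<in> neighbors G (X t). z \<notin> {X i | i. t \<le> i + k \<and> i \<le> t}}"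

text \<open>The law on trajectories (infinite sequences of vertices) of the walk started from \<open>v\<close>,
  obtained from the kernel by the Ionescu-Tulcea construction. All states are taken in the
  discrete space on the vertex set. The construction is meaningful for countable vertex sets and
  kernels that stay in the vertex set; see \<open>walk_law_start\<close> and \<open>walk_law_Suc\<close> below.\<close>

definition walk_step :: "'a ugraph \<Rightarrow> 'a kernel \<Rightarrow> 'a \<Rightarrow> nat \<Rightarrow> (nat \<Rightarrow> 'a) \<Rightarrow> 'a measure" where
  "walk_step G K v n X = (case n of
      0 \<Rightarrow> return (count_space (verts G)) v
    | Suc t \<Rightarrow> restrict_space (measure_pmf (K t X)) (verts G))"

definition walk_law :: "'a ugraph \<Rightarrow> 'a kernel \<Rightarrow> 'a \<Rightarrow> (nat \<Rightarrow> 'a) measure" where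
  "walk_law G K v =
     projective_family.lim UNIV
       (Ionescu_Tulcea.CI (walk_step G K v) (\<lambda>_. count_space (verts G)))
       (\<lambda>_. count_space (verts G))"

definition recurrent_vertex :: "'a ugraph \<Rightarrow> 'a kernel \<Rightarrow> 'a \<Rightarrow> bool" where
  "recurrent_vertex G K v \<longleftrightarrow> (AE X in walk_law G K v. infinite {t. X t = v})"

definition recurrent_walk :: "'a ugraph \<Rightarrow> 'a kernel \<Rightarrow> bool" where
  "recurrent_walk G K \<longleftrightarrow> (\<forall>v \<in> verts G. recurrent_vertex G K v)"


section \<open>The law has the prescribed conditional distributions\<close>

locale walk_kernel =
  fixes G :: "'a ugraph" and K :: "'a kernel"
  assumes countable_verts: "countable (verts G)"
    and closed: "\<And>t X. (\<And>i. i \<le> t \<Longrightarrow> X i \<in> verts G) \<Longrightarrow> set_pmf (K t X) \<subseteq> verts G"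
    and adapted: "\<And>t X Y. (\<And>i. i \<le> t \<Longrightarrow> X i = Y i) \<Longrightarrow> K t X = K t Y"
begin

lemma Ionescu_Tulcea_walk:
  assumes v: "v \<in> verts G"
  shows "Ionescu_Tulcea (walk_step G K v) (\<lambda>_. count_space (verts G))"
proof -
  have prob: "prob_space (walk_step G K v i X) \<and> sets (walk_step G K v i X) = Pow (verts G)"
    if X: "X \<in> PiE {0..<i} (\<lambda>_. verts G)" for i X
  proof (cases i)
    case 0
    then show ?thesis using v by (auto simp: walk_step_def intro!: prob_space_return)
  next
    case (Suc t)
    have sub: "set_pmf (K t X) \<subseteq> verts G"
      by (rule closed) (use X Suc in \<open>auto simp: PiE_iff\<close>)
    have "emeasure (measure_pmf (K t X)) (verts G) = 1"
      using sub by (simp add: measure_pmf.emeasure_eq_1_AE AE_measure_pmf_iff subset_iff)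
    then have "prob_space (restrict_space (measure_pmf (K t X)) (verts G))"
      by (intro prob_spaceI) (simp add: space_restrict_space emeasure_restrict_space)
    then show ?thesis
      using Suc by (auto simp: walk_step_def sets_restrict_space)
  qed
  have PiM: "PiM {0..<i} (\<lambda>_. count_space (verts G)) = count_space (PiE {0..<i} (\<lambda>_. verts G))" for i :: nat
    by (rule count_space_PiM_finite) (simp_all add: countable_verts)
  show ?thesis
    unfolding Ionescu_Tulcea_def
  proof (intro conjI allI impI)
    fix i :: nat
    show "walk_step G K v i \<in> PiM {0..<i} (\<lambda>_. count_space (verts G)) \<rightarrow>\<^sub>M
            subprob_algebra (count_space (verts G))"
      unfolding PiM
      using prob by (auto simp: measurable_count_space_eq1 space_subprob_algebra
          intro: prob_space_imp_subprob_space)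
  next
    fix i :: nat and X :: "nat \<Rightarrow> 'a"
    assume "X \<in> space (PiM {0..<i} (\<lambda>_. count_space (verts G)))"
    then show "prob_space (walk_step G K v i X)"
      using prob unfolding PiM by simp
  qed
qed

context
  fixes v :: 'a
  assumes v: "v \<in> verts G"
begin

interpretation IT: Ionescu_Tulcea "walk_step G K v" "\<lambda>_. count_space (verts G)"
  by (rule Ionescu_Tulcea_walk[OF v])

lemma sets_walk_law: "sets (walk_law G K v) = sets (PiM UNIV (\<lambda>_. count_space (verts G)))"
  by (simp add: walk_law_def)

lemma space_walk_law: "space (walk_law G K v) = UNIV \<rightarrow>\<^sub>E verts G"
  by (simp add: walk_law_def space_PiM)

lemma prob_space_walk_law: "prob_space (walk_law G K v)"
proof
  let ?M = "\<lambda>_::nat. count_space (verts G)"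
  have "space (walk_law G K v) = IT.PF.emb UNIV {} (space (PiM {} ?M))"
    by (auto simp: space_walk_law prod_emb_def space_PiM)
  then show "emeasure (walk_law G K v) (space (walk_law G K v)) = 1"
    using IT.lim[of "{}" "space (PiM {} ?M)"] prob_space.emeasure_space_1[OF IT.PF.prob_space_P[of "{}"]]
    by (simp add: walk_law_def IT.PF.space_P)
qed

lemma PiM_verts:
  "PiM {0..<n::nat} (\<lambda>_. count_space (verts G)) = count_space (PiE {0..<n} (\<lambda>_. verts G))"
  by (rule count_space_PiM_finite) (simp_all add: countable_verts)

lemma emeasure_walk_law_cylinder:
  assumes x: "\<And>i. i < n \<Longrightarrow> x i \<in> verts G"
  shows "emeasure (walk_law G K v) {X \<in> space (walk_law G K v). \<forall>i<n. X i = x i}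
       = emeasure (IT.C 0 n (\<lambda>_. undefined)) {restrict x {0..<n}}"
proof -
  let ?M = "\<lambda>_::nat. count_space (verts G)"
  have mem: "{restrict x {0..<n}} \<in> sets (PiM {0..<n} ?M)"
    unfolding PiM_verts using x by (auto simp: PiE_iff)
  have "{X \<in> space (walk_law G K v). \<forall>i<n. X i = x i} = IT.PF.emb UNIV {0..<n} {restrict x {0..<n}}"
  proof -
    have "restrict X {0..<n} = restrict x {0..<n} \<longleftrightarrow> (\<forall>i<n. X i = x i)" for X :: "nat \<Rightarrow> 'a"
      by (auto simp: restrict_def fun_eq_iff split: if_splits)
    then show ?thesis
      by (auto simp: space_walk_law prod_emb_def)
  qed
  then have "emeasure (walk_law G K v) {X \<in> space (walk_law G K v). \<forall>i<n. X i = x i}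
      = emeasure (IT.CI {0..<n}) {restrict x {0..<n}}"
    using IT.lim[OF _ mem] by (simp add: walk_law_def)
  also have "\<dots> = emeasure (IT.C 0 n (\<lambda>_. undefined)) (IT.PF.emb {0..<n} {0..<n} {restrict x {0..<n}})"
    by (rule IT.emeasure_CI[OF _ mem]) simp
  also have "IT.PF.emb {0..<n} {0..<n} {restrict x {0..<n}} = {restrict x {0..<n}}"
    by (rule prod_emb_id) (use x in \<open>auto simp: PiE_iff\<close>)
  finally show ?thesis .
qed

lemma emeasure_C_Suc:
  assumes x: "\<And>i. i \<le> n \<Longrightarrow> x i \<in> verts G"
  shows "emeasure (IT.C 0 (Suc n) (\<lambda>_. undefined)) {restrict x {0..<Suc n}}
       = emeasure (IT.C 0 n (\<lambda>_. undefined)) {restrict x {0..<n}}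
         * emeasure (walk_step G K v n (restrict x {0..<n})) {x n}"
proof -
  let ?M = "\<lambda>_::nat. count_space (verts G)"
  let ?C = "IT.C 0 n (\<lambda>_. undefined)"
  let ?y = "restrict x {0..<n}"
  have und: "(\<lambda>_. undefined) \<in> space (PiM {0..<0} ?M)"
    by (simp add: space_PiM)
  have memS: "{restrict x {0..<Suc n}} \<in> sets (PiM {0..<Suc n} ?M)"
    unfolding PiM_verts using x by (auto simp: PiE_iff)
  have mem: "{?y} \<in> sets ?C"
    unfolding IT.sets_C[OF und] add_0 PiM_verts using x by (auto simp: PiE_iff)
  have spC: "space ?C = space (PiM {0..<n} ?M)"
    using IT.space_C[OF und, of n] by simp
  have yM: "?y \<in> space (PiM {0..<n} ?M)"
    using x by (auto simp: space_PiM PiE_iff)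
  have upd: "(fun_upd \<omega> n y = restrict x {0..<Suc n}) \<longleftrightarrow> \<omega> = ?y \<and> y = x n"
    if "\<omega> \<in> space (PiM {0..<n} ?M)" for \<omega> y
    using that by (auto simp: space_PiM PiE_iff extensional_def fun_eq_iff restrict_def less_Suc_eq)
  have eP: "emeasure (IT.eP n \<omega>) {restrict x {0..<Suc n}}
      = emeasure (walk_step G K v n ?y) {x n} * indicator {?y} \<omega>"
    if \<omega>: "\<omega> \<in> space ?C" for \<omega>
  proof -
    have "emeasure (IT.eP n \<omega>) {restrict x {0..<Suc n}}
        = emeasure (walk_step G K v n \<omega>) {y \<in> verts G. \<omega> = ?y \<and> y = x n}"
      by (subst IT.emeasure_eP[OF _ memS])
        (use \<omega> spC upd in \<open>auto intro!: arg_cong2[where f=emeasure]\<close>)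
    also have "{y \<in> verts G. \<omega> = ?y \<and> y = x n} = (if \<omega> = ?y then {x n} else {})"
      using x by auto
    finally show ?thesis
      by (cases "\<omega> = ?y") (simp_all del: restrict_apply)
  qed
  have "emeasure (IT.C 0 (Suc n) (\<lambda>_. undefined)) {restrict x {0..<Suc n}}
      = (\<integral>\<^sup>+\<omega>. emeasure (IT.eP n \<omega>) {restrict x {0..<Suc n}} \<partial>?C)"
  proof -
    have "IT.eP n \<in> measurable ?C (subprob_algebra (PiM {0..<Suc n} ?M))"
    proof -
      have "sets ?C = sets (PiM {0..<n} ?M)" using IT.sets_C[OF und, of n] by simp
      from measurable_cong_sets[OF this refl] show ?thesis using IT.measurable_eP[of n] by blast
    qed
    moreover have "space ?C \<noteq> {}" using yM spC by blast
    ultimately show ?thesis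
      using emeasure_bind[OF _ _ memS] by simp
  qed
  also have "\<dots> = (\<integral>\<^sup>+\<omega>. emeasure (walk_step G K v n ?y) {x n} * indicator {?y} \<omega> \<partial>?C)"
    by (rule nn_integral_cong) (rule eP)
  also have "\<dots> = emeasure (walk_step G K v n ?y) {x n} * emeasure ?C {?y}"
    by (rule nn_integral_cmult_indicator[OF mem])
  finally show ?thesis by (simp add: mult.commute)
qed

lemma walk_law_start: "AE X in walk_law G K v. X 0 = v"
proof -
  interpret prob_space "walk_law G K v" by (rule prob_space_walk_law)
  let ?A = "{X \<in> space (walk_law G K v). X 0 = v}"
  have A: "?A = {X \<in> space (walk_law G K v). \<forall>i<1. X i = v}"
    by simp
  have "emeasure (walk_law G K v) ?A = emeasure (IT.C 0 (Suc 0) (\<lambda>_. undefined)) {restrict (\<lambda>_. v) {0..<Suc 0}}"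
    unfolding A using emeasure_walk_law_cylinder[of 1 "\<lambda>_. v"] v by simp
  also have "\<dots> = emeasure (IT.C 0 0 (\<lambda>_. undefined)) {restrict (\<lambda>_. v) {0..<0}}
      * emeasure (walk_step G K v 0 (restrict (\<lambda>_. v) {0..<0})) {v}"
    by (rule emeasure_C_Suc) (use v in simp)
  also have "\<dots> = 1"
    using v by (simp add: walk_step_def PiM_empty emeasure_return restrict_def)
  finally have "emeasure (walk_law G K v) ?A = 1" .
  moreover have "?A \<in> sets (walk_law G K v)"
    using calculation emeasure_notin_sets[of ?A "walk_law G K v"] by fastforce
  ultimately have "AE X in walk_law G K v. X \<in> ?A"
    by (subst prob_eq_1[symmetric]) (simp_all add: measure_def)
  then show ?thesis by eventually_elim simp
qed

lemma walk_law_Suc: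
  assumes x: "\<And>i. i \<le> Suc t \<Longrightarrow> x i \<in> verts G"
  shows "emeasure (walk_law G K v) {X \<in> space (walk_law G K v). \<forall>i\<le>Suc t. X i = x i}
       = emeasure (walk_law G K v) {X \<in> space (walk_law G K v). \<forall>i\<le>t. X i = x i}
         * ennreal (pmf (K t x) (x (Suc t)))"
proof -
  have K: "K t (restrict x {0..<Suc t}) = K t x"
    by (rule adapted) simp
  have "emeasure (walk_step G K v (Suc t) (restrict x {0..<Suc t})) {x (Suc t)}
      = ennreal (pmf (K t x) (x (Suc t)))"
    using x[of "Suc t"]
    by (simp add: walk_step_def K emeasure_restrict_space emeasure_pmf_single)
  moreover have "emeasure (walk_law G K v) {X \<in> space (walk_law G K v). \<forall>i\<le>m. X i = x i}
      = emeasure (IT.C 0 (Suc m) (\<lambda>_. undefined)) {restrict x {0..<Suc m}}" if "m \<le> Suc t" for m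
    using emeasure_walk_law_cylinder[of "Suc m" x] x that by (simp add: less_Suc_eq_le)
  ultimately show ?thesis
    using emeasure_C_Suc[of "Suc t" x] x by (simp del: IT.C.simps)
qed

end

end


section \<open>Walks on Cayley graphs\<close>

lemma neighbors_cayley_graph:
  assumes "group H" "S \<subseteq> carrier H" "set_inv\<^bsub>H\<^esub> S = S" "x \<in> carrier H"
  shows "neighbors (cayley_graph H S) x = (\<lambda>s. x \<otimes>\<^bsub>H\<^esub> s) ` S"
proof -
  interpret group H by fact
  have "\<exists>s\<in>S. h = (h \<otimes>\<^bsub>H\<^esub> t) \<otimes>\<^bsub>H\<^esub> s" if "h \<in> carrier H" "t \<in> S" for h t
  proof (intro bexI)
    show "inv\<^bsub>H\<^esub> t \<in> S" using assms(3) that by (auto simp: SET_INV_def)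
    show "h = h \<otimes>\<^bsub>H\<^esub> t \<otimes>\<^bsub>H\<^esub> inv\<^bsub>H\<^esub> t"
      using that assms(2) by (simp add: m_assoc subset_iff)
  qed
  then show ?thesis
    using assms(4)
    by (auto simp: neighbors_def adjacent_def cayley_graph_def doubleton_eq_iff)
qed

lemma walk_kernels_cayley_graph:
  assumes H: "group H" and S: "S \<subseteq> carrier H" "finite S" "set_inv\<^bsub>H\<^esub> S = S" "S \<noteq> {}"
    and gen: "generate H S = carrier H"
  defines "G \<equiv> cayley_graph H S"
  shows "walk_kernel G (srw_kernel G)"
    and "walk_kernel G (edge_nbrw_kernel k G)"
    and "walk_kernel G (vertex_nbrw_kernel k G)"
proof -
  interpret group H by fact
  have verts: "verts G = carrier H" by (simp add: G_def cayley_graph_def)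
  have nb: "neighbors G x = (\<lambda>s. x \<otimes>\<^bsub>H\<^esub> s) ` S" if "x \<in> verts G" for x
    using neighbors_cayley_graph[OF H S(1,3)] that by (simp add: verts G_def[symmetric])
  have sub: "neighbors G x \<subseteq> verts G" "finite (neighbors G x)" "neighbors G x \<noteq> {}"
    if "x \<in> verts G" for x
    using that S nb[OF that] by (auto simp: verts)
  have un: "set_pmf (uniform_or_neighbor G x A) \<subseteq> verts G"
    if "x \<in> verts G" "A \<subseteq> neighbors G x" for x A
    using sub[OF that(1)] that(2) finite_subset[OF that(2)]
    by (auto simp: uniform_or_neighbor_def)
  have "countable (generate H S)"
  proof -
    have "generate H S \<subseteq> (\<lambda>w. foldr (\<otimes>\<^bsub>H\<^esub>) w \<one>\<^bsub>H\<^esub>) ` lists S"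
    proof
      fix h assume "h \<in> generate H S"
      then show "h \<in> (\<lambda>w. foldr (\<otimes>\<^bsub>H\<^esub>) w \<one>\<^bsub>H\<^esub>) ` lists S"
      proof induction
        case one
        show ?case by (rule image_eqI[of _ _ "[]"]) auto
      next
        case (incl h)
        then show ?case using S by (intro image_eqI[of _ _ "[h]"]) auto
      next
        case (inv h)
        then have "inv\<^bsub>H\<^esub> h \<in> S" using S(3) by (auto simp: SET_INV_def)
        then show ?case using S by (intro image_eqI[of _ _ "[inv\<^bsub>H\<^esub> h]"]) auto
      next
        case (eng h1 h2)
        then obtain w1 w2 where w: "w1 \<in> lists S" "w2 \<in> lists S"
          "h1 = foldr (\<otimes>\<^bsub>H\<^esub>) w1 \<one>\<^bsub>H\<^esub>" "h2 = foldr (\<otimes>\<^bsub>H\<^esub>) w2 \<one>\<^bsub>H\<^esub>" by blast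
        have cl: "foldr (\<otimes>\<^bsub>H\<^esub>) u \<one>\<^bsub>H\<^esub> \<in> carrier H" if "u \<in> lists S" for u
          using that S(1) by (induction u) auto
        have "foldr (\<otimes>\<^bsub>H\<^esub>) (u @ w2) \<one>\<^bsub>H\<^esub>
            = foldr (\<otimes>\<^bsub>H\<^esub>) u \<one>\<^bsub>H\<^esub> \<otimes>\<^bsub>H\<^esub> foldr (\<otimes>\<^bsub>H\<^esub>) w2 \<one>\<^bsub>H\<^esub>" if "u \<in> lists S" for u
          using that cl[OF w(2)] S(1) cl by (induction u) (auto simp: m_assoc subset_iff)
        with w show ?case by (intro image_eqI[of _ _ "w1 @ w2"]) auto
      qed
    qed
    moreover have "countable (lists S)"
      using S(2) by (simp add: countable_finite)
    ultimately show ?thesis by (meson countable_image countable_subset)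
  qed
  then have cnt: "countable (verts G)" using gen verts by simp
  show "walk_kernel G (srw_kernel G)"
  proof
    show "set_pmf (srw_kernel G t X) \<subseteq> verts G" if "\<And>i. i \<le> t \<Longrightarrow> X i \<in> verts G" for t X
      using sub[OF that[of t]] by (simp add: srw_kernel_def)
  qed (auto simp: cnt srw_kernel_def)
  show "walk_kernel G (edge_nbrw_kernel k G)"
  proof
    show "set_pmf (edge_nbrw_kernel k G t X) \<subseteq> verts G" if "\<And>i. i \<le> t \<Longrightarrow> X i \<in> verts G" for t X
      unfolding edge_nbrw_kernel_def by (rule un) (use that in auto)
    show "edge_nbrw_kernel k G t X = edge_nbrw_kernel k G t Y"
      if "\<And>i. i \<le> t \<Longrightarrow> X i = Y i" for t X Y
    proof -
      have "{{X (i - 1), X i} | i. t < i + k \<and> i \<le> t \<and> 1 \<le> i}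
          = {{Y (i - 1), Y i} | i. t < i + k \<and> i \<le> t \<and> 1 \<le> i}"
        by (rule Collect_cong) (metis that diff_le_self le_trans)
      then show ?thesis using that[of t] by (simp add: edge_nbrw_kernel_def)
    qed
  qed (rule cnt)
  show "walk_kernel G (vertex_nbrw_kernel k G)"
  proof
    show "set_pmf (vertex_nbrw_kernel k G t X) \<subseteq> verts G" if "\<And>i. i \<le> t \<Longrightarrow> X i \<in> verts G" for t X
      unfolding vertex_nbrw_kernel_def by (rule un) (use that in auto)
    show "vertex_nbrw_kernel k G t X = vertex_nbrw_kernel k G t Y"
      if "\<And>i. i \<le> t \<Longrightarrow> X i = Y i" for t X Y
    proof -
      have "{X i | i. t \<le> i + k \<and> i \<le> t} = {Y i | i. t \<le> i + k \<and> i \<le> t}"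
        by (rule Collect_cong) (metis that)
      then show ?thesis using that[of t] by (simp add: vertex_nbrw_kernel_def)
    qed
  qed (rule cnt)
qed

end

theory Submission
  imports Defs "HOL-Algebra.Multiplicative_Group"
begin

text \<open>Let \<open>s\<close> be a generator that maximises a nonzero homomorphism \<open>\<phi>\<close> to the integers, and let \<open>r\<close> be
  a generator outside the subgroup of \<open>s\<close>, which exists because \<open>H\<close> is not infinite cyclic. The range
  of \<open>\<phi>\<close> over the recent past of the walk shrinks until the walk is at an extreme point of it;
  from there it can run straight along \<open>s\<close> or along its inverse, and it can turn around by a single
  step \<open>r\<close>. Hence straight runs of length \<open>k\<close> in both directions recur with geometric tails.

  The displacements between a straight run along \<open>s\<close> and the next one along the inverse of \<open>s\<close>, and
  back, are independent, and since inversion is an automorphism of the Cayley graph they are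
  distributed as \<open>a\<close> and the inverse of \<open>b\<close>, with \<open>a\<close> and \<open>b\<close> independent copies of one another. So at
  every second change of direction one sees a random walk on \<open>H\<close> with a symmetric step law \<open>\<mu>\<close> that
  has a finite second moment and whose support generates \<open>H\<close>. Its Dirichlet form is therefore
  comparable with that of the Cayley graph. If points have positive capacity for this form, then
  the expected number of visits is finite; otherwise bounded superharmonic functions of \<open>\<mu>\<close>, among
  them the probability of hitting a given vertex, are constant. Thus recurrence is equivalent to a
  condition that depends on \<open>H\<close> and \<open>S\<close> only. Simple random walk is covered by the same argument.\<close>

section \<open>Hitting times of Markov chains\<close>

text \<open>The position alone is not Markov, and a walk that has enclosed itself may find every
  neighbour forbidden. The one quantitative fact used about a kernel is that a neighbour outside the
  last k + 1 positions has mass at least 1 / |S|; it holds for all three walks. A straight run of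
  length k fills the whole memory, so it is a regeneration: only its direction and end point matter
  afterwards. Turning around needs a generator outside the subgroup of \<open>s\<close>. On the
  integers with generators 1 and -1 there is none, and a walk with memory there never turns,
  although simple random walk is recurrent.

  Commutativity makes inversion preserve adjacency and makes the form \<open>D h\<close> invariant
  under translation. Two moments of the cycle length are wanted because a displacement that is a
  word of length n costs a factor n^2 in the Dirichlet form. The capacity criterion replaces rank,
  volume growth and local limit estimates, and no structure theorem for \<open>H\<close> is
  invoked.\<close>

lemma nn_integral_pmf_cong:
  "(\<And>x. x \<in> set_pmf p \<Longrightarrow> F x = G x) \<Longrightarrow> (\<integral>\<^sup>+x. F x \<partial>measure_pmf p) = (\<integral>\<^sup>+x. G x \<partial>measure_pmf p)"
  by (intro nn_integral_cong_AE) (simp add: AE_measure_pmf_iff)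

lemma nn_integral_pmf_mono:
  "(\<And>x. x \<in> set_pmf p \<Longrightarrow> F x \<le> G x) \<Longrightarrow> (\<integral>\<^sup>+x. F x \<partial>measure_pmf p) \<le> (\<integral>\<^sup>+x. G x \<partial>measure_pmf p)"
  by (intro nn_integral_mono_AE) (simp add: AE_measure_pmf_iff)

text \<open>The starting state is not tested, only the states at times 1 to \<open>n\<close>; for
  \<open>p\<close> in \<open>A\<close> this is the probability of a return. Recursion on the horizon
  keeps everything on discrete laws, without a measure on infinite trajectories.\<close>

primrec reach :: "('s \<Rightarrow> 's pmf) \<Rightarrow> ('s \<Rightarrow> bool) \<Rightarrow> nat \<Rightarrow> 's \<Rightarrow> ennreal" where
  "reach st A 0 p = 0"
| "reach st A (Suc n) p = (\<integral>\<^sup>+q. (if A q then 1 else reach st A n q) \<partial>st p)"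

primrec surv :: "('s \<Rightarrow> 's pmf) \<Rightarrow> ('s \<Rightarrow> bool) \<Rightarrow> nat \<Rightarrow> 's \<Rightarrow> ennreal" where
  "surv st A 0 p = 1"
| "surv st A (Suc n) p = (\<integral>\<^sup>+q. (if A q then 0 else surv st A n q) \<partial>st p)"

lemma reach_add_surv: "reach st A n p + surv st A n p = 1"
proof (induction n arbitrary: p)
  case (Suc n)
  have "reach st A (Suc n) p + surv st A (Suc n) p
      = (\<integral>\<^sup>+q. (if A q then 1 else reach st A n q) + (if A q then 0 else surv st A n q) \<partial>st p)"
    by (simp add: nn_integral_add)
  also have "\<dots> = (\<integral>\<^sup>+q. 1 \<partial>st p)"
    by (rule nn_integral_cong) (simp add: Suc)
  finally show ?case by simp
qed simp

lemma reach_le_1: "reach st A n p \<le> 1"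
  using reach_add_surv[of st A n p] by (metis le_iff_add)

lemma surv_le_1: "surv st A n p \<le> 1"
  using reach_add_surv[of st A n p] by (metis add.commute le_iff_add)

lemma surv_eq: "surv st A n p = 1 - reach st A n p"
  using reach_add_surv[of st A n p] reach_le_1[of st A n p]
  by (metis add.commute ennreal_add_diff_cancel_right ennreal_one_neq_top neq_top_trans)

lemma reach_Suc_mono: "reach st A n p \<le> reach st A (Suc n) p"
proof (induction n arbitrary: p)
  case (Suc n)
  have "reach st A (Suc n) p = (\<integral>\<^sup>+q. (if A q then 1 else reach st A n q) \<partial>st p)" by simp
  also have "\<dots> \<le> (\<integral>\<^sup>+q. (if A q then 1 else reach st A (Suc n) q) \<partial>st p)"
    by (rule nn_integral_mono) (use Suc in auto)
  finally show ?case by simp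
qed simp

lemma reach_mono: "m \<le> n \<Longrightarrow> reach st A m p \<le> reach st A n p"
  by (rule lift_Suc_mono_le[where f = "\<lambda>n. reach st A n p", OF reach_Suc_mono])

lemma surv_antimono: "m \<le> n \<Longrightarrow> surv st A n p \<le> surv st A m p"
  unfolding surv_eq by (rule ennreal_minus_mono[OF order_refl reach_mono])

text \<open>Markov property at time \<open>m\<close>: wherever the chain is then, it is still in
  \<open>V\<close>, and from there it survives \<open>N\<close> more steps with probability at most
  \<open>c\<close>.\<close>

lemma surv_add_le:
  assumes closed: "\<And>p q. p \<in> V \<Longrightarrow> q \<in> set_pmf (st p) \<Longrightarrow> q \<in> V"
    and N: "\<And>p. p \<in> V \<Longrightarrow> surv st A N p \<le> c"
    and p: "p \<in> V"
  shows "surv st A (m + N) p \<le> c * surv st A m p"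
  using p
proof (induction m arbitrary: p)
  case 0 then show ?case using N by simp
next
  case (Suc m)
  have "surv st A (Suc m + N) p = (\<integral>\<^sup>+q. (if A q then 0 else surv st A (m + N) q) \<partial>st p)" by simp
  also have "\<dots> \<le> (\<integral>\<^sup>+q. c * (if A q then 0 else surv st A m q) \<partial>st p)"
    by (rule nn_integral_pmf_mono) (use Suc closed in auto)
  also have "\<dots> = c * surv st A (Suc m) p" by (simp add: nn_integral_cmult)
  finally show ?case .
qed

lemma surv_power_le:
  assumes closed: "\<And>p q. p \<in> V \<Longrightarrow> q \<in> set_pmf (st p) \<Longrightarrow> q \<in> V"
    and N: "\<And>p. p \<in> V \<Longrightarrow> surv st A N p \<le> c"
    and p: "p \<in> V"
  shows "surv st A (j * N) p \<le> c ^ j"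
proof (induction j)
  case (Suc j)
  have "surv st A (Suc j * N) p \<le> c * surv st A (j * N) p"
    using surv_add_le[where m = "j * N" and V = V, OF closed N p] by (simp add: add.commute)
  also have "\<dots> \<le> c * c ^ j" by (rule mult_left_mono[OF Suc]) simp
  finally show ?case by simp
qed simp

text \<open>The mass of the trajectories that never enter \<open>A\<close> is moved to the junk value \<open>the None\<close> by
  \<open>hit\<close>; it is zero in the locale \<open>hitting\<close> below.\<close>

partial_function (spmf) hit_spmf :: "('s \<Rightarrow> 's pmf) \<Rightarrow> ('s \<Rightarrow> bool) \<Rightarrow> 's \<Rightarrow> 's spmf" where
  "hit_spmf st A p = bind_spmf (spmf_of_pmf (st p)) (\<lambda>q. if A q then return_spmf q else hit_spmf st A q)"

definition hit :: "('s \<Rightarrow> 's pmf) \<Rightarrow> ('s \<Rightarrow> bool) \<Rightarrow> 's \<Rightarrow> 's pmf" where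
  "hit st A p = map_pmf the (hit_spmf st A p)"

locale hitting =
  fixes st :: "'s \<Rightarrow> 's pmf" and A :: "'s \<Rightarrow> bool" and V :: "'s set"
  assumes closed: "\<And>p q. p \<in> V \<Longrightarrow> q \<in> set_pmf (st p) \<Longrightarrow> q \<in> V"
    and surv_0: "\<And>p. p \<in> V \<Longrightarrow> (\<lambda>n. surv st A n p) \<longlonglongrightarrow> 0"
begin

lemma hit_unfold:
  assumes p: "p \<in> V"
  shows "hit st A p = bind_pmf (st p) (\<lambda>q. if A q then return_pmf q else hit st A q)"
proof -
  have "hit st A p = map_pmf the (bind_pmf (st p) (\<lambda>q. if A q then return_spmf q else hit_spmf st A q))"
    unfolding hit_def by (subst hit_spmf.simps) (simp add: bind_spmf_of_pmf)
  also have "\<dots> = bind_pmf (st p) (\<lambda>q. if A q then return_pmf q else hit st A q)"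
    unfolding map_bind_pmf by (rule bind_pmf_cong) (auto simp: hit_def)
  finally show ?thesis .
qed

lemma nn_integral_hit:
  assumes p: "p \<in> V"
  shows "(\<integral>\<^sup>+q. F q \<partial>hit st A p) = (\<integral>\<^sup>+q. (if A q then F q else (\<integral>\<^sup>+q'. F q' \<partial>hit st A q)) \<partial>st p)"
  by (subst hit_unfold[OF p]) (auto intro!: nn_integral_cong)

text \<open>Claims about an unbounded hitting time are proved by induction on a horizon
  \<open>n\<close>, with the chance of not having hit by then as error term; letting
  \<open>n\<close> grow removes the error.\<close>

lemma le_of_le_add_surv:
  assumes p: "p \<in> V" and le: "\<And>n. (a::ennreal) \<le> b + surv st A n p"
  shows "a \<le> b"
proof -
  have "(\<lambda>n. b + surv st A n p) \<longlonglongrightarrow> b + 0"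
    by (intro tendsto_add surv_0 p tendsto_const)
  then show ?thesis
    using le by (intro LIMSEQ_le_const[where X = "\<lambda>n. b + surv st A n p"]) auto
qed

text \<open>Unfold the first step; since \<open>F\<close> is at most 1, the paths that have not hit
  within \<open>n\<close> steps contribute at most their probability. With the matching lower bound
  below this is uniqueness for the bounded Dirichlet problem, and for \<open>u = F\<close> it is
  optional stopping.\<close>

lemma hit_le_supersolution:
  assumes F: "\<And>q. F q \<le> 1"
    and u: "\<And>p. p \<in> V \<Longrightarrow> (\<integral>\<^sup>+q. (if A q then F q else u q) \<partial>st p) \<le> u p"
    and p: "p \<in> V"
  shows "(\<integral>\<^sup>+q. F q \<partial>hit st A p) \<le> u p"
proof (rule le_of_le_add_surv[OF p])
  fix n
  show "(\<integral>\<^sup>+q. F q \<partial>hit st A p) \<le> u p + surv st A n p"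
    using p
  proof (induction n arbitrary: p)
    case 0
    have "(\<integral>\<^sup>+q. F q \<partial>hit st A p) \<le> (\<integral>\<^sup>+q. 1 \<partial>hit st A p)" by (rule nn_integral_mono) (rule F)
    then show ?case by (simp add: add_increasing)
  next
    case (Suc n)
    have "(\<integral>\<^sup>+q. F q \<partial>hit st A p) = (\<integral>\<^sup>+q. (if A q then F q else (\<integral>\<^sup>+q'. F q' \<partial>hit st A q)) \<partial>st p)"
      by (rule nn_integral_hit) fact
    also have "\<dots> \<le> (\<integral>\<^sup>+q. (if A q then F q else u q) + (if A q then 0 else surv st A n q) \<partial>st p)"
      by (rule nn_integral_pmf_mono) (use Suc closed in auto)
    also have "\<dots> \<le> u p + surv st A (Suc n) p"
      by (simp add: nn_integral_add add_right_mono u Suc.prems)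
    finally show ?case .
  qed
qed

lemma subsolution_le_hit:
  assumes u1: "\<And>p. p \<in> V \<Longrightarrow> u p \<le> 1"
    and u: "\<And>p. p \<in> V \<Longrightarrow> u p \<le> (\<integral>\<^sup>+q. (if A q then F q else u q) \<partial>st p)"
    and p: "p \<in> V"
  shows "u p \<le> (\<integral>\<^sup>+q. F q \<partial>hit st A p)"
proof (rule le_of_le_add_surv[OF p])
  fix n
  show "u p \<le> (\<integral>\<^sup>+q. F q \<partial>hit st A p) + surv st A n p"
    using p
  proof (induction n arbitrary: p)
    case 0
    then show ?case using u1 by (simp add: add_increasing)
  next
    case (Suc n)
    have "u p \<le> (\<integral>\<^sup>+q. (if A q then F q else u q) \<partial>st p)" by (rule u) fact
    also have "\<dots> \<le> (\<integral>\<^sup>+q. (if A q then F q else (\<integral>\<^sup>+q'. F q' \<partial>hit st A q)) + (if A q then 0 else surv st A n q) \<partial>st p)"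
      by (rule nn_integral_pmf_mono) (use Suc closed in auto)
    also have "\<dots> = (\<integral>\<^sup>+q. F q \<partial>hit st A p) + surv st A (Suc n) p"
      by (simp add: nn_integral_add nn_integral_hit[OF Suc.prems, of F])
    finally show ?case .
  qed
qed

lemma hit_supermartingale:
  assumes "\<And>q. u q \<le> 1" "\<And>p. p \<in> V \<Longrightarrow> (\<integral>\<^sup>+q. u q \<partial>st p) \<le> u p" "p \<in> V"
  shows "(\<integral>\<^sup>+q. u q \<partial>hit st A p) \<le> u p"
  by (rule hit_le_supersolution) (use assms in auto)

lemma in_set_hit:
  assumes "p \<in> V" "q \<in> set_pmf (st p)" "if A q then q' = q else q' \<in> set_pmf (hit st A q)"
  shows "q' \<in> set_pmf (hit st A p)"
  by (subst hit_unfold) (use assms in \<open>auto split: if_splits\<close>)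

text \<open>\<open>hit\<close> comes from a least fixed point and carries no step count to induct
  on. The failure of \<open>Q\<close> is therefore treated as an event whose probability is below
  every survival probability, and a null event misses the support of a discrete law.\<close>

lemma set_hit_induct:
  assumes p: "p \<in> V"
    and A: "\<And>p q. p \<in> V \<Longrightarrow> q \<in> set_pmf (st p) \<Longrightarrow> A q \<Longrightarrow> Q p q"
    and nA: "\<And>p q q'. p \<in> V \<Longrightarrow> q \<in> set_pmf (st p) \<Longrightarrow> \<not> A q \<Longrightarrow> Q q q' \<Longrightarrow> Q p q'"
  shows "q \<in> set_pmf (hit st A p) \<Longrightarrow> Q p q"
proof -
  have "(\<integral>\<^sup>+q. (if Q p q then 0 else 1) \<partial>hit st A p) \<le> 0"
  proof (rule le_of_le_add_surv[OF p])
    fix n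
    show "(\<integral>\<^sup>+q. (if Q p q then 0 else 1) \<partial>hit st A p) \<le> 0 + surv st A n p"
      using p
    proof (induction n arbitrary: p)
      case 0
      have "(\<integral>\<^sup>+q. (if Q p q then 0 else 1) \<partial>hit st A p) \<le> (\<integral>\<^sup>+q. 1 \<partial>hit st A p)"
        by (rule nn_integral_mono) auto
      then show ?case by simp
    next
      case (Suc n)
      have "(\<integral>\<^sup>+q. (if Q p q then 0 else 1) \<partial>hit st A p)
          = (\<integral>\<^sup>+q. (if A q then (if Q p q then 0 else 1) else (\<integral>\<^sup>+q'. (if Q p q' then 0 else 1) \<partial>hit st A q)) \<partial>st p)"
        by (rule nn_integral_hit) fact
      also have "\<dots> \<le> (\<integral>\<^sup>+q. (if A q then 0 else surv st A n q) \<partial>st p)"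
      proof (rule nn_integral_pmf_mono)
        fix q assume q: "q \<in> set_pmf (st p)"
        have qV: "q \<in> V" using closed Suc.prems q by blast
        have "(\<integral>\<^sup>+q'. (if Q p q' then 0 else 1) \<partial>hit st A q) \<le> (\<integral>\<^sup>+q'. (if Q q q' then 0 else 1) \<partial>hit st A q)" if "\<not> A q"
          by (rule nn_integral_mono) (use nA[OF Suc.prems q that] in auto)
        then show "(if A q then (if Q p q then 0 else 1) else (\<integral>\<^sup>+q'. (if Q p q' then 0 else 1) \<partial>hit st A q))
            \<le> (if A q then 0 else surv st A n q)"
          using A[OF Suc.prems q] Suc.IH[OF qV] by auto
      qed
      finally show ?case by simp
    qed
  qed
  then have "AE q in hit st A p. (if Q p q then 0 else 1::ennreal) = 0"
    by (subst nn_integral_0_iff_AE[symmetric]) auto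
  then show "q \<in> set_pmf (hit st A p) \<Longrightarrow> Q p q" for q
    by (auto simp: AE_measure_pmf_iff split: if_splits)
qed

end

section \<open>Dirichlet forms on a Cayley graph\<close>

locale cayley = comm_group H for H :: "('a, 'b) monoid_scheme" (structure) +
  fixes S :: "'a set"
  assumes finite_S: "finite S" and S_sub: "S \<subseteq> carrier H"
    and S_inv: "\<And>s. s \<in> S \<Longrightarrow> inv s \<in> S"
    and S_gen: "generate H S = carrier H"
    and countable_carrier: "countable (carrier H)"
begin

abbreviation sum_carrier :: "('a \<Rightarrow> ennreal) \<Rightarrow> ennreal" where
  "sum_carrier F \<equiv> \<integral>\<^sup>+x. F x \<partial>count_space (carrier H)"

definition finite_supp :: "('a \<Rightarrow> real) \<Rightarrow> bool" where
  "finite_supp f \<longleftrightarrow> (\<forall>x. 0 \<le> f x) \<and> finite {x \<in> carrier H. f x \<noteq> 0}"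

definition D :: "'a \<Rightarrow> ('a \<Rightarrow> real) \<Rightarrow> ennreal" where
  "D h f = sum_carrier (\<lambda>x. ennreal ((f (x \<otimes> h) - f x)\<^sup>2))"

text \<open>Every edge is counted from both of its ends, so this is twice the Dirichlet energy in
  which each edge counts once.\<close>

definition energy :: "('a \<Rightarrow> real) \<Rightarrow> ennreal" where
  "energy f = (\<Sum>s\<in>S. D s f)"

text \<open>The point \<open>\<one>\<close> has positive capacity for the Dirichlet form of the Cayley graph.\<close>

definition pos_capacity :: bool where
  "pos_capacity \<longleftrightarrow> (\<exists>C::real. \<forall>f. finite_supp f \<longrightarrow> ennreal ((f \<one>)\<^sup>2) \<le> ennreal C * energy f)"

lemma bij_mult_right: "g \<in> carrier H \<Longrightarrow> bij_betw (\<lambda>x. x \<otimes> g) (carrier H) (carrier H)"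
  by (rule bij_betwI[where g = "\<lambda>x. x \<otimes> inv g"]) (auto simp: m_assoc)

lemma sum_carrier_shift:
  assumes "g \<in> carrier H"
  shows "sum_carrier (\<lambda>x. F (x \<otimes> g)) = sum_carrier F"
  using nn_integral_bij_count_space[OF bij_mult_right[OF assms], of F] by simp

lemma sum_carrier_commute:
  "sum_carrier (\<lambda>x. \<integral>\<^sup>+y. F x y \<partial>measure_pmf p) = (\<integral>\<^sup>+y. sum_carrier (\<lambda>x. F x y) \<partial>measure_pmf p)"
  by (rule nn_integral_count_space_nn_integral[symmetric]) (auto simp: countable_carrier)

lemma sum_carrier_square_finite:
  assumes "finite_supp f"
  shows "sum_carrier (\<lambda>x. ennreal ((f x)\<^sup>2)) < \<infinity>"
proof -
  have "finite {x \<in> carrier H. f x \<noteq> 0}" using assms by (simp add: finite_supp_def)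
  then have "finite {x \<in> carrier H. 0 < ennreal ((f x)\<^sup>2)}"
    by (rule rev_finite_subset) auto
  then show ?thesis by (subst nn_integral_count_space) (auto simp: less_top[symmetric])
qed

lemma finite_supp_shift:
  assumes "finite_supp f" "g \<in> carrier H"
  shows "finite_supp (\<lambda>x. f (x \<otimes> g))"
proof -
  have "x \<in> (\<lambda>x. x \<otimes> inv g) ` {x \<in> carrier H. f x \<noteq> 0}" if "x \<in> carrier H" "f (x \<otimes> g) \<noteq> 0" for x
    by (rule image_eqI[of _ _ "x \<otimes> g"]) (use that assms(2) in \<open>simp_all add: m_assoc\<close>)
  then have "{x \<in> carrier H. f (x \<otimes> g) \<noteq> 0} \<subseteq> (\<lambda>x. x \<otimes> inv g) ` {x \<in> carrier H. f x \<noteq> 0}" by blast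
  with assms show ?thesis by (auto simp: finite_supp_def intro: finite_subset)
qed

lemma D_shift:
  assumes "g \<in> carrier H" "h \<in> carrier H"
  shows "D h (\<lambda>x. f (x \<otimes> g)) = D h f"
proof -
  have "D h (\<lambda>x. f (x \<otimes> g)) = sum_carrier (\<lambda>x. ennreal ((f ((x \<otimes> g) \<otimes> h) - f (x \<otimes> g))\<^sup>2))"
    unfolding D_def by (rule nn_integral_cong) (use assms in \<open>simp add: m_ac\<close>)
  then show ?thesis
    unfolding D_def by (simp add: sum_carrier_shift[OF assms(1), of "\<lambda>x. ennreal ((f (x \<otimes> h) - f x)\<^sup>2)"])
qed

lemma energy_shift: "g \<in> carrier H \<Longrightarrow> energy (\<lambda>x. f (x \<otimes> g)) = energy f"
  unfolding energy_def using S_sub by (auto intro!: sum.cong D_shift)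

lemma D_one: "D \<one> f = 0"
proof -
  have "D \<one> f = sum_carrier (\<lambda>x. 0)" unfolding D_def by (rule nn_integral_cong) simp
  then show ?thesis by simp
qed

lemma D_inv:
  assumes "h \<in> carrier H"
  shows "D (inv h) f = D h f"
proof -
  have "D (inv h) f = sum_carrier (\<lambda>x. ennreal ((f (x \<otimes> h \<otimes> inv h) - f (x \<otimes> h))\<^sup>2))"
    unfolding D_def using sum_carrier_shift[OF assms, of "\<lambda>x. ennreal ((f (x \<otimes> inv h) - f x)\<^sup>2)"] by simp
  also have "\<dots> = D h f"
    unfolding D_def by (rule nn_integral_cong) (use assms in \<open>simp add: m_assoc power2_commute\<close>)
  finally show ?thesis .
qed

text \<open>Young's inequality for (a + b)^2 with a free weight \<open>t\<close>. A fixed weight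
  would make the constants grow exponentially along a word; adapting it to the length keeps the
  growth quadratic.\<close>

lemma D_mult:
  assumes g: "g \<in> carrier H" and h: "h \<in> carrier H" and t: "0 < t"
  shows "D (g \<otimes> h) f \<le> ennreal (1 + t) * D h f + ennreal (1 + 1 / t) * D g f"
proof -
  have pt: "(a + b)\<^sup>2 \<le> (1 + t) * a\<^sup>2 + (1 + 1 / t) * b\<^sup>2" for a b :: real
  proof -
    have "0 \<le> (t * a - b)\<^sup>2 / t" using t by simp
    also have "\<dots> = t * a\<^sup>2 - 2 * a * b + (1 / t) * b\<^sup>2" using t by (simp add: field_simps power2_eq_square)
    finally show ?thesis by (simp add: power2_eq_square algebra_simps)
  qed
  have "D (g \<otimes> h) f \<le> sum_carrier (\<lambda>x. ennreal (1 + t) * ennreal ((f (x \<otimes> g \<otimes> h) - f (x \<otimes> g))\<^sup>2)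
      + ennreal (1 + 1 / t) * ennreal ((f (x \<otimes> g) - f x)\<^sup>2))"
    unfolding D_def
  proof (rule nn_integral_mono)
    fix x assume "x \<in> space (count_space (carrier H))"
    then have "f (x \<otimes> (g \<otimes> h)) = f (x \<otimes> g \<otimes> h)" using g h by (simp add: m_assoc)
    then show "ennreal ((f (x \<otimes> (g \<otimes> h)) - f x)\<^sup>2) \<le> ennreal (1 + t) * ennreal ((f (x \<otimes> g \<otimes> h) - f (x \<otimes> g))\<^sup>2)
      + ennreal (1 + 1 / t) * ennreal ((f (x \<otimes> g) - f x)\<^sup>2)"
      using pt[of "f (x \<otimes> g \<otimes> h) - f (x \<otimes> g)" "f (x \<otimes> g) - f x"] t
      by (simp add: ennreal_mult[symmetric] ennreal_plus[symmetric] del: ennreal_plus)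
  qed
  also have "\<dots> = ennreal (1 + t) * sum_carrier (\<lambda>x. ennreal ((f (x \<otimes> g \<otimes> h) - f (x \<otimes> g))\<^sup>2))
      + ennreal (1 + 1 / t) * D g f"
    unfolding D_def by (simp add: nn_integral_add nn_integral_cmult)
  also have "sum_carrier (\<lambda>x. ennreal ((f (x \<otimes> g \<otimes> h) - f (x \<otimes> g))\<^sup>2)) = D h f"
    unfolding D_def by (rule sum_carrier_shift[OF g, of "\<lambda>x. ennreal ((f (x \<otimes> h) - f x)\<^sup>2)"])
  finally show ?thesis .
qed

lemma D_mult_2:
  assumes "g \<in> carrier H" "h \<in> carrier H"
  shows "D (g \<otimes> h) f \<le> 2 * D h f + 2 * D g f"
  using D_mult[OF assms, of 1 f] by simp

primrec words :: "nat \<Rightarrow> 'a set" where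
  "words 0 = {\<one>}"
| "words (Suc n) = {w \<otimes> s | w s. w \<in> words n \<and> s \<in> S}"

lemma words_carrier: "w \<in> words n \<Longrightarrow> w \<in> carrier H"
  by (induction n arbitrary: w) (use S_sub in auto)

lemma D_le_energy: "s \<in> S \<Longrightarrow> D s f \<le> energy f"
  unfolding energy_def by (rule member_le_sum) (auto simp: finite_S)

text \<open>With the weight \<open>t = n\<close> the constants add up to (1 + n) + (1 + 1/n) n^2 =
  (n + 1)^2.\<close>

lemma D_words:
  assumes "w \<in> words n"
  shows "D w f \<le> ennreal ((real n)\<^sup>2) * energy f"
  using assms
proof (induction n arbitrary: w)
  case 0 then show ?case by (simp add: D_one)
next
  case (Suc n)
  then obtain w' s where w: "w = w' \<otimes> s" "w' \<in> words n" "s \<in> S" by auto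
  have c: "w' \<in> carrier H" "s \<in> carrier H" using words_carrier w S_sub by auto
  show ?case
  proof (cases "n = 0")
    case True
    then show ?thesis using w c D_le_energy by simp
  next
    case False
    have "D w f \<le> ennreal (1 + real n) * D s f + ennreal (1 + 1 / real n) * D w' f"
      unfolding w by (rule D_mult) (use c False in auto)
    also have "\<dots> \<le> ennreal (1 + real n) * energy f + ennreal (1 + 1 / real n) * (ennreal ((real n)\<^sup>2) * energy f)"
      by (intro add_mono mult_left_mono D_le_energy Suc.IH w) auto
    also have "\<dots> = (ennreal (1 + real n) + ennreal (1 + 1 / real n) * ennreal ((real n)\<^sup>2)) * energy f"
      by (simp only: distrib_right mult.assoc)
    also have "ennreal (1 + real n) + ennreal (1 + 1 / real n) * ennreal ((real n)\<^sup>2) = ennreal ((real (Suc n))\<^sup>2)"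
    proof -
      have "(1 + real n) + (1 + 1 / real n) * (real n)\<^sup>2 = (real (Suc n))\<^sup>2"
        using False by (simp add: field_simps power2_eq_square)
      then show ?thesis
        by (simp add: ennreal_mult[symmetric] ennreal_plus[symmetric] del: ennreal_plus)
    qed
    finally show ?thesis .
  qed
qed

end

section \<open>Symmetric step laws: superharmonic functions and a Green function bound\<close>

locale sym_walk = cayley +
  fixes \<mu> :: "'a pmf"
  assumes mu_carrier: "set_pmf \<mu> \<subseteq> carrier H"
    and mu_sym: "map_pmf (\<lambda>h. inv h) \<mu> = \<mu>"
begin

definition E\<mu> :: "('a \<Rightarrow> real) \<Rightarrow> ennreal" where
  "E\<mu> f = (\<integral>\<^sup>+h. D h f \<partial>\<mu>)"

lemma nn_integral_mu_inv: "(\<integral>\<^sup>+h. F (inv h) \<partial>\<mu>) = (\<integral>\<^sup>+h. F h \<partial>\<mu>)"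
proof -
  have "(\<integral>\<^sup>+h. F h \<partial>map_pmf (\<lambda>h. inv h) \<mu>) = (\<integral>\<^sup>+h. F (inv h) \<partial>\<mu>)"
    by simp
  then show ?thesis by (simp add: mu_sym)
qed

lemma nn_integral_mu_cong:
  "(\<And>h. h \<in> carrier H \<Longrightarrow> F h = G h) \<Longrightarrow> (\<integral>\<^sup>+h. F h \<partial>\<mu>) = (\<integral>\<^sup>+h. G h \<partial>\<mu>)"
  using mu_carrier by (intro nn_integral_pmf_cong) auto

lemma two_sum_squares:
  "(\<integral>\<^sup>+h. sum_carrier (\<lambda>x. ennreal ((f x)\<^sup>2) + ennreal ((f (x \<otimes> h))\<^sup>2)) \<partial>\<mu>)
     = 2 * sum_carrier (\<lambda>x. ennreal ((f x)\<^sup>2))"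
proof -
  have "(\<integral>\<^sup>+h. sum_carrier (\<lambda>x. ennreal ((f x)\<^sup>2) + ennreal ((f (x \<otimes> h))\<^sup>2)) \<partial>\<mu>)
      = (\<integral>\<^sup>+h. 2 * sum_carrier (\<lambda>x. ennreal ((f x)\<^sup>2)) \<partial>\<mu>)"
    by (rule nn_integral_mu_cong)
      (simp add: nn_integral_add sum_carrier_shift[of _ "\<lambda>x. ennreal ((f x)\<^sup>2)"] mult_2)
  then show ?thesis by simp
qed

text \<open>A positive superharmonic function \<open>W\<close> bounds the Dirichlet form from below through
  \<open>a\<^sup>2 + b\<^sup>2 \<le> (a - b)\<^sup>2 + a\<^sup>2 v / w + b\<^sup>2 w / v\<close>.\<close>

lemma hardy:
  fixes W :: "'a \<Rightarrow> real"
  assumes W: "\<And>x. 0 < W x"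
    and super: "\<And>x. x \<in> carrier H \<Longrightarrow> (\<integral>\<^sup>+h. ennreal (W (x \<otimes> h)) \<partial>\<mu>) \<le> ennreal (W x)"
    and x0: "x0 \<in> carrier H"
    and strict: "(\<integral>\<^sup>+h. ennreal (W (x0 \<otimes> h)) \<partial>\<mu>) + ennreal \<epsilon> \<le> ennreal (W x0)"
    and eps: "0 < \<epsilon>"
    and f: "finite_supp f"
  shows "2 * ennreal (\<epsilon> / W x0 * (f x0)\<^sup>2) \<le> E\<mu> f"
proof -
  define N where "N = sum_carrier (\<lambda>x. ennreal ((f x)\<^sup>2))"
  define J where "J = sum_carrier (\<lambda>x. ennreal ((f x)\<^sup>2 / W x) * (\<integral>\<^sup>+h. ennreal (W (x \<otimes> h)) \<partial>\<mu>))"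
  have N: "N < \<infinity>" unfolding N_def by (rule sum_carrier_square_finite[OF f])
  have pt: "a\<^sup>2 + b\<^sup>2 \<le> (b - a)\<^sup>2 + a\<^sup>2 / w * v + b\<^sup>2 / v * w" if "0 < v" "0 < w" for a b v w :: real
  proof -
    have "0 \<le> (a * v - b * w)\<^sup>2 / (v * w)" using that by simp
    also have "\<dots> = a\<^sup>2 / w * v + b\<^sup>2 / v * w - 2 * a * b" using that by (simp add: field_simps power2_eq_square)
    finally show ?thesis by (simp add: power2_eq_square algebra_simps)
  qed
  have J1: "(\<integral>\<^sup>+h. sum_carrier (\<lambda>x. ennreal ((f x)\<^sup>2 / W x * W (x \<otimes> h))) \<partial>\<mu>) = J"
    unfolding J_def sum_carrier_commute[symmetric] using W
    by (intro nn_integral_cong) (simp add: ennreal_mult less_imp_le nn_integral_cmult del: times_divide_eq_left)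
  \<comment> \<open>Translating the summation variable by \<open>inv h\<close> and then using the
    symmetry of \<open>\<mu>\<close> identifies the second cross term with the first.\<close>
  have J2: "(\<integral>\<^sup>+h. sum_carrier (\<lambda>x. ennreal ((f (x \<otimes> h))\<^sup>2 / W (x \<otimes> h) * W x)) \<partial>\<mu>) = J"
  proof -
    have "(\<integral>\<^sup>+h. sum_carrier (\<lambda>x. ennreal ((f (x \<otimes> h))\<^sup>2 / W (x \<otimes> h) * W x)) \<partial>\<mu>)
        = (\<integral>\<^sup>+h. sum_carrier (\<lambda>x. ennreal ((f x)\<^sup>2 / W x * W (x \<otimes> inv h))) \<partial>\<mu>)"
    proof (rule nn_integral_mu_cong)
      fix h assume h: "h \<in> carrier H"
      have "sum_carrier (\<lambda>x. ennreal ((f x)\<^sup>2 / W x * W (x \<otimes> inv h)))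
          = sum_carrier (\<lambda>x. ennreal ((f (x \<otimes> h))\<^sup>2 / W (x \<otimes> h) * W (x \<otimes> h \<otimes> inv h)))"
        by (rule sum_carrier_shift[OF h, symmetric])
      also have "\<dots> = sum_carrier (\<lambda>x. ennreal ((f (x \<otimes> h))\<^sup>2 / W (x \<otimes> h) * W x))"
        by (rule nn_integral_cong) (use h in \<open>simp add: m_assoc\<close>)
      finally show "sum_carrier (\<lambda>x. ennreal ((f (x \<otimes> h))\<^sup>2 / W (x \<otimes> h) * W x))
        = sum_carrier (\<lambda>x. ennreal ((f x)\<^sup>2 / W x * W (x \<otimes> inv h)))" by simp
    qed
    then show ?thesis
      using nn_integral_mu_inv[of "\<lambda>h. sum_carrier (\<lambda>x. ennreal ((f x)\<^sup>2 / W x * W (x \<otimes> h)))"] J1 by simp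
  qed
  have "2 * N = (\<integral>\<^sup>+h. sum_carrier (\<lambda>x. ennreal ((f x)\<^sup>2) + ennreal ((f (x \<otimes> h))\<^sup>2)) \<partial>\<mu>)"
    unfolding N_def by (rule two_sum_squares[symmetric])
  also have "\<dots> \<le> (\<integral>\<^sup>+h. sum_carrier (\<lambda>x. ennreal ((f (x \<otimes> h) - f x)\<^sup>2) + ennreal ((f x)\<^sup>2 / W x * W (x \<otimes> h))
      + ennreal ((f (x \<otimes> h))\<^sup>2 / W (x \<otimes> h) * W x)) \<partial>\<mu>)"
  proof (intro nn_integral_mono)
    fix h x
    show "ennreal ((f x)\<^sup>2) + ennreal ((f (x \<otimes> h))\<^sup>2) \<le> ennreal ((f (x \<otimes> h) - f x)\<^sup>2) + ennreal ((f x)\<^sup>2 / W x * W (x \<otimes> h))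
      + ennreal ((f (x \<otimes> h))\<^sup>2 / W (x \<otimes> h) * W x)"
      using pt[of "W (x \<otimes> h)" "W x" "f x" "f (x \<otimes> h)"] W[of x] W[of "x \<otimes> h"]
      by (simp add: ennreal_plus[symmetric] less_imp_le del: ennreal_plus)
  qed
  also have "\<dots> = E\<mu> f + J + J"
    by (simp add: nn_integral_add J1 J2 E\<mu>_def D_def del: times_divide_eq_left)
  finally have 1: "2 * N \<le> E\<mu> f + 2 * J" by (simp add: mult_2 add.assoc)
  \<comment> \<open>Superharmonicity makes \<open>J\<close> at most \<open>N\<close>; the strict
    drop at \<open>x0\<close> is the surplus that later bounds the Dirichlet form from
    below.\<close>
  have 2: "J + ennreal (\<epsilon> / W x0 * (f x0)\<^sup>2) \<le> N"
  proof -
    have "J + ennreal (\<epsilon> / W x0 * (f x0)\<^sup>2)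
       = sum_carrier (\<lambda>x. ennreal ((f x)\<^sup>2 / W x) * (\<integral>\<^sup>+h. ennreal (W (x \<otimes> h)) \<partial>\<mu>)
           + ennreal (\<epsilon> / W x0 * (f x0)\<^sup>2) * indicator {x0} x)"
      unfolding J_def using x0 by (simp add: nn_integral_add nn_integral_cmult)
    also have "\<dots> \<le> N"
      unfolding N_def
    proof (rule nn_integral_mono)
      fix x assume "x \<in> space (count_space (carrier H))"
      then have x: "x \<in> carrier H" by simp
      have sq: "ennreal ((f x)\<^sup>2 / W x) * ennreal (W x) = ennreal ((f x)\<^sup>2)"
        using W[of x] by (simp add: ennreal_mult[symmetric] less_imp_le)
      show "ennreal ((f x)\<^sup>2 / W x) * (\<integral>\<^sup>+h. ennreal (W (x \<otimes> h)) \<partial>\<mu>)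
           + ennreal (\<epsilon> / W x0 * (f x0)\<^sup>2) * indicator {x0} x \<le> ennreal ((f x)\<^sup>2)"
      proof (cases "x = x0")
        case True
        have e: "ennreal (\<epsilon> / W x0 * (f x0)\<^sup>2) = ennreal ((f x0)\<^sup>2 / W x0) * ennreal \<epsilon>"
          using W[of x0] eps by (simp add: ennreal_mult[symmetric] less_imp_le mult.commute)
        show ?thesis
          unfolding True e
          using mult_left_mono[OF strict, of "ennreal ((f x0)\<^sup>2 / W x0)"] sq True
          by (simp add: distrib_left)
      next
        case False
        then show ?thesis
          using mult_left_mono[OF super[OF x], of "ennreal ((f x)\<^sup>2 / W x)"] sq by simp
      qed
    qed
    finally show ?thesis .
  qed
  \<comment> \<open>\<open>J\<close> must be finite before it can be cancelled in
    \<open>ennreal\<close>; this comes from the finite support of \<open>f\<close>.\<close>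
  have "J \<le> N" using 2 by (metis add_increasing2 le_iff_add order_trans zero_le)
  also note N
  finally have J: "2 * J \<noteq> \<infinity>" by (simp add: ennreal_mult_eq_top_iff)
  have "2 * J + 2 * ennreal (\<epsilon> / W x0 * (f x0)\<^sup>2) \<le> 2 * N"
    using mult_left_mono[OF 2, of 2] by (simp add: distrib_left)
  also note 1
  finally have "2 * J + 2 * ennreal (\<epsilon> / W x0 * (f x0)\<^sup>2) \<le> 2 * J + E\<mu> f" by (simp add: add.commute)
  then show ?thesis using J by (simp add: ennreal_add_left_cancel_le)
qed

text \<open>\<open>hardy\<close> controls a test function at \<open>x0\<close>. As
  \<open>energy\<close> is translation invariant, it may be applied to the translate whose value at
  \<open>x0\<close> is \<open>f \<one>\<close>.\<close>

lemma pos_capacity_of_superharmonic: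
  fixes W :: "'a \<Rightarrow> real"
  assumes W: "\<And>x. 0 < W x"
    and super: "\<And>x. x \<in> carrier H \<Longrightarrow> (\<integral>\<^sup>+h. ennreal (W (x \<otimes> h)) \<partial>\<mu>) \<le> ennreal (W x)"
    and x0: "x0 \<in> carrier H"
    and strict: "(\<integral>\<^sup>+h. ennreal (W (x0 \<otimes> h)) \<partial>\<mu>) + ennreal \<epsilon> \<le> ennreal (W x0)"
    and eps: "0 < \<epsilon>"
    and C: "\<And>f. E\<mu> f \<le> ennreal C * energy f" and C0: "0 \<le> C"
  shows pos_capacity
  unfolding pos_capacity_def
proof (intro exI allI impI)
  fix f :: "'a \<Rightarrow> real"
  assume f: "finite_supp f"
  define g where "g = (\<lambda>x. f (x \<otimes> inv x0))"
  have g: "finite_supp g" unfolding g_def by (rule finite_supp_shift[OF f]) (use x0 in simp)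
  have gx: "g x0 = f \<one>" unfolding g_def using x0 by simp
  have "ennreal (2 * (\<epsilon> / W x0)) * ennreal ((f \<one>)\<^sup>2) = 2 * ennreal (\<epsilon> / W x0 * (g x0)\<^sup>2)"
  proof -
    have "0 \<le> \<epsilon> / W x0" using eps W[of x0] by (simp add: less_imp_le)
    then show ?thesis unfolding gx by (simp add: ennreal_mult mult.assoc del: times_divide_eq_left times_divide_eq_right)
  qed
  also have "\<dots> \<le> E\<mu> g" by (rule hardy[OF W super x0 strict eps g])
  also have "\<dots> \<le> ennreal C * energy g" by (rule C)
  also have "energy g = energy f" unfolding g_def by (rule energy_shift) (use x0 in simp)
  finally have "ennreal (1 / (2 * (\<epsilon> / W x0))) * (ennreal (2 * (\<epsilon> / W x0)) * ennreal ((f \<one>)\<^sup>2))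
      \<le> ennreal (1 / (2 * (\<epsilon> / W x0))) * (ennreal C * energy f)"
    by (rule mult_left_mono) simp
  moreover have "ennreal (1 / (2 * (\<epsilon> / W x0))) * ennreal (2 * (\<epsilon> / W x0)) = 1"
    using eps W[of x0] by (simp add: ennreal_mult[symmetric] less_imp_le)
  moreover have "ennreal (1 / (2 * (\<epsilon> / W x0))) * ennreal C = ennreal (1 / (2 * (\<epsilon> / W x0)) * C)"
    by (rule ennreal_mult[symmetric]) (use eps W[of x0] C0 in \<open>simp_all add: less_imp_le\<close>)
  ultimately show "ennreal ((f \<one>)\<^sup>2) \<le> ennreal (1 / (2 * (\<epsilon> / W x0)) * C) * energy f"
    by (simp only: mult.assoc[symmetric] mult_1)
qed

text \<open>Otherwise the truncation \<open>min U (U x)\<close> would be strictly superharmonic at \<open>x\<close>.\<close>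

lemma superharmonic_mono:
  fixes U :: "'a \<Rightarrow> real"
  assumes rec: "\<not> pos_capacity"
    and C: "\<And>f. E\<mu> f \<le> ennreal C * energy f" and C0: "0 \<le> C"
    and U: "\<And>x. 0 \<le> U x"
    and super: "\<And>x. x \<in> carrier H \<Longrightarrow> (\<integral>\<^sup>+h. ennreal (U (x \<otimes> h)) \<partial>\<mu>) \<le> ennreal (U x)"
    and x: "x \<in> carrier H" and h: "h \<in> set_pmf \<mu>"
  shows "U x \<le> U (x \<otimes> h)"
proof (rule ccontr)
  assume less: "\<not> U x \<le> U (x \<otimes> h)"
  define a where "a = U x"
  \<comment> \<open>Adding 1 makes the truncation strictly positive, as \<open>hardy\<close>
    demands. The gain \<open>\<epsilon>\<close> is the mass of the atom \<open>h\<close> times its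
    shortfall below the level \<open>a\<close>.\<close>
  define W where "W = (\<lambda>y. min (U y) a + 1)"
  define \<epsilon> where "\<epsilon> = pmf \<mu> h * (a - U (x \<otimes> h))"
  have a: "0 \<le> a" using U by (simp add: a_def)
  have mn: "0 \<le> min (U y) a" for y using U a by simp
  have split: "(\<integral>\<^sup>+h. ennreal (W (y \<otimes> h)) \<partial>\<mu>) = (\<integral>\<^sup>+h. ennreal (min (U (y \<otimes> h)) a) \<partial>\<mu>) + 1" for y
    unfolding W_def using mn by (simp add: ennreal_plus[OF _ zero_le_one] nn_integral_add)
  have pos_capacity
  proof (rule pos_capacity_of_superharmonic[where W = W and \<epsilon> = \<epsilon> and C = C])
    show "0 < W y" for y unfolding W_def using mn[of y] by linarith
    show "(\<integral>\<^sup>+h. ennreal (W (y \<otimes> h)) \<partial>\<mu>) \<le> ennreal (W y)" if y: "y \<in> carrier H" for y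
    proof -
      have "(\<integral>\<^sup>+h. ennreal (min (U (y \<otimes> h)) a) \<partial>\<mu>) \<le> (\<integral>\<^sup>+h. ennreal (U (y \<otimes> h)) \<partial>\<mu>)"
        by (intro nn_integral_mono) (simp add: ennreal_leI)
      moreover have "(\<integral>\<^sup>+h. ennreal (min (U (y \<otimes> h)) a) \<partial>\<mu>) \<le> (\<integral>\<^sup>+h. ennreal a \<partial>\<mu>)"
        by (intro nn_integral_mono) (simp add: ennreal_leI)
      ultimately have "(\<integral>\<^sup>+h. ennreal (min (U (y \<otimes> h)) a) \<partial>\<mu>) \<le> ennreal (min (U y) a)"
        using super[OF y] by (cases "U y \<le> a") (simp_all add: min_absorb1 min_absorb2)
      then show ?thesis unfolding split using mn[of y] by (simp add: W_def ennreal_plus)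
    qed
    show "x \<in> carrier H" by (rule x)
    show "0 < \<epsilon>" unfolding \<epsilon>_def using h less by (simp add: a_def pmf_positive)
    show "(\<integral>\<^sup>+h. ennreal (W (x \<otimes> h)) \<partial>\<mu>) + ennreal \<epsilon> \<le> ennreal (W x)"
    proof -
      have "(\<integral>\<^sup>+h. ennreal (min (U (x \<otimes> h)) a) \<partial>\<mu>) + ennreal \<epsilon>
          = (\<integral>\<^sup>+h'. ennreal (min (U (x \<otimes> h')) a) + ennreal (a - U (x \<otimes> h)) * indicator {h} h' \<partial>\<mu>)"
      proof -
        have "(\<integral>\<^sup>+h'. ennreal (a - U (x \<otimes> h)) * indicator {h} h' \<partial>\<mu>) = ennreal \<epsilon>"
          using less by (subst nn_integral_cmult_indicator)
            (auto simp: emeasure_pmf_single \<epsilon>_def a_def ennreal_mult mult.commute)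
        then show ?thesis by (simp add: nn_integral_add)
      qed
      also have "\<dots> \<le> (\<integral>\<^sup>+h'. ennreal a \<partial>\<mu>)"
        using less U[of "x \<otimes> h"]
        by (intro nn_integral_mono)
          (auto simp: a_def ennreal_plus[symmetric] min_def ennreal_leI split: split_indicator simp del: ennreal_plus)
      finally have "(\<integral>\<^sup>+h. ennreal (min (U (x \<otimes> h)) a) \<partial>\<mu>) + ennreal \<epsilon> \<le> ennreal a" by simp
      then have "(\<integral>\<^sup>+h. ennreal (min (U (x \<otimes> h)) a) \<partial>\<mu>) + ennreal \<epsilon> + 1 \<le> ennreal a + 1"
        by (rule add_right_mono)
      then show ?thesis unfolding split using a by (simp add: W_def a_def ennreal_plus ac_simps)
    qed
  qed (use C C0 in auto)
  with rec show False ..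
qed

text \<open>A bound on the Green function without constructing it. Multiplying the inequality for
  \<open>f\<close> by \<open>f\<close> and summing bounds \<open>E\<mu> f\<close> by twice the sum
  of \<open>f b\<close>, hence by 2 m B' with \<open>m\<close> the maximum of \<open>f\<close> and
  B' the total of \<open>b\<close>. Positive capacity at a point where the maximum is attained turns
  this into m^2 <= K m. So \<open>K\<close> depends on \<open>b\<close> and the constants, but not
  on the size of the support of \<open>f\<close>.\<close>

lemma bounded_of_pos_capacity:
  assumes trans: pos_capacity
    and C: "\<And>f. energy f \<le> ennreal C * E\<mu> f"
    and B: "sum_carrier b < \<infinity>"
  shows "\<exists>K. \<forall>f. finite_supp f \<and> (\<forall>x\<in>carrier H. ennreal (f x) \<le> b x + (\<integral>\<^sup>+h. ennreal (f (x \<otimes> h)) \<partial>\<mu>))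
     \<longrightarrow> (\<forall>x\<in>carrier H. f x \<le> K)"
proof -
  obtain C1 where C1: "\<And>f. finite_supp f \<Longrightarrow> ennreal ((f \<one>)\<^sup>2) \<le> ennreal C1 * energy f"
    using trans unfolding pos_capacity_def by blast
  obtain B' where B': "sum_carrier b = ennreal B'" "0 \<le> B'"
    using B by (cases "sum_carrier b") auto
  define K where "K = max 0 C1 * max 0 C * 2 * B'"
  show ?thesis
  proof (intro exI allI impI ballI)
    fix f x
    assume "finite_supp f \<and> (\<forall>x\<in>carrier H. ennreal (f x) \<le> b x + (\<integral>\<^sup>+h. ennreal (f (x \<otimes> h)) \<partial>\<mu>))"
    then have f: "finite_supp f" and le: "\<And>x. x \<in> carrier H \<Longrightarrow> ennreal (f x) \<le> b x + (\<integral>\<^sup>+h. ennreal (f (x \<otimes> h)) \<partial>\<mu>)"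
      by auto
    have f0: "0 \<le> f x" for x using f by (simp add: finite_supp_def)
    define N where "N = sum_carrier (\<lambda>x. ennreal ((f x)\<^sup>2))"
    define J where "J = sum_carrier (\<lambda>x. ennreal (f x) * (\<integral>\<^sup>+h. ennreal (f (x \<otimes> h)) \<partial>\<mu>))"
    have N: "N < \<infinity>" unfolding N_def by (rule sum_carrier_square_finite[OF f])
    have J1: "(\<integral>\<^sup>+h. sum_carrier (\<lambda>x. ennreal (f x * f (x \<otimes> h))) \<partial>\<mu>) = J"
      unfolding J_def sum_carrier_commute[symmetric] using f0
      by (intro nn_integral_cong) (simp add: ennreal_mult nn_integral_cmult)
    have "E\<mu> f + 2 * J = (\<integral>\<^sup>+h. sum_carrier (\<lambda>x. ennreal ((f (x \<otimes> h) - f x)\<^sup>2) + 2 * ennreal (f x * f (x \<otimes> h))) \<partial>\<mu>)"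
      by (simp add: nn_integral_add nn_integral_cmult J1 E\<mu>_def D_def)
    also have "\<dots> = (\<integral>\<^sup>+h. sum_carrier (\<lambda>x. ennreal ((f x)\<^sup>2) + ennreal ((f (x \<otimes> h))\<^sup>2)) \<partial>\<mu>)"
    proof (intro nn_integral_cong)
      fix h x
      have "ennreal ((f (x \<otimes> h) - f x)\<^sup>2) + 2 * ennreal (f x * f (x \<otimes> h))
          = ennreal ((f (x \<otimes> h) - f x)\<^sup>2 + 2 * (f x * f (x \<otimes> h)))"
        using f0[of x] f0[of "x \<otimes> h"] by (simp add: ennreal_plus ennreal_mult)
      also have "(f (x \<otimes> h) - f x)\<^sup>2 + 2 * (f x * f (x \<otimes> h)) = (f x)\<^sup>2 + (f (x \<otimes> h))\<^sup>2"
        by (simp add: power2_eq_square algebra_simps)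
      finally show "ennreal ((f (x \<otimes> h) - f x)\<^sup>2) + 2 * ennreal (f x * f (x \<otimes> h))
         = ennreal ((f x)\<^sup>2) + ennreal ((f (x \<otimes> h))\<^sup>2)" by (simp add: ennreal_plus)
    qed
    also have "\<dots> = 2 * N" unfolding N_def by (rule two_sum_squares)
    finally have 1: "E\<mu> f + 2 * J = 2 * N" .
    have "2 * J \<le> 2 * N" using 1 by (metis add.commute le_iff_add)
    also have "2 * N < \<infinity>" using N by (simp add: ennreal_mult_less_top)
    finally have J: "2 * J \<noteq> \<infinity>" by simp
    have "N \<le> sum_carrier (\<lambda>x. ennreal (f x) * b x + ennreal (f x) * (\<integral>\<^sup>+h. ennreal (f (x \<otimes> h)) \<partial>\<mu>))"
      unfolding N_def
    proof (rule nn_integral_mono)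
      fix x assume "x \<in> space (count_space (carrier H))"
      then show "ennreal ((f x)\<^sup>2) \<le> ennreal (f x) * b x + ennreal (f x) * (\<integral>\<^sup>+h. ennreal (f (x \<otimes> h)) \<partial>\<mu>)"
        using mult_left_mono[OF le[of x], of "ennreal (f x)"] f0[of x]
        by (simp add: power2_eq_square ennreal_mult distrib_left)
    qed
    also have "\<dots> = sum_carrier (\<lambda>x. ennreal (f x) * b x) + J"
      unfolding J_def by (simp add: nn_integral_add)
    finally have "2 * N \<le> 2 * sum_carrier (\<lambda>x. ennreal (f x) * b x) + 2 * J"
      using mult_left_mono[of _ _ 2] by (fastforce simp: distrib_left)
    then have "2 * J + E\<mu> f \<le> 2 * J + 2 * sum_carrier (\<lambda>x. ennreal (f x) * b x)"
      using 1 by (simp add: add.commute)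
    then have 2: "E\<mu> f \<le> 2 * sum_carrier (\<lambda>x. ennreal (f x) * b x)"
      using J by (simp add: ennreal_add_left_cancel_le)
    define F where "F = f ` {x \<in> carrier H. f x \<noteq> 0}"
    \<comment> \<open>Inserting 0 covers the function that vanishes on the carrier; otherwise
      \<open>m\<close> is attained, and \<open>m2\<close> at that point reads m^2 <= K m.\<close>
    define m where "m = Max (insert 0 F)"
    have finF: "finite (insert 0 F)" using f by (simp add: F_def finite_supp_def)
    have fm: "f y \<le> m" if "y \<in> carrier H" for y
      unfolding m_def by (rule Max_ge[OF finF]) (use that in \<open>auto simp: F_def\<close>)
    have m0: "0 \<le> m" unfolding m_def by (rule Max_ge[OF finF]) simp
    have "sum_carrier (\<lambda>x. ennreal (f x) * b x) \<le> sum_carrier (\<lambda>x. ennreal m * b x)"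
      by (intro nn_integral_mono mult_right_mono) (auto intro!: ennreal_leI fm)
    also have "\<dots> = ennreal (m * B')" using B' m0 by (simp add: nn_integral_cmult ennreal_mult)
    finally have 3: "E\<mu> f \<le> ennreal (2 * (m * B'))"
      using 2 mult_left_mono[of "sum_carrier (\<lambda>x. ennreal (f x) * b x)" "ennreal (m * B')" 2] m0 B'(2)
      by (simp add: ennreal_mult)
    have m2: "(f y)\<^sup>2 \<le> K * m" if y: "y \<in> carrier H" for y
    proof -
      define g where "g = (\<lambda>x. f (x \<otimes> y))"
      have g: "finite_supp g" unfolding g_def by (rule finite_supp_shift[OF f y])
      have "ennreal ((f y)\<^sup>2) = ennreal ((g \<one>)\<^sup>2)" using y by (simp add: g_def)
      also have "\<dots> \<le> ennreal C1 * energy g" by (rule C1[OF g])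
      also have "energy g = energy f" unfolding g_def by (rule energy_shift[OF y])
      also have "ennreal C1 * energy f \<le> ennreal (max 0 C1) * (ennreal (max 0 C) * ennreal (2 * (m * B')))"
      proof (rule mult_mono)
        have "energy f \<le> ennreal C * E\<mu> f" by (rule C)
        also have "\<dots> \<le> ennreal (max 0 C) * ennreal (2 * (m * B'))"
          by (rule mult_mono) (auto intro: ennreal_leI 3)
        finally show "energy f \<le> ennreal (max 0 C) * ennreal (2 * (m * B'))" .
      qed (auto intro: ennreal_leI)
      also have "\<dots> = ennreal (K * m)"
      proof -
        have "ennreal c * (ennreal d * ennreal (2 * (m * B'))) = ennreal (c * d * 2 * B' * m)" if "0 \<le> c" "0 \<le> d" for c d
          using m0 B'(2) that by (simp add: ennreal_mult[symmetric] mult_ac)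
        from this[of "max 0 C1" "max 0 C"] show ?thesis unfolding K_def by (simp only: max.cobounded1)
      qed
      finally show ?thesis using m0 B'(2) by (simp add: K_def)
    qed
    have K0: "0 \<le> K" using B'(2) by (simp add: K_def)
    have "m \<in> insert 0 F" unfolding m_def by (rule Max_in[OF finF]) simp
    then have "m \<le> K"
    proof
      assume "m \<in> F"
      then obtain y where "y \<in> carrier H" "f y = m" "m \<noteq> 0" by (auto simp: F_def)
      then show "m \<le> K" using m2[of y] m0 by (simp add: power2_eq_square)
    qed (use K0 in simp)
    moreover assume "x \<in> carrier H"
    ultimately show "f x \<le> K" using fm[of x] by simp
  qed
qed

end

section \<open>A direction of infinite order\<close>

context comm_group
begin

text \<open>An element x r^m can have several such representations; two of them differ by a power of
  \<open>r\<close> lying in \<open>K\<close>, and \<open>con\<close> says that the proposed value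
  respects exactly these. The factor \<open>n\<close> clears denominators: \<open>\<phi>\<close>
  itself need not extend with integer values, but a multiple does.\<close>

lemma extend_hom_int:
  fixes \<phi> :: "'a \<Rightarrow> int" and n c :: int
  assumes K: "subgroup K G" and add: "\<And>x y. x \<in> K \<Longrightarrow> y \<in> K \<Longrightarrow> \<phi> (x \<otimes> y) = \<phi> x + \<phi> y"
    and r: "r \<in> carrier G"
    and con: "\<And>m::int. r [^] m \<in> K \<Longrightarrow> n * \<phi> (r [^] m) = m * c"
  shows "\<exists>\<phi>'::'a \<Rightarrow> int. \<forall>x\<in>K. \<forall>m::int. \<phi>' (x \<otimes> r [^] m) = n * \<phi> x + m * c"
proof -
  have KG: "x \<in> carrier G" if "x \<in> K" for x using K that by (rule subgroup.mem_carrier)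
  have unique: "n * \<phi> x + m * c = n * \<phi> y + l * c"
    if x: "x \<in> K" and y: "y \<in> K" and eq: "x \<otimes> r [^] m = y \<otimes> r [^] l" for x y and m l :: int
  proof -
    have d: "r [^] (m - l) = y \<otimes> inv x"
    proof -
      have "r [^] (m - l) = r [^] m \<otimes> inv (r [^] l)" using r by (rule int_pow_diff)
      also have "\<dots> = inv x \<otimes> (x \<otimes> r [^] m) \<otimes> inv (r [^] l)" using r KG[OF x] by (simp add: m_assoc[symmetric])
      also have "\<dots> = inv x \<otimes> y" unfolding eq using r KG[OF x] KG[OF y] by (simp add: m_assoc)
      finally show ?thesis using KG[OF x] KG[OF y] by (simp add: m_comm)
    qed
    have dK: "y \<otimes> inv x \<in> K" using K x y by (simp add: subgroup.m_closed subgroup.m_inv_closed)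
    have "\<phi> y = \<phi> (y \<otimes> inv x) + \<phi> x"
      using add[OF dK x] KG[OF x] KG[OF y] by (simp add: m_assoc)
    then have "n * \<phi> y = n * \<phi> (r [^] (m - l)) + n * \<phi> x" unfolding d by (simp add: distrib_left)
    moreover have "n * \<phi> (r [^] (m - l)) = (m - l) * c" by (rule con) (simp add: d dK)
    ultimately show ?thesis by (simp add: algebra_simps)
  qed
  define \<phi>' where "\<phi>' z = (SOME v. \<exists>x\<in>K. \<exists>m::int. z = x \<otimes> r [^] m \<and> v = n * \<phi> x + m * c)" for z
  have "\<phi>' (x \<otimes> r [^] m) = n * \<phi> x + m * c" if "x \<in> K" for x and m :: int
    unfolding \<phi>'_def
  proof (rule some_equality)
    show "\<exists>xa\<in>K. \<exists>ma::int. x \<otimes> r [^] m = xa \<otimes> r [^] ma \<and> n * \<phi> x + m * c = n * \<phi> xa + ma * c"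
      using that by blast
    show "v = n * \<phi> x + m * c"
      if "\<exists>xa\<in>K. \<exists>ma::int. x \<otimes> r [^] m = xa \<otimes> r [^] ma \<and> v = n * \<phi> xa + ma * c" for v
      using that unique[OF \<open>x \<in> K\<close>] by force
  qed
  then show ?thesis by blast
qed

lemma generate_insert_sub:
  assumes A: "A \<subseteq> carrier G" and r: "r \<in> carrier G"
  shows "generate G (insert r A) \<subseteq> {x \<otimes> r [^] m | x (m::int). x \<in> generate G A}"
proof
  have K: "subgroup (generate G A) G" by (rule generate_is_subgroup[OF A])
  have KG: "x \<in> carrier G" if "x \<in> generate G A" for x using K that by (rule subgroup.mem_carrier)
  fix z assume "z \<in> generate G (insert r A)"
  then show "z \<in> {x \<otimes> r [^] m | x (m::int). x \<in> generate G A}"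
  proof induction
    case one
    show ?case using generate.one[of G A] by (auto intro!: exI[of _ \<one>] exI[of _ "0::int"])
  next
    case (incl h)
    then show ?case
    proof
      assume "h = r"
      then show ?thesis using r generate.one[of G A] by (auto intro!: exI[of _ \<one>] exI[of _ "1::int"])
    next
      assume "h \<in> A"
      then show ?thesis using A generate.incl[of h A G] by (auto intro!: exI[of _ h] exI[of _ "0::int"])
    qed
  next
    case (inv h)
    then show ?case
    proof
      assume "h = r"
      then show ?thesis using r generate.one[of G A]
        by (auto intro!: exI[of _ \<one>] exI[of _ "- 1::int"] simp: int_pow_neg)
    next
      assume h: "h \<in> A"
      then have "inv h \<in> carrier G" using A by auto
      then show ?thesis using generate.inv[OF h, of G] by (auto intro!: exI[of _ "inv h"] exI[of _ "0::int"])
    qed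
  next
    case (eng h1 h2)
    then obtain x1 x2 and m1 m2 :: int where e: "h1 = x1 \<otimes> r [^] m1" "x1 \<in> generate G A" "h2 = x2 \<otimes> r [^] m2" "x2 \<in> generate G A"
      by blast
    have "h1 \<otimes> h2 = (x1 \<otimes> x2) \<otimes> r [^] (m1 + m2)"
      using r KG e by (simp add: int_pow_mult m_ac)
    moreover have "x1 \<otimes> x2 \<in> generate G A" using e by (simp add: generate.eng)
    ultimately show ?case by blast
  qed
qed

text \<open>Induction on the generators. If a positive power r^n lies in the old subgroup,
  finiteness persists because exponents can be reduced modulo n, and a nonzero homomorphism extends
  after multiplication by n. If no positive power lies there, reading off the exponent of
  \<open>r\<close> is a homomorphism.\<close>

lemma finite_or_hom_int:
  assumes "finite A" "A \<subseteq> carrier G"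
  shows "finite (generate G A) \<or> (\<exists>\<phi>::'a \<Rightarrow> int. (\<forall>x\<in>generate G A. \<forall>y\<in>generate G A. \<phi> (x \<otimes> y) = \<phi> x + \<phi> y)
      \<and> (\<exists>x\<in>generate G A. \<phi> x \<noteq> 0))"
  using assms
proof (induction A rule: finite_induct)
  case empty
  then show ?case by (simp add: generate_empty)
next
  case (insert r A)
  let ?K = "generate G A" and ?L = "generate G (insert r A)"
  have A: "A \<subseteq> carrier G" and r: "r \<in> carrier G" using insert by auto
  have K: "subgroup ?K G" by (rule generate_is_subgroup[OF A])
  have KG: "x \<in> carrier G" if "x \<in> ?K" for x using K that by (rule subgroup.mem_carrier)
  have KL: "?K \<subseteq> ?L" by (rule mono_generate) auto
  have L: "?L \<subseteq> {x \<otimes> r [^] m | x (m::int). x \<in> ?K}" by (rule generate_insert_sub[OF A r])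
  have hom: "\<forall>x\<in>?L. \<forall>y\<in>?L. \<phi>' (x \<otimes> y) = \<phi>' x + \<phi>' y"
    if \<phi>: "\<And>x y. x \<in> ?K \<Longrightarrow> y \<in> ?K \<Longrightarrow> \<phi> (x \<otimes> y) = \<phi> x + \<phi> y"
      and \<phi>': "\<And>x m. x \<in> ?K \<Longrightarrow> \<phi>' (x \<otimes> r [^] (m::int)) = n * \<phi> x + m * c"
    for \<phi> \<phi>' :: "'a \<Rightarrow> int" and n c :: int
  proof (intro ballI)
    fix z1 z2 assume "z1 \<in> ?L" "z2 \<in> ?L"
    then obtain x1 x2 and m1 m2 :: int where e: "z1 = x1 \<otimes> r [^] m1" "x1 \<in> ?K" "z2 = x2 \<otimes> r [^] m2" "x2 \<in> ?K"
      using L by blast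
    have z: "z1 \<otimes> z2 = (x1 \<otimes> x2) \<otimes> r [^] (m1 + m2)"
      using r KG e by (simp add: int_pow_mult m_ac)
    show "\<phi>' (z1 \<otimes> z2) = \<phi>' z1 + \<phi>' z2"
      using \<phi>'[OF generate.eng[OF e(2,4)], of "m1 + m2"] \<phi>'[OF e(2), of m1] \<phi>'[OF e(4), of m2] \<phi>[OF e(2,4)]
      by (simp add: z[symmetric] e(1,3)[symmetric] algebra_simps)
  qed
  show ?case
  proof (cases "\<exists>n::int. n > 0 \<and> r [^] n \<in> ?K")
    case True
    then obtain n :: int where n: "n > 0" "r [^] n \<in> ?K" by blast
    show ?thesis
      using insert.IH[OF A]
    proof
      assume fin: "finite ?K"
      have "?L \<subseteq> (\<lambda>(x, m). x \<otimes> r [^] m) ` (?K \<times> {0..<n})"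
      proof
        fix z assume "z \<in> ?L"
        then obtain x and m :: int where z: "z = x \<otimes> r [^] m" "x \<in> ?K" using L by blast
        have "r [^] m = (r [^] n) [^] (m div n) \<otimes> r [^] (m mod n)"
          using r by (simp add: int_pow_pow int_pow_mult[symmetric])
        then have "z = (x \<otimes> (r [^] n) [^] (m div n)) \<otimes> r [^] (m mod n)"
          using z KG r by (simp add: m_assoc)
        moreover have "x \<otimes> (r [^] n) [^] (m div n) \<in> ?K"
          using z n(2) K by (simp add: generate.eng subgroup_int_pow_closed)
        ultimately show "z \<in> (\<lambda>(x, m). x \<otimes> r [^] m) ` (?K \<times> {0..<n})"
          using n(1) by (auto intro!: image_eqI[of _ _ "(x \<otimes> (r [^] n) [^] (m div n), m mod n)"])
      qed
      then show ?thesis using fin finite_subset by fastforce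
    next
      assume "\<exists>\<phi>::'a \<Rightarrow> int. (\<forall>x\<in>?K. \<forall>y\<in>?K. \<phi> (x \<otimes> y) = \<phi> x + \<phi> y) \<and> (\<exists>x\<in>?K. \<phi> x \<noteq> 0)"
      then obtain \<phi> :: "'a \<Rightarrow> int" and x0 where \<phi>: "\<And>x y. x \<in> ?K \<Longrightarrow> y \<in> ?K \<Longrightarrow> \<phi> (x \<otimes> y) = \<phi> x + \<phi> y"
        and x0: "x0 \<in> ?K" "\<phi> x0 \<noteq> 0" by blast
      have pow: "\<phi> (y [^] (k::int)) = k * \<phi> y" if y: "y \<in> ?K" for y k
      proof -
        let ?G = "G\<lparr>carrier := ?K\<rparr>"
        have "\<phi> \<in> hom ?G integer_group" by (rule homI) (simp_all add: \<phi>)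
        moreover have "group ?G" by (rule subgroup.subgroup_is_group[OF K is_group])
        ultimately have "\<phi> (y [^]\<^bsub>?G\<^esub> k) = k * \<phi> y"
          using hom_int_pow[of \<phi> ?G integer_group y k] y by simp
        then show ?thesis by (simp only: int_pow_consistent[OF K y])
      qed
      have con: "n * \<phi> (r [^] m) = m * \<phi> (r [^] n)" if m: "r [^] m \<in> ?K" for m :: int
      proof -
        have "(r [^] m) [^] n = (r [^] n) [^] m" using r by (simp add: int_pow_pow mult.commute)
        then show ?thesis using pow[OF m, of n] pow[OF n(2), of m] by simp
      qed
      \<comment> \<open>The extension restricts to \<open>n * \<phi>\<close> on \<open>?K\<close>,
        which forces its value at \<open>r\<close> to be \<open>\<phi> (r [^] n)\<close>.\<close>
      obtain \<phi>' :: "'a \<Rightarrow> int" where \<phi>': "\<And>x m. x \<in> ?K \<Longrightarrow> \<phi>' (x \<otimes> r [^] (m::int)) = n * \<phi> x + m * \<phi> (r [^] n)"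
        using extend_hom_int[where n = n and c = "\<phi> (r [^] n)", OF K \<phi> r con] by blast
      have "\<phi>' x0 \<noteq> 0" using \<phi>'[OF x0(1), of 0] x0 KG n by simp
      then show ?thesis using hom[OF \<phi> \<phi>'] x0 KL by blast
    qed
  next
    case False
    have m0: "m = 0" if "r [^] m \<in> ?K" for m :: int
    proof (rule ccontr)
      assume "m \<noteq> 0"
      moreover have "r [^] (- m) \<in> ?K" using that K r by (simp add: int_pow_neg subgroup.m_inv_closed)
      ultimately show False using False that by (metis linorder_neqE_linordered_idom neg_0_less_iff_less)
    qed
    have con: "0 * (0::int) = m * 1" if "r [^] m \<in> ?K" for m :: int using m0[OF that] by simp
    obtain \<phi>' :: "'a \<Rightarrow> int" where \<phi>': "\<And>x m. x \<in> ?K \<Longrightarrow> \<phi>' (x \<otimes> r [^] (m::int)) = 0 * 0 + m * 1"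
      using extend_hom_int[where n = 0 and c = 1 and \<phi> = "\<lambda>_. 0", OF K _ r con] by auto
    have "\<phi>' r \<noteq> 0" using \<phi>'[OF generate.one, of 1] r by simp
    moreover have "r \<in> ?L" by (rule generate.incl) simp
    moreover have "\<forall>x\<in>?L. \<forall>y\<in>?L. \<phi>' (x \<otimes> y) = \<phi>' x + \<phi>' y"
      by (rule hom[where \<phi> = "\<lambda>_. 0" and n = 0 and c = 1]) (auto simp: \<phi>')
    ultimately show ?thesis by blast
  qed
qed

lemma iso_integer_group_of_generator:
  assumes s: "s \<in> carrier G" and inf: "infinite (carrier G)"
    and gen: "\<And>x. x \<in> carrier G \<Longrightarrow> \<exists>m::int. x = s [^] m"
  shows "G \<cong> integer_group"
proof -
  have "generate G {s} = carrier G"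
    using gen generate_pow[OF s] s by auto
  then have "infinite (carrier (subgroup_generated G {s}))"
    using inf s by (simp add: carrier_subgroup_generated Int_absorb1)
  then have inj: "inj (\<lambda>m::int. s [^] m)"
    using infinite_cyclic_subgroup_int[OF s] by (auto simp: inj_def)
  have "(\<lambda>m::int. s [^] m) \<in> iso integer_group G"
    unfolding iso_def using s inj gen
    by (auto simp: hom_integer_group_pow bij_betw_def)
  then have "integer_group \<cong> G" by (auto simp: is_iso_def)
  then show ?thesis by (rule group.iso_sym[OF group_integer_group])
qed

end

context cayley
begin

text \<open>A homomorphism that vanishes on \<open>S\<close> vanishes on \<open>H\<close>, so by
  symmetry of \<open>S\<close> the maximum over \<open>S\<close> is positive. If every generator
  were a power of the maximiser \<open>s\<close>, then \<open>H\<close> would be infinite cyclic;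
  here the exclusion of the integers enters.\<close>

lemma exists_direction:
  assumes inf: "infinite (carrier H)" and nZ: "\<not> H \<cong> integer_group"
  obtains \<phi> :: "'a \<Rightarrow> int" and s r where
    "\<And>x y. x \<in> carrier H \<Longrightarrow> y \<in> carrier H \<Longrightarrow> \<phi> (x \<otimes> y) = \<phi> x + \<phi> y"
    and "s \<in> S" "0 < \<phi> s" "\<And>t. t \<in> S \<Longrightarrow> \<phi> t \<le> \<phi> s"
    and "r \<in> S" "\<And>m::int. r \<noteq> s [^] m"
proof -
  obtain \<phi> :: "'a \<Rightarrow> int" and x0 where \<phi>: "\<And>x y. x \<in> carrier H \<Longrightarrow> y \<in> carrier H \<Longrightarrow> \<phi> (x \<otimes> y) = \<phi> x + \<phi> y"
    and x0: "x0 \<in> carrier H" "\<phi> x0 \<noteq> 0"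
    using finite_or_hom_int[OF finite_S S_sub] inf unfolding S_gen by blast
  have \<phi>1: "\<phi> \<one> = 0" using \<phi>[of \<one> \<one>] by simp
  have \<phi>i: "\<phi> (inv y) = - \<phi> y" if "y \<in> carrier H" for y
    using \<phi>[of "inv y" y] that by (simp add: \<phi>1)
  have "\<exists>t\<in>S. \<phi> t \<noteq> 0"
  proof (rule ccontr)
    assume n: "\<not> (\<exists>t\<in>S. \<phi> t \<noteq> 0)"
    have "x \<in> carrier H \<and> \<phi> x = 0" if "x \<in> generate H S" for x
      using that
    proof induction
      case (eng h1 h2) then show ?case using \<phi> by simp
    qed (use n S_sub \<phi>1 \<phi>i in auto)
    then show False using x0 S_gen by auto
  qed
  then obtain t where t: "t \<in> S" "\<phi> t \<noteq> 0" by blast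
  define t' where "t' = (if \<phi> t > 0 then t else inv t)"
  have t': "t' \<in> S" "\<phi> t' > 0" using t S_inv S_sub \<phi>i[of t] by (auto simp: t'_def)
  obtain s where s: "s \<in> S" "\<phi> s = Max (\<phi> ` S)"
    using Max_in[of "\<phi> ` S"] finite_S t(1) by (metis empty_iff finite_imageI imageE image_is_empty)
  have max: "\<phi> u \<le> \<phi> s" if "u \<in> S" for u using s finite_S that by simp
  have "\<exists>r\<in>S. \<forall>m::int. r \<noteq> s [^] m"
  proof (rule ccontr)
    assume n: "\<not> (\<exists>r\<in>S. \<forall>m::int. r \<noteq> s [^] m)"
    have sc: "s \<in> carrier H" using s S_sub by auto
    have "\<exists>m::int. x = s [^] m" if "x \<in> generate H S" for x
      using that
    proof induction
      case one show ?case by (rule exI[of _ 0]) simp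
    next
      case (incl h) then show ?case using n by auto
    next
      case (inv h)
      then have "inv h \<in> S" by (rule S_inv)
      then show ?case using n by auto
    next
      case (eng h1 h2) then show ?case using sc by (metis int_pow_mult)
    qed
    then have "H \<cong> integer_group"
      using iso_integer_group_of_generator[OF sc inf] S_gen by simp
    with nZ show False ..
  qed
  then obtain r where r: "r \<in> S" "\<And>m::int. r \<noteq> s [^] m" by blast
  show thesis
    by (rule that[OF \<phi> s(1) _ max r]) (use max[OF t'(1)] t'(2) in auto)
qed

end

section \<open>Walks with finite memory\<close>

lemma nn_integral_pmf_ge: "ennreal (pmf p x) * F x \<le> (\<integral>\<^sup>+y. F y \<partial>measure_pmf p)"
proof -
  have "ennreal (pmf p x) * F x = (\<integral>\<^sup>+y. F x * indicator {x} y \<partial>measure_pmf p)"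
    by (simp add: nn_integral_cmult_indicator emeasure_pmf_single mult.commute)
  also have "\<dots> \<le> (\<integral>\<^sup>+y. F y \<partial>measure_pmf p)"
    by (rule nn_integral_mono) (auto split: split_indicator)
  finally show ?thesis .
qed

text \<open>What the proof sees of a kernel: steps lie in \<open>S\<close>, neighbours outside the
  window of the last \<open>k + 1\<close> positions have a guaranteed mass, and the law commutes
  with translations and with inversion. \<open>K_memory\<close> is confined to
  \<open>k \<le> t\<close>, where the window is full; before that time the kernel may also depend on
  \<open>t\<close>.\<close>

locale memory_walk = cayley +
  fixes k :: nat and K :: "nat \<Rightarrow> (nat \<Rightarrow> 'a) \<Rightarrow> 'a pmf"
  assumes k: "1 \<le> k"
    and S_nonempty: "S \<noteq> {}"
    and K_supp: "\<And>t X. (\<And>i. i \<le> t \<Longrightarrow> X i \<in> carrier H) \<Longrightarrow> set_pmf (K t X) \<subseteq> (\<lambda>s. X t \<otimes> s) ` S"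
    and K_fresh: "\<And>t X s. (\<And>i. i \<le> t \<Longrightarrow> X i \<in> carrier H) \<Longrightarrow> s \<in> S \<Longrightarrow>
      (\<And>i. t \<le> i + k \<Longrightarrow> i \<le> t \<Longrightarrow> X t \<otimes> s \<noteq> X i) \<Longrightarrow> 1 / real (card S) \<le> pmf (K t X) (X t \<otimes> s)"
    and K_adapted: "\<And>t X Y. (\<And>i. i \<le> t \<Longrightarrow> X i = Y i) \<Longrightarrow> K t X = K t Y"
    and K_memory: "\<And>t X. k \<le> t \<Longrightarrow> K t X = K k (\<lambda>i. X (i + (t - k)))"
    and K_trans: "\<And>a t X. a \<in> carrier H \<Longrightarrow> (\<And>i. i \<le> t \<Longrightarrow> X i \<in> carrier H) \<Longrightarrow>
      K t (\<lambda>i. a \<otimes> X i) = map_pmf (\<lambda>z. a \<otimes> z) (K t X)"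
    and K_inv: "\<And>t X. (\<And>i. i \<le> t \<Longrightarrow> X i \<in> carrier H) \<Longrightarrow>
      K t (\<lambda>i. inv (X i)) = map_pmf (\<lambda>z. inv z) (K t X)"
begin

text \<open>The state of the chain is the whole trajectory, as a list with the present position first.\<close>

definition \<kappa> :: "'a list \<Rightarrow> 'a pmf" where
  "\<kappa> p = K (length p - 1) (\<lambda>i. rev p ! i)"

definition step :: "'a list \<Rightarrow> 'a list pmf" where
  "step p = map_pmf (\<lambda>z. z # p) (\<kappa> p)"

definition V :: "'a list set" where
  "V = {p. p \<noteq> [] \<and> set p \<subseteq> carrier H \<and> (\<forall>i. Suc i < length p \<longrightarrow> (\<exists>s\<in>S. p ! i = p ! Suc i \<otimes> s))}"

lemma V_nonempty: "p \<in> V \<Longrightarrow> p \<noteq> []"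
  by (simp add: V_def)

lemma V_carrier: "p \<in> V \<Longrightarrow> x \<in> set p \<Longrightarrow> x \<in> carrier H"
  by (auto simp: V_def)

lemma V_hd_carrier: "p \<in> V \<Longrightarrow> hd p \<in> carrier H"
  by (rule V_carrier) (auto simp: V_def)

lemma V_Cons:
  assumes p: "p \<in> V" and s: "s \<in> S"
  shows "(hd p \<otimes> s) # p \<in> V"
proof -
  have "\<exists>t\<in>S. ((hd p \<otimes> s) # p) ! i = ((hd p \<otimes> s) # p) ! Suc i \<otimes> t" if "Suc i < length ((hd p \<otimes> s) # p)" for i
    using that p s by (cases i) (auto simp: V_def hd_conv_nth)
  then show ?thesis using p s S_sub V_hd_carrier[OF p] by (auto simp: V_def)
qed

lemma V_singleton: "x \<in> carrier H \<Longrightarrow> [x] \<in> V"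
  by (simp add: V_def)

lemma rev_nth_carrier: "p \<in> V \<Longrightarrow> i \<le> length p - 1 \<Longrightarrow> rev p ! i \<in> carrier H"
proof -
  assume p: "p \<in> V" and "i \<le> length p - 1"
  then have "rev p ! i \<in> set (rev p)" using V_nonempty[OF p] by (intro nth_mem) (cases p; simp)
  then show ?thesis using V_carrier[OF p] by simp
qed

lemma rev_nth_last: "p \<noteq> [] \<Longrightarrow> rev p ! (length p - 1) = hd p"
  by (simp add: rev_nth hd_conv_nth)

lemma set_step:
  assumes "p \<in> V" "q \<in> set_pmf (step p)"
  shows "\<exists>s\<in>S. q = (hd p \<otimes> s) # p"
proof -
  have "set_pmf (\<kappa> p) \<subseteq> (\<lambda>s. rev p ! (length p - 1) \<otimes> s) ` S"
    unfolding \<kappa>_def by (rule K_supp) (rule rev_nth_carrier[OF assms(1)])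
  then show ?thesis
    using assms unfolding rev_nth_last[OF V_nonempty[OF assms(1)]] by (auto simp: step_def)
qed

lemma V_closed: "p \<in> V \<Longrightarrow> q \<in> set_pmf (step p) \<Longrightarrow> q \<in> V"
  using set_step V_Cons by blast

abbreviation recent :: "'a list \<Rightarrow> 'a set" where
  "recent p \<equiv> set (take (Suc k) p)"

lemma pmf_step_fresh:
  assumes p: "p \<in> V" and s: "s \<in> S" and f: "hd p \<otimes> s \<notin> recent p"
  shows "1 / real (card S) \<le> pmf (step p) ((hd p \<otimes> s) # p)"
proof -
  have "1 / real (card S) \<le> pmf (\<kappa> p) (rev p ! (length p - 1) \<otimes> s)"
    unfolding \<kappa>_def
  proof (rule K_fresh)
    fix i assume i: "length p - 1 \<le> i + k" "i \<le> length p - 1"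
    have l: "i < length p" using i V_nonempty[OF p] by (cases p) auto
    have "rev p ! i = p ! (length p - Suc i)" using l by (simp add: rev_nth)
    also have "\<dots> \<in> recent p"
      using i l by (auto simp: in_set_conv_nth intro!: exI[of _ "length p - Suc i"])
    finally show "rev p ! (length p - 1) \<otimes> s \<noteq> rev p ! i"
      using f by (auto simp only: rev_nth_last[OF V_nonempty[OF p]])
  qed (use rev_nth_carrier[OF p] s in auto)
  also have "rev p ! (length p - 1) = hd p" by (rule rev_nth_last[OF V_nonempty[OF p]])
  also have "pmf (\<kappa> p) (hd p \<otimes> s) = pmf (step p) ((hd p \<otimes> s) # p)"
    unfolding step_def using pmf_map_inj'[of "\<lambda>z. z # p" "\<kappa> p" "hd p \<otimes> s"] by (simp add: inj_def)
  finally show ?thesis .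
qed

lemma \<kappa>_take:
  assumes "Suc k \<le> length p"
  shows "\<kappa> p = \<kappa> (take (Suc k) p)"
proof -
  have "\<kappa> p = K k (\<lambda>i. rev p ! (i + (length p - 1 - k)))"
    unfolding \<kappa>_def by (rule K_memory) (use assms in simp)
  also have "\<dots> = K k (\<lambda>i. rev (take (Suc k) p) ! i)"
    by (rule K_adapted) (use assms in \<open>simp add: rev_nth\<close>)
  also have "\<dots> = \<kappa> (take (Suc k) p)"
    unfolding \<kappa>_def using assms by (simp add: min_def)
  finally show ?thesis .
qed

lemma step_map:
  assumes p: "p \<in> V"
    and \<theta>: "\<And>t X. (\<And>i. i \<le> t \<Longrightarrow> X i \<in> carrier H) \<Longrightarrow> K t (\<lambda>i. \<theta> (X i)) = map_pmf \<theta> (K t X)"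
  shows "step (map \<theta> p) = map_pmf (map \<theta>) (step p)"
proof -
  have "\<kappa> (map \<theta> p) = K (length p - 1) (\<lambda>i. \<theta> (rev p ! i))"
    unfolding \<kappa>_def length_map
  proof (rule K_adapted)
    fix i assume "i \<le> length p - 1"
    then have "i < length (rev p)" using V_nonempty[OF p] by (cases p) auto
    then show "rev (map \<theta> p) ! i = \<theta> (rev p ! i)" by (simp only: rev_map nth_map)
  qed
  also have "\<dots> = map_pmf \<theta> (\<kappa> p)"
    unfolding \<kappa>_def by (rule \<theta>) (rule rev_nth_carrier[OF p])
  finally show ?thesis by (simp add: step_def map_pmf_comp)
qed

primrec ext :: "'a list \<Rightarrow> 'a list \<Rightarrow> 'a list" where
  "ext p [] = p"
| "ext p (\<sigma> # \<sigma>s) = ext ((hd p \<otimes> \<sigma>) # p) \<sigma>s"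

text \<open>The second argument lists increments, not positions. Such a list is a script each of
  whose steps leaves the current window, so that \<open>K_fresh\<close> bounds its probability from
  below.\<close>

primrec fresh :: "'a list \<Rightarrow> 'a list \<Rightarrow> bool" where
  "fresh p [] = True"
| "fresh p (\<sigma> # \<sigma>s) \<longleftrightarrow> \<sigma> \<in> S \<and> hd p \<otimes> \<sigma> \<notin> recent p \<and> fresh ((hd p \<otimes> \<sigma>) # p) \<sigma>s"

lemma ext_append: "ext p (\<sigma>s @ \<tau>s) = ext (ext p \<sigma>s) \<tau>s"
  by (induction \<sigma>s arbitrary: p) auto

lemma fresh_append: "fresh p (\<sigma>s @ \<tau>s) \<longleftrightarrow> fresh p \<sigma>s \<and> fresh (ext p \<sigma>s) \<tau>s"
  by (induction \<sigma>s arbitrary: p) auto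

lemma ext_V: "p \<in> V \<Longrightarrow> fresh p \<sigma>s \<Longrightarrow> ext p \<sigma>s \<in> V"
  by (induction \<sigma>s arbitrary: p) (auto intro: V_Cons)

lemma card_S_pos: "0 < card S"
  using finite_S S_nonempty by (simp add: card_gt_0_iff)

lemma reach_fresh:
  assumes "p \<in> V" "fresh p \<sigma>s" "\<sigma>s \<noteq> []" "A (ext p \<sigma>s)"
  shows "ennreal ((1 / real (card S)) ^ length \<sigma>s) \<le> reach step A (length \<sigma>s) p"
  using assms
proof (induction \<sigma>s arbitrary: p)
  case (Cons \<sigma> \<sigma>s)
  let ?q = "(hd p \<otimes> \<sigma>) # p" and ?d = "1 / real (card S)"
  have d: "?d \<le> 1" "0 \<le> ?d" using card_S_pos by auto
  have "ennreal (?d ^ length \<sigma>s) \<le> (if A ?q then 1 else reach step A (length \<sigma>s) ?q)"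
    using Cons V_Cons[of p \<sigma>] d by (cases "\<sigma>s = []") (auto simp: power_le_one)
  then have "ennreal ?d * ennreal (?d ^ length \<sigma>s) \<le> ennreal (pmf (step p) ?q) * (if A ?q then 1 else reach step A (length \<sigma>s) ?q)"
    using Cons by (intro mult_mono ennreal_leI pmf_step_fresh) auto
  also have "\<dots> \<le> reach step A (length (\<sigma> # \<sigma>s)) p"
    using nn_integral_pmf_ge[of "step p" ?q "\<lambda>q. if A q then 1 else reach step A (length \<sigma>s) q"] by simp
  finally show ?case using d by (simp add: ennreal_mult[symmetric])
qed simp

text \<open>Stated through positions, so that \<open>run \<sigma> k\<close> is a condition on the
  \<open>k + 1\<close> most recent positions, which form the memory of the walk.\<close>

definition run :: "'a \<Rightarrow> nat \<Rightarrow> 'a list \<Rightarrow> bool" where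
  "run \<sigma> n p \<longleftrightarrow> n < length p \<and> (\<forall>j\<le>n. p ! j = hd p \<otimes> inv (\<sigma> [^] j))"

lemma run_0: "p \<in> V \<Longrightarrow> run \<sigma> 0 p"
  using V_hd_carrier[of p] by (auto simp: run_def V_def hd_conv_nth)

lemma run_Cons:
  assumes "p \<in> V" "\<sigma> \<in> S" "run \<sigma> n p"
  shows "run \<sigma> (Suc n) ((hd p \<otimes> \<sigma>) # p)"
proof -
  have c: "\<sigma> \<in> carrier H" "hd p \<in> carrier H" using assms S_sub V_hd_carrier by auto
  have "((hd p \<otimes> \<sigma>) # p) ! j = hd p \<otimes> \<sigma> \<otimes> inv (\<sigma> [^] j)" if "j \<le> Suc n" for j
  proof (cases j)
    case 0 then show ?thesis using c by simp
  next
    case (Suc i)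
    have "hd p \<otimes> \<sigma> \<otimes> inv (\<sigma> [^] Suc i) = hd p \<otimes> inv (\<sigma> [^] i)"
    proof -
      have "inv (\<sigma> [^] Suc i) = inv \<sigma> \<otimes> inv (\<sigma> [^] i)" using c by (simp add: inv_mult_group)
      then show ?thesis using c by (simp add: m_assoc) (simp add: m_assoc[symmetric])
    qed
    then show ?thesis using Suc that assms(3) by (simp add: run_def)
  qed
  then show ?thesis using assms(3) by (simp add: run_def)
qed

lemma run_replicate:
  assumes "p \<in> V" "\<sigma> \<in> S" "run \<sigma> n p"
  shows "run \<sigma> (n + m) (ext p (replicate m \<sigma>))"
  using assms
proof (induction m arbitrary: p n)
  case (Suc m)
  then show ?case using Suc.IH[of "(hd p \<otimes> \<sigma>) # p" "Suc n"] run_Cons V_Cons by simp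
qed simp

lemma run_mono: "run \<sigma> n p \<Longrightarrow> m \<le> n \<Longrightarrow> run \<sigma> m p"
  by (auto simp: run_def)

lemma run_replicate': "p \<in> V \<Longrightarrow> \<sigma> \<in> S \<Longrightarrow> run \<sigma> m (ext p (replicate m \<sigma>))"
  using run_replicate[of p \<sigma> 0 m] run_0[of p \<sigma>] by simp

text \<open>Infinite order keeps the ray from meeting itself, so only positions visited before its
  start can be in the way. The moving window gains no such position and gradually loses those it
  has.\<close>

lemma fresh_replicate:
  assumes "p \<in> V" "\<sigma> \<in> S" and inf: "\<And>j::nat. 0 < j \<Longrightarrow> \<sigma> [^] j \<noteq> \<one>"
    and "\<And>j. 0 < j \<Longrightarrow> j \<le> n \<Longrightarrow> hd p \<otimes> \<sigma> [^] j \<notin> recent p"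
  shows "fresh p (replicate n \<sigma>)"
  using assms(1,2,4)
proof (induction n arbitrary: p)
  case (Suc n)
  let ?q = "(hd p \<otimes> \<sigma>) # p"
  have c: "\<sigma> \<in> carrier H" "hd p \<in> carrier H" using Suc.prems S_sub V_hd_carrier by auto
  have "fresh ?q (replicate n \<sigma>)"
  proof (rule Suc.IH)
    fix j :: nat assume j: "0 < j" "j \<le> n"
    have e: "hd p \<otimes> \<sigma> \<otimes> \<sigma> [^] j = hd p \<otimes> \<sigma> [^] Suc j" using c by (simp add: m_ac)
    have "hd p \<otimes> \<sigma> [^] Suc j \<notin> recent p" by (rule Suc.prems(3)) (use j in auto)
    then have "hd p \<otimes> \<sigma> [^] Suc j \<notin> set (take k p)" using set_take_subset_set_take[of k "Suc k" p] by auto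
    moreover have "hd p \<otimes> \<sigma> \<otimes> \<sigma> [^] j \<noteq> hd p \<otimes> \<sigma>" using inf[OF j(1)] c by simp
    ultimately show "hd ?q \<otimes> \<sigma> [^] j \<notin> recent ?q" by (simp add: e)
  qed (use Suc.prems V_Cons in auto)
  then show ?case using Suc.prems(2) Suc.prems(3)[of 1] c by simp
qed simp

end

section \<open>Straight runs are reached from every past\<close>

locale direction = memory_walk +
  fixes \<phi> :: "'a \<Rightarrow> int" and s r :: 'a
  assumes \<phi>_add: "\<And>x y. x \<in> carrier H \<Longrightarrow> y \<in> carrier H \<Longrightarrow> \<phi> (x \<otimes> y) = \<phi> x + \<phi> y"
    and s: "s \<in> S" and \<phi>s: "0 < \<phi> s" and \<phi>_max: "\<And>t. t \<in> S \<Longrightarrow> \<phi> t \<le> \<phi> s"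
    and r: "r \<in> S" and r_notin: "\<And>m::int. r \<noteq> s [^] m"
begin

lemma sc: "s \<in> carrier H" and rc: "r \<in> carrier H"
  using s r S_sub by auto

lemma \<phi>_one: "\<phi> \<one> = 0"
  using \<phi>_add[of \<one> \<one>] by simp

lemma \<phi>_inv: "x \<in> carrier H \<Longrightarrow> \<phi> (inv x) = - \<phi> x"
  using \<phi>_add[of "inv x" x] by (simp add: \<phi>_one)

lemma \<phi>_pow: "x \<in> carrier H \<Longrightarrow> \<phi> (x [^] (j::nat)) = int j * \<phi> x"
  by (induction j) (simp_all add: \<phi>_one \<phi>_add algebra_simps)

lemma s_pow: "0 < j \<Longrightarrow> s [^] (j::nat) \<noteq> \<one>"
  using \<phi>_pow[OF sc, of j] \<phi>s \<phi>_one by auto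

lemma inv_s_pow: "0 < j \<Longrightarrow> inv s [^] (j::nat) \<noteq> \<one>"
  using \<phi>_pow[of "inv s" j] \<phi>_inv[OF sc] sc \<phi>s \<phi>_one by auto

lemma inv_s: "inv s \<in> S"
  by (rule S_inv[OF s])

lemma \<phi>_abs: "t \<in> S \<Longrightarrow> \<bar>\<phi> t\<bar> \<le> \<phi> s"
  using \<phi>_max[of t] \<phi>_max[OF S_inv, of t] \<phi>_inv[of t] S_sub by (auto simp: subset_iff)

text \<open>The hypotheses survive exchanging \<open>s\<close> with its inverse and changing the
  sign of \<open>\<phi>\<close>. Every result about runs along \<open>s\<close> is thereby available
  for runs along \<open>inv s\<close> without a second proof.\<close>

lemma direction_inv: "direction H S k K (\<lambda>x. - \<phi> x) (inv s) r"
proof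
  show "- \<phi> (x \<otimes> y) = - \<phi> x + - \<phi> y" if "x \<in> carrier H" "y \<in> carrier H" for x y
    using \<phi>_add that by simp
  show "0 < - \<phi> (inv s)" using \<phi>_inv sc \<phi>s by simp
  show "- \<phi> t \<le> - \<phi> (inv s)" if "t \<in> S" for t
    using \<phi>_abs[OF that] \<phi>_inv sc by simp
  show "r \<noteq> inv s [^] m" for m :: int
    using r_notin[of "- m"] sc by (simp add: int_pow_neg int_pow_inv)
qed (use inv_s r in auto)

definition line :: "'a list \<Rightarrow> bool" where
  "line p \<longleftrightarrow> (\<forall>y\<in>recent p. \<exists>m::int. y = hd p \<otimes> s [^] m)"

lemma pow_s_or_inv:
  assumes "\<tau> = s \<or> \<tau> = inv s"
  shows "\<exists>m::int. \<tau> [^] (j::nat) = s [^] m"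
proof (cases "\<tau> = s")
  case True
  then show ?thesis by (metis int_pow_int)
next
  case False
  then have "\<tau> [^] j = s [^] (- int j)" using assms sc by (simp add: int_pow_neg int_pow_int nat_pow_inv)
  then show ?thesis by blast
qed

lemma line_run:
  assumes \<tau>: "\<tau> = s \<or> \<tau> = inv s" and "run \<tau> k p"
  shows "line p"
  unfolding line_def
proof
  fix y assume "y \<in> recent p"
  then obtain j where j: "j \<le> k" "y = p ! j" by (auto simp: in_set_conv_nth less_Suc_eq_le)
  obtain m :: int where m: "\<tau> [^] j = s [^] m" using pow_s_or_inv[OF \<tau>] by blast
  have "y = hd p \<otimes> s [^] (- m)"
    using assms(2) j m sc by (auto simp: run_def int_pow_neg)
  then show "\<exists>m::int. y = hd p \<otimes> s [^] m" by blast
qed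

text \<open>The window lies in one coset of the subgroup of \<open>s\<close>. The step
  \<open>\<rho>\<close> leaves this coset, and the ray along \<open>\<tau>\<close> stays in the new
  one, so it cannot meet the old positions.\<close>

lemma fresh_turn:
  assumes p: "p \<in> V" and line: "line p" and \<rho>: "\<rho> \<in> S" "\<And>m::int. \<rho> \<noteq> s [^] m" and \<tau>: "\<tau> = s \<or> \<tau> = inv s"
  shows "fresh p (\<rho> # replicate n \<tau>)"
proof -
  let ?q = "(hd p \<otimes> \<rho>) # p"
  have c: "\<rho> \<in> carrier H" "hd p \<in> carrier H" using p \<rho> S_sub V_hd_carrier by auto
  have "hd p \<otimes> \<rho> \<notin> recent p"
  proof
    assume "hd p \<otimes> \<rho> \<in> recent p"
    then obtain m :: int where "hd p \<otimes> \<rho> = hd p \<otimes> s [^] m" using line by (auto simp: line_def)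
    then show False using c sc \<rho> by simp
  qed
  moreover have "fresh ?q (replicate n \<tau>)"
  proof (rule fresh_replicate)
    show "?q \<in> V" using p \<rho> by (simp add: V_Cons)
    show "\<tau> \<in> S" using \<tau> s inv_s by auto
    show "\<tau> [^] j \<noteq> \<one>" if "0 < j" for j :: nat using \<tau> s_pow inv_s_pow that by auto
    then show "hd ?q \<otimes> \<tau> [^] j \<notin> recent ?q" if j: "0 < j" for j :: nat
    proof -
      have \<tau>c: "\<tau> \<in> carrier H" using \<tau> sc by auto
      have "hd p \<otimes> \<rho> \<otimes> \<tau> [^] j \<noteq> hd p \<otimes> \<rho>" using \<open>\<And>j. 0 < j \<Longrightarrow> \<tau> [^] j \<noteq> \<one>\<close>[OF j] c \<tau>c by simp
      moreover have "hd p \<otimes> \<rho> \<otimes> \<tau> [^] j \<notin> set (take k p)"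
      proof
        assume "hd p \<otimes> \<rho> \<otimes> \<tau> [^] j \<in> set (take k p)"
        then obtain m :: int where m: "hd p \<otimes> \<rho> \<otimes> \<tau> [^] j = hd p \<otimes> s [^] m"
          using line set_take_subset_set_take[of k "Suc k" p] by (auto simp: line_def)
        obtain l :: int where l: "\<tau> [^] j = s [^] l" using pow_s_or_inv[OF \<tau>] by blast
        have "\<rho> \<otimes> s [^] l = s [^] m" using m l c sc by (simp add: m_assoc)
        then have "\<rho> = s [^] (m - l)" using c sc by (metis int_pow_closed int_pow_diff inv_solve_right)
        then show False using \<rho> by simp
      qed
      ultimately show ?thesis by simp
    qed
  qed
  ultimately show ?thesis using \<rho> by simp
qed

text \<open>Length of the script in \<open>reach_min\<close>: \<open>k\<close> steps along
  \<open>inv s\<close>, one step \<open>r\<close>, and \<open>k\<close> steps along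
  \<open>s\<close>.\<close>

definition L :: nat where "L = 2 * k + 1"

definition \<epsilon> :: real where "\<epsilon> = (1 / real (card S)) ^ L"

lemma \<epsilon>_pos: "0 < \<epsilon>" and \<epsilon>_le_1: "\<epsilon> \<le> 1"
  using card_S_pos by (auto simp: \<epsilon>_def power_le_one)

lemma reach_max:
  assumes p: "p \<in> V" and max: "\<And>y. y \<in> recent p \<Longrightarrow> \<phi> y \<le> \<phi> (hd p)"
  shows "ennreal \<epsilon> \<le> reach step (run s k) L p"
proof -
  have f: "fresh p (replicate k s)"
  proof (rule fresh_replicate[OF p s s_pow])
    fix j :: nat assume j: "0 < j"
    have "\<phi> (hd p \<otimes> s [^] j) = \<phi> (hd p) + int j * \<phi> s"
      using V_hd_carrier[OF p] sc by (simp add: \<phi>_add \<phi>_pow)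
    then have "\<phi> (hd p) < \<phi> (hd p \<otimes> s [^] j)" using j \<phi>s by simp
    then show "hd p \<otimes> s [^] j \<notin> recent p" using max by fastforce
  qed auto
  have "ennreal \<epsilon> \<le> ennreal ((1 / real (card S)) ^ k)"
    unfolding \<epsilon>_def L_def using card_S_pos by (intro ennreal_leI power_decreasing) auto
  also have "\<dots> \<le> reach step (run s k) k p"
    using reach_fresh[where A = "run s k", OF p f] run_replicate'[OF p s] k by auto
  also have "\<dots> \<le> reach step (run s k) L p"
    by (rule reach_mono) (simp add: L_def)
  finally show ?thesis .
qed

text \<open>At a minimum the way along \<open>s\<close> may be blocked by the recent past, but the
  way along \<open>inv s\<close> is free. After \<open>k\<close> such steps the window contains
  nothing but this run, so a turn with \<open>r\<close> and a run along \<open>s\<close> are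
  possible.\<close>

lemma reach_min:
  assumes p: "p \<in> V" and min: "\<And>y. y \<in> recent p \<Longrightarrow> \<phi> (hd p) \<le> \<phi> y"
  shows "ennreal \<epsilon> \<le> reach step (run s k) L p"
proof -
  have f1: "fresh p (replicate k (inv s))"
  proof (rule fresh_replicate[OF p inv_s inv_s_pow])
    fix j :: nat assume j: "0 < j"
    have "\<phi> (hd p \<otimes> inv s [^] j) = \<phi> (hd p) - int j * \<phi> s"
      using V_hd_carrier[OF p] sc by (simp add: \<phi>_add \<phi>_pow \<phi>_inv)
    then have "\<phi> (hd p \<otimes> inv s [^] j) < \<phi> (hd p)" using j \<phi>s by simp
    then show "hd p \<otimes> inv s [^] j \<notin> recent p" using min by fastforce
  qed auto
  let ?p = "ext p (replicate k (inv s))"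
  have p': "?p \<in> V" by (rule ext_V[OF p f1])
  have "line ?p" by (rule line_run[OF _ run_replicate'[OF p inv_s]]) simp
  then have f2: "fresh ?p (r # replicate k s)" by (intro fresh_turn p' r r_notin) simp_all
  let ?\<sigma> = "replicate k (inv s) @ r # replicate k s"
  have "run s k (ext p ?\<sigma>)"
    unfolding ext_append by (simp add: run_replicate' V_Cons p' r s)
  moreover have "length ?\<sigma> = L" by (simp add: L_def)
  ultimately show ?thesis
    using reach_fresh[where A = "run s k" and \<sigma>s = ?\<sigma>, OF p] f1 f2 by (simp add: fresh_append \<epsilon>_def)
qed

text \<open>As long as the walk is strictly between the extremes of its recent past, the range of
  \<open>\<phi>\<close> over the last \<open>k + 1\<close> positions shrinks every \<open>k + 1\<close> steps.\<close>

lemma reach_of_range: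
  assumes "p \<in> V" "\<And>y. y \<in> recent p \<Longrightarrow> a \<le> \<phi> y \<and> \<phi> y \<le> b" "b - a \<le> int n"
  shows "ennreal \<epsilon> \<le> reach step (run s k) (n * Suc k + L) p"
  using assms
proof (induction n arbitrary: p b)
  case 0
  have "hd p \<in> recent p" using V_nonempty[OF 0(1)] by (cases p) auto
  then have "ennreal \<epsilon> \<le> reach step (run s k) L p"
    using 0 by (intro reach_max) (auto intro: order_trans)
  then show ?case by simp
next
  case (Suc n)
  \<comment> \<open>The state inside one round of \<open>k + 1\<close> steps: \<open>m\<close> steps
    are left, and the newest \<open>Suc k - m\<close> positions already lie strictly below
    \<open>b\<close>. At \<open>m = 0\<close> the whole window does, and the outer induction
    continues with \<open>b - 1\<close>.\<close>
  have inner: "ennreal \<epsilon> \<le> reach step (run s k) (m + (n * Suc k + L)) p"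
    if "m \<le> Suc k" "p \<in> V" "\<And>y. y \<in> recent p \<Longrightarrow> a \<le> \<phi> y \<and> \<phi> y \<le> b"
      "\<And>y. y \<in> set (take (Suc k - m) p) \<Longrightarrow> \<phi> y < b" for m p
    using that
  proof (induction m arbitrary: p)
    case 0
    show ?case
      unfolding add_0
    proof (rule Suc.IH[where b = "b - 1"])
      show "a \<le> \<phi> y \<and> \<phi> y \<le> b - 1" if "y \<in> recent p" for y
        using 0(3)[OF that] 0(4)[of y] that by simp
    qed (use 0 Suc.prems in auto)
  next
    case (Suc m)
    let ?M = "m + (n * Suc k + L)"
    have "ennreal \<epsilon> \<le> (if run s k q then 1 else reach step (run s k) ?M q)" if q: "q \<in> set_pmf (step p)" for q
    proof -
      obtain t where t: "t \<in> S" "q = (hd p \<otimes> t) # p" using set_step[OF Suc.prems(2) q] by blast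
      have qV: "q \<in> V" using V_closed[OF Suc.prems(2) q] .
      have sub: "y \<in> recent p" if "y \<in> set (take k p)" for y
        using that set_take_subset_set_take[of k "Suc k" p] by auto
      have LM: "reach step (run s k) L q \<le> reach step (run s k) ?M q" by (rule reach_mono) simp
      have "ennreal \<epsilon> \<le> reach step (run s k) ?M q"
      \<comment> \<open>At an extreme of the window a script is available at once. Otherwise the new
        value lies strictly between two values of the window, hence below \<open>b\<close>.\<close>
      proof (cases "(\<forall>y\<in>recent q. \<phi> y \<le> \<phi> (hd q)) \<or> (\<forall>y\<in>recent q. \<phi> (hd q) \<le> \<phi> y)")
        case True
        then have "ennreal \<epsilon> \<le> reach step (run s k) L q" using reach_max[OF qV] reach_min[OF qV] by blast
        then show ?thesis using LM by (rule order_trans)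
      next
        case False
        then obtain y1 y2 where y: "y1 \<in> recent q" "\<phi> (hd q) < \<phi> y1" "y2 \<in> recent q" "\<phi> y2 < \<phi> (hd q)"
          by (auto simp: not_le)
        have y': "y1 \<in> set (take k p)" "y2 \<in> set (take k p)" using y t by auto
        have h: "a \<le> \<phi> (hd q)" "\<phi> (hd q) < b"
          using y Suc.prems(3)[OF sub[OF y'(1)]] Suc.prems(3)[OF sub[OF y'(2)]] by auto
        show ?thesis
        proof (rule Suc.IH)
          show "a \<le> \<phi> y \<and> \<phi> y \<le> b" if "y \<in> recent q" for y
            using that h Suc.prems(3)[OF sub, of y] t by auto
          show "\<phi> y < b" if y: "y \<in> set (take (Suc k - m) q)" for y
          proof -
            have "Suc k - m = Suc (Suc k - Suc m)" using Suc.prems(1) by simp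
            then have "y = hd q \<or> y \<in> set (take (Suc k - Suc m) p)" using y t by auto
            then show ?thesis using h Suc.prems(4) by auto
          qed
        qed (use Suc.prems qV in auto)
      qed
      then show ?thesis using \<epsilon>_le_1 by auto
    qed
    then have "(\<integral>\<^sup>+q. ennreal \<epsilon> \<partial>step p) \<le> (\<integral>\<^sup>+q. (if run s k q then 1 else reach step (run s k) ?M q) \<partial>step p)"
      by (intro nn_integral_pmf_mono) simp
    then show ?case by (simp only: add_Suc reach.simps) simp
  qed
  have "ennreal \<epsilon> \<le> reach step (run s k) (Suc k + (n * Suc k + L)) p"
    by (rule inner) (use Suc.prems in auto)
  then show ?case by (simp add: add_ac)
qed

lemma \<phi>_range:
  assumes p: "p \<in> V" and i: "i < length p"
  shows "\<bar>\<phi> (p ! i) - \<phi> (hd p)\<bar> \<le> int i * \<phi> s"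
  using i
proof (induction i)
  case 0 then show ?case by (simp add: hd_conv_nth V_nonempty[OF p])
next
  case (Suc i)
  then obtain t where t: "t \<in> S" "p ! i = p ! Suc i \<otimes> t" using p by (auto simp: V_def)
  have "\<phi> (p ! i) = \<phi> (p ! Suc i) + \<phi> t"
    unfolding t(2) by (rule \<phi>_add) (use V_carrier[OF p] Suc.prems t S_sub in auto)
  then show ?case using Suc \<phi>_abs[OF t(1)] by (simp add: algebra_simps abs_le_iff)
qed

text \<open>The window has \<open>\<phi>\<close>-range at most \<open>2 * k * \<phi> s\<close>, a
  round of \<open>Suc k\<close> steps lowers the range by one, and \<open>L\<close> steps remain for
  the final script.\<close>

definition N0 :: nat where "N0 = nat (2 * int k * \<phi> s) * Suc k + L"

lemma reach_run:
  assumes p: "p \<in> V"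
  shows "ennreal \<epsilon> \<le> reach step (run s k) N0 p"
  unfolding N0_def
proof (rule reach_of_range[OF p])
  fix y assume "y \<in> recent p"
  then obtain i where i: "i \<le> k" "i < length p" "y = p ! i" by (auto simp: in_set_conv_nth less_Suc_eq_le)
  have "int i * \<phi> s \<le> int k * \<phi> s" using i \<phi>s by simp
  then show "\<phi> (hd p) - int k * \<phi> s \<le> \<phi> y \<and> \<phi> y \<le> \<phi> (hd p) + int k * \<phi> s"
    using \<phi>_range[OF p i(2)] i(3) by auto
qed (use \<phi>s in auto)

lemma surv_run:
  assumes "p \<in> V"
  shows "surv step (run s k) N0 p \<le> ennreal (1 - \<epsilon>)"
proof -
  have "surv step (run s k) N0 p \<le> 1 - ennreal \<epsilon>"
    unfolding surv_eq by (rule ennreal_minus_mono[OF order_refl reach_run[OF assms]])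
  also have "1 - ennreal \<epsilon> = ennreal (1 - \<epsilon>)"
    using \<epsilon>_pos by (simp add: ennreal_minus ennreal_1[symmetric] del: ennreal_1)
  finally show ?thesis .
qed

lemma N0_pos: "0 < N0"
  by (simp add: N0_def L_def)

lemma hitting_run: "hitting step (run s k) V"
proof
  fix p assume p: "p \<in> V"
  show "(\<lambda>n. surv step (run s k) n p) \<longlonglongrightarrow> 0"
  proof (rule tendsto_sandwich[OF _ _ tendsto_const])
    show "\<forall>\<^sub>F n in sequentially. surv step (run s k) n p \<le> ennreal ((1 - \<epsilon>) ^ (n div N0))"
    proof (rule always_eventually, intro allI)
      fix n
      have "surv step (run s k) n p \<le> surv step (run s k) ((n div N0) * N0) p"
        by (rule surv_antimono) simp
      also have "\<dots> \<le> ennreal (1 - \<epsilon>) ^ (n div N0)"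
        by (rule surv_power_le[OF V_closed surv_run p])
      finally show "surv step (run s k) n p \<le> ennreal ((1 - \<epsilon>) ^ (n div N0))"
        using \<epsilon>_le_1 by (simp add: ennreal_power)
    qed
    have "filterlim (\<lambda>n. n div N0) at_top sequentially"
      using N0_pos by (rule filterlim_at_top_div_const_nat)
    moreover have "(\<lambda>n. (1 - \<epsilon>) ^ n) \<longlonglongrightarrow> 0"
      using \<epsilon>_pos \<epsilon>_le_1 by (intro LIMSEQ_realpow_zero) auto
    ultimately have "(\<lambda>n. (1 - \<epsilon>) ^ (n div N0)) \<longlonglongrightarrow> 0" by (rule filterlim_compose[rotated])
    then show "(\<lambda>n. ennreal ((1 - \<epsilon>) ^ (n div N0))) \<longlonglongrightarrow> 0"
      using tendsto_ennrealI by fastforce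
  qed simp
qed (rule V_closed)

end

text \<open>Bernoulli's inequality converts a factor \<open>1 - \<epsilon>\<close> per block of
  \<open>N\<close> steps into a factor \<open>\<theta>\<close> per step; \<open>diffs\<close> of the
  constant sequence gives the derivative of the geometric series. The bound \<open>2 \<le> N\<close>
  keeps \<open>\<theta>\<close> positive even for \<open>\<epsilon> = 1\<close>.\<close>

lemma summable_linear_geometric_div:
  fixes \<epsilon> :: real
  assumes e: "0 < \<epsilon>" "\<epsilon> \<le> 1" and N: "2 \<le> N"
  shows "summable (\<lambda>m. (2 * real m + 1) * (1 - \<epsilon>) ^ (m div N))"
proof -
  define \<theta> where "\<theta> = 1 - \<epsilon> / real N"
  have "\<epsilon> / real N < 1" "0 < \<epsilon> / real N" using e N by (auto simp: field_simps)
  then have \<theta>: "0 < \<theta>" "\<theta> < 1" unfolding \<theta>_def by linarith+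
  have "1 - \<epsilon> \<le> \<theta> ^ N"
    using Bernoulli_inequality[of "- (\<epsilon> / real N)" N] N e \<theta> by (simp add: \<theta>_def)
  have le: "(1 - \<epsilon>) ^ (m div N) \<le> \<theta> ^ m / \<theta> ^ N" for m
  proof -
    have "(1 - \<epsilon>) ^ (m div N) \<le> (\<theta> ^ N) ^ (m div N)"
      using \<open>1 - \<epsilon> \<le> \<theta> ^ N\<close> e by (intro power_mono) auto
    also have "\<dots> = \<theta> ^ (N * (m div N))" by (simp add: power_mult)
    also have "\<dots> * \<theta> ^ N = \<theta> ^ (N * (m div N) + N)" by (simp add: power_add)
    also have "\<dots> \<le> \<theta> ^ m"
    proof (rule power_decreasing)
      have "m = N * (m div N) + m mod N" by simp
      moreover have "m mod N < N" using N by simp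
      ultimately show "m \<le> N * (m div N) + N" by linarith
    qed (use \<theta> in auto)
    finally show ?thesis using \<theta> by (simp add: field_simps)
  qed
  have "summable (\<lambda>m. diffs (\<lambda>_. 1) m * \<theta> ^ m)"
    by (rule termdiff_converges[of _ 1]) (use \<theta> in auto)
  then have "summable (\<lambda>m. 2 / \<theta> ^ N * (diffs (\<lambda>_. 1) m * \<theta> ^ m))" by (rule summable_mult)
  then show ?thesis
  proof (rule summable_comparison_test'[where N = 0])
    fix m :: nat
    have "norm ((2 * real m + 1) * (1 - \<epsilon>) ^ (m div N)) = (2 * real m + 1) * (1 - \<epsilon>) ^ (m div N)"
      using e by simp
    also have "\<dots> \<le> (2 * (real m + 1)) * (\<theta> ^ m / \<theta> ^ N)"
      using e by (intro mult_mono le) auto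
    finally show "norm ((2 * real m + 1) * (1 - \<epsilon>) ^ (m div N)) \<le> 2 / \<theta> ^ N * (diffs (\<lambda>_. 1) m * \<theta> ^ m)"
      by (simp add: diffs_def field_simps)
  qed
qed

lemma pmf_eq_nn_integral: "ennreal (pmf p y) = (\<integral>\<^sup>+q. indicator {y} q \<partial>measure_pmf p)"
  by (simp add: emeasure_pmf_single)

section \<open>Symmetries of the hitting law and regeneration at straight runs\<close>

context memory_walk
begin

text \<open>The added prefix links time and space: its length is the hitting time and also the
  length of a word for the displacement, so moments of the one control the other.\<close>

lemma hit_append:
  assumes "hitting step A V" "p \<in> V" "q \<in> set_pmf (hit step A p)"
  shows "q \<in> V \<and> A q \<and> (\<exists>w. q = w @ p \<and> hd q \<otimes> inv (hd p) \<in> words (length w))"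
proof -
  interpret hitting step A V by fact
  define Q where "Q p q \<longleftrightarrow> q \<in> V \<and> A q \<and> (\<exists>w. q = w @ p \<and> hd q \<otimes> inv (hd p) \<in> words (length w))" for p q
  have "Q p q"
    using assms(2)
  proof (rule set_hit_induct)
    fix p q assume p: "p \<in> V" and q: "q \<in> set_pmf (step p)" and A: "A q"
    obtain t where t: "t \<in> S" "q = (hd p \<otimes> t) # p" using set_step[OF p q] by blast
    have "hd p \<otimes> t \<otimes> inv (hd p) = \<one> \<otimes> t"
      using t V_hd_carrier[OF p] S_sub by (simp add: m_comm[of "hd p"] m_assoc subset_iff)
    then have "hd q \<otimes> inv (hd p) \<in> words (length [hd p \<otimes> t])"
      using t by auto
    then show "Q p q" unfolding Q_def using V_closed[OF p q] A t by (auto intro!: exI[of _ "[hd p \<otimes> t]"])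
  next
    fix p q q' assume p: "p \<in> V" and q: "q \<in> set_pmf (step p)" and Q: "Q q q'"
    obtain t where t: "t \<in> S" "q = (hd p \<otimes> t) # p" using set_step[OF p q] by blast
    obtain w where w: "q' \<in> V" "A q'" "q' = w @ q" "hd q' \<otimes> inv (hd q) \<in> words (length w)" using Q by (auto simp: Q_def)
    have c: "t \<in> carrier H" "hd p \<in> carrier H" "hd q' \<in> carrier H" using t S_sub V_hd_carrier p w by auto
    have "hd q' \<otimes> inv (hd p) = hd q' \<otimes> inv (hd q) \<otimes> t"
      using c by (simp add: t(2) inv_mult m_assoc)
    then have "hd q' \<otimes> inv (hd p) \<in> words (length (w @ [hd p \<otimes> t]))"
      using w t by auto
    then show "Q p q'" unfolding Q_def using w t by (auto intro!: exI[of _ "w @ [hd p \<otimes> t]"])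
  qed (rule assms(3))
  then show ?thesis by (simp add: Q_def)
qed

lemma hit_length_tail:
  assumes "hitting step A V" "p \<in> V"
  shows "(\<integral>\<^sup>+q. (if m < length q - length p then 1 else 0) \<partial>hit step A p) \<le> surv step A m p"
  using assms(2)
proof (induction m arbitrary: p)
  case 0
  have "(\<integral>\<^sup>+q. (if 0 < length q - length p then 1 else 0) \<partial>hit step A p) \<le> (\<integral>\<^sup>+q. 1 \<partial>hit step A p)"
    by (rule nn_integral_mono) auto
  then show ?case by simp
next
  case (Suc m)
  interpret hitting step A V by fact
  have "(\<integral>\<^sup>+q. (if Suc m < length q - length p then 1 else 0) \<partial>hit step A p)
     = (\<integral>\<^sup>+q. (if A q then (if Suc m < length q - length p then 1 else 0)
          else (\<integral>\<^sup>+q'. (if Suc m < length q' - length p then 1 else 0) \<partial>hit step A q)) \<partial>step p)"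
    by (rule nn_integral_hit[OF Suc.prems])
  also have "\<dots> \<le> (\<integral>\<^sup>+q. (if A q then 0 else surv step A m q) \<partial>step p)"
  proof (rule nn_integral_pmf_mono)
    fix q assume q: "q \<in> set_pmf (step p)"
    then have l: "length q = Suc (length p)" using set_step[OF Suc.prems] by fastforce
    have "(\<integral>\<^sup>+q'. (if Suc m < length q' - length p then 1 else 0) \<partial>hit step A q)
      = (\<integral>\<^sup>+q'. (if m < length q' - length q then 1 else (0::ennreal)) \<partial>hit step A q)"
      by (rule nn_integral_cong) (auto simp: l)
    also have "\<dots> \<le> surv step A m q" by (rule Suc.IH[OF V_closed[OF Suc.prems q]])
    finally show "(if A q then (if Suc m < length q - length p then 1 else 0)
          else (\<integral>\<^sup>+q'. (if Suc m < length q' - length p then 1 else 0) \<partial>hit step A q))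
        \<le> (if A q then 0 else surv step A m q)"
      using l by auto
  qed
  finally show ?case by simp
qed

definition equivariant :: "('a \<Rightarrow> 'a) \<Rightarrow> bool" where
  "equivariant \<theta> \<longleftrightarrow> (\<forall>t X. (\<forall>i\<le>t. X i \<in> carrier H) \<longrightarrow> K t (\<lambda>i. \<theta> (X i)) = map_pmf \<theta> (K t X))
     \<and> (\<forall>p\<in>V. map \<theta> p \<in> V)"

lemma equivariant_mult: "a \<in> carrier H \<Longrightarrow> equivariant (\<lambda>x. a \<otimes> x)"
proof -
  assume a: "a \<in> carrier H"
  have "map (\<lambda>x. a \<otimes> x) p \<in> V" if p: "p \<in> V" for p
  proof -
    have "\<exists>s\<in>S. map (\<lambda>x. a \<otimes> x) p ! i = map (\<lambda>x. a \<otimes> x) p ! Suc i \<otimes> s" if i: "Suc i < length p" for i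
    proof -
      obtain s where s: "s \<in> S" "p ! i = p ! Suc i \<otimes> s" using p i by (auto simp: V_def)
      have "p ! Suc i \<in> carrier H" "s \<in> carrier H" using V_carrier[OF p] i s S_sub by auto
      then show ?thesis using i s a by (intro bexI[of _ s]) (simp_all add: m_assoc)
    qed
    then show ?thesis using p a by (auto simp: V_def)
  qed
  then show ?thesis unfolding equivariant_def using K_trans[OF a] by simp
qed

lemma equivariant_inv: "equivariant (\<lambda>x. inv x)"
proof -
  have "map (\<lambda>x. inv x) p \<in> V" if p: "p \<in> V" for p
  proof -
    have "\<exists>s\<in>S. map (\<lambda>x. inv x) p ! i = map (\<lambda>x. inv x) p ! Suc i \<otimes> s" if i: "Suc i < length p" for i
    proof -
      obtain s where s: "s \<in> S" "p ! i = p ! Suc i \<otimes> s" using p i by (auto simp: V_def)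
      have "p ! Suc i \<in> carrier H" "s \<in> carrier H" using V_carrier[OF p] i s S_sub by auto
      then show ?thesis using i s by (intro bexI[of _ "inv s"] S_inv) (simp_all add: inv_mult)
    qed
    then show ?thesis using p by (auto simp: V_def)
  qed
  then show ?thesis unfolding equivariant_def using K_inv by auto
qed

text \<open>Pulled back along \<open>\<theta>\<close>, the second law satisfies the bounded
  first-step equation of the first. Uniqueness follows by squeezing between
  \<open>hit_le_supersolution\<close> and \<open>subsolution_le_hit\<close>, applied to the
  indicator of each single path.\<close>

lemma hit_equivariant:
  assumes h: "hitting step A V" and h': "hitting step A' V" and \<theta>: "equivariant \<theta>"
    and A: "\<And>q. q \<in> V \<Longrightarrow> A' (map \<theta> q) \<longleftrightarrow> A q" and p: "p \<in> V"
  shows "hit step A' (map \<theta> p) = map_pmf (map \<theta>) (hit step A p)"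
proof (rule pmf_eqI)
  fix y
  interpret hitting step A V by fact
  interpret h': hitting step A' V by fact
  define F where "F q = (indicator {y} q :: ennreal)" for q :: "'a list"
  define u where "u p = (\<integral>\<^sup>+q. F q \<partial>hit step A' (map \<theta> p))" for p
  have V: "map \<theta> q \<in> V" if "q \<in> V" for q using \<theta> that by (simp add: equivariant_def)
  have u: "u p = (\<integral>\<^sup>+q. (if A q then F (map \<theta> q) else u q) \<partial>step p)" if p: "p \<in> V" for p
  proof -
    have "u p = (\<integral>\<^sup>+q. (if A' q then F q else (\<integral>\<^sup>+q'. F q' \<partial>hit step A' q)) \<partial>step (map \<theta> p))"
      unfolding u_def by (rule h'.nn_integral_hit) (rule V[OF p])
    also have "\<dots> = (\<integral>\<^sup>+q. (if A' (map \<theta> q) then F (map \<theta> q) else u q) \<partial>step p)"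
      unfolding u_def using step_map[OF p, of \<theta>] \<theta>
      by (simp add: equivariant_def )
    also have "\<dots> = (\<integral>\<^sup>+q. (if A q then F (map \<theta> q) else u q) \<partial>step p)"
      by (rule nn_integral_pmf_cong) (use A V_closed[OF p] in auto)
    finally show ?thesis .
  qed
  have u1: "u p \<le> 1" for p
  proof -
    have "u p \<le> (\<integral>\<^sup>+q. 1 \<partial>hit step A' (map \<theta> p))"
      unfolding u_def F_def by (rule nn_integral_mono) (auto split: split_indicator)
    then show ?thesis by simp
  qed
  have "(\<integral>\<^sup>+q. F (map \<theta> q) \<partial>hit step A p) = u p"
  proof (rule antisym)
    show "(\<integral>\<^sup>+q. F (map \<theta> q) \<partial>hit step A p) \<le> u p"
      by (rule hit_le_supersolution) (use u p in \<open>auto simp: F_def split: split_indicator\<close>)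
    show "u p \<le> (\<integral>\<^sup>+q. F (map \<theta> q) \<partial>hit step A p)"
      by (rule subsolution_le_hit[OF u1 eq_refl[OF u] p])
  qed
  moreover have "(\<integral>\<^sup>+q. F (map \<theta> q) \<partial>hit step A p) = (\<integral>\<^sup>+q. F q \<partial>map_pmf (map \<theta>) (hit step A p))"
    by simp
  ultimately have "u p = (\<integral>\<^sup>+q. F q \<partial>map_pmf (map \<theta>) (hit step A p))" by (rule trans[OF sym])
  then have "ennreal (pmf (hit step A' (map \<theta> p)) y) = ennreal (pmf (map_pmf (map \<theta>) (hit step A p)) y)"
    unfolding u_def F_def pmf_eq_nn_integral .
  then show "pmf (hit step A' (map \<theta> p)) y = pmf (map_pmf (map \<theta>) (hit step A p)) y" by simp
qed

lemma run_map_mult: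
  assumes "a \<in> carrier H" "\<sigma> \<in> carrier H" "q \<in> V"
  shows "run \<sigma> n (map (\<lambda>x. a \<otimes> x) q) \<longleftrightarrow> run \<sigma> n q"
proof -
  have eq: "a \<otimes> q ! j = a \<otimes> hd q \<otimes> inv (\<sigma> [^] j) \<longleftrightarrow> q ! j = hd q \<otimes> inv (\<sigma> [^] j)" if "j < length q" for j
    using assms V_hd_carrier[of q] V_carrier[of q "q ! j"] that by (simp add: m_assoc)
  have "run \<sigma> n (map (\<lambda>x. a \<otimes> x) q) \<longleftrightarrow> n < length q \<and> (\<forall>j\<le>n. a \<otimes> q ! j = a \<otimes> hd q \<otimes> inv (\<sigma> [^] j))"
    using V_nonempty[OF assms(3)] by (auto simp: run_def hd_map)
  also have "\<dots> \<longleftrightarrow> run \<sigma> n q" unfolding run_def using eq by (meson le_less_trans)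
  finally show ?thesis .
qed

lemma run_map_inv:
  assumes "\<sigma> \<in> carrier H" "q \<in> V"
  shows "run (inv \<sigma>) n (map (\<lambda>x. inv x) q) \<longleftrightarrow> run \<sigma> n q"
proof -
  have eq: "inv (q ! j) = inv (hd q) \<otimes> inv (inv \<sigma> [^] j) \<longleftrightarrow> q ! j = hd q \<otimes> inv (\<sigma> [^] j)" if "j < length q" for j
  proof -
    have c: "q ! j \<in> carrier H" "hd q \<in> carrier H" using assms V_hd_carrier[of q] V_carrier[of q "q ! j"] that by auto
    have "inv (hd q) \<otimes> inv (inv \<sigma> [^] j) = inv (hd q \<otimes> inv (\<sigma> [^] j))"
      using c assms by (simp add: inv_mult nat_pow_inv)
    then show ?thesis using c assms by (metis inv_closed inv_inv m_closed nat_pow_closed)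
  qed
  have "run (inv \<sigma>) n (map (\<lambda>x. inv x) q) \<longleftrightarrow> n < length q \<and> (\<forall>j\<le>n. inv (q ! j) = inv (hd q) \<otimes> inv (inv \<sigma> [^] j))"
    using V_nonempty[OF assms(2)] by (auto simp: run_def hd_map)
  also have "\<dots> \<longleftrightarrow> run \<sigma> n q" unfolding run_def using eq by (meson le_less_trans)
  finally show ?thesis .
qed

text \<open>A model history with exactly full memory, ending in a run along \<open>\<sigma>\<close>
  at the identity. It stands for all histories that end in such a run; \<open>straight\<close> moves
  its end point to \<open>x\<close>.\<close>

definition past :: "'a \<Rightarrow> 'a list" where
  "past \<sigma> = map (\<lambda>j. inv (\<sigma> [^] j)) [0..<Suc k]"

lemma hd_past: "\<sigma> \<in> carrier H \<Longrightarrow> hd (past \<sigma>) = \<one>"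
  by (simp add: past_def hd_map upt_conv_Cons del: upt_Suc)

lemma past_nth: "j \<le> k \<Longrightarrow> past \<sigma> ! j = inv (\<sigma> [^] j)"
  by (simp add: past_def del: upt_Suc)

lemma length_past: "length (past \<sigma>) = Suc k"
  by (simp add: past_def)

lemma past_V:
  assumes "\<sigma> \<in> S"
  shows "past \<sigma> \<in> V"
proof -
  have c: "\<sigma> \<in> carrier H" using assms S_sub by auto
  have "\<exists>s\<in>S. past \<sigma> ! i = past \<sigma> ! Suc i \<otimes> s" if "Suc i < length (past \<sigma>)" for i
  proof -
    have "inv (\<sigma> [^] Suc i) = inv (\<sigma> [^] i) \<otimes> inv \<sigma>" using c by (simp add: inv_mult)
    then show ?thesis
      using that assms c by (intro bexI[of _ \<sigma>]) (simp_all add: past_nth length_past m_assoc del: nat_pow_Suc)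
  qed
  then show ?thesis using c by (auto simp: V_def past_def)
qed

lemma run_past: "\<sigma> \<in> carrier H \<Longrightarrow> run \<sigma> k (past \<sigma>)"
  by (auto simp: run_def length_past hd_past past_nth)

lemma past_inv: "\<sigma> \<in> carrier H \<Longrightarrow> past (inv \<sigma>) = map (\<lambda>x. inv x) (past \<sigma>)"
  by (auto simp: past_def nat_pow_inv)

definition straight :: "'a \<Rightarrow> 'a \<Rightarrow> 'a list" where
  "straight \<sigma> x = map (\<lambda>y. x \<otimes> y) (past \<sigma>)"

lemma straight_V: "\<sigma> \<in> S \<Longrightarrow> x \<in> carrier H \<Longrightarrow> straight \<sigma> x \<in> V"
  using equivariant_mult[of x] past_V by (simp add: straight_def equivariant_def)

lemma hd_straight: "\<sigma> \<in> carrier H \<Longrightarrow> x \<in> carrier H \<Longrightarrow> hd (straight \<sigma> x) = x"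
  using hd_past[of \<sigma>] length_past[of \<sigma>] by (cases "past \<sigma>") (simp_all add: straight_def)

lemma run_straight: "\<sigma> \<in> S \<Longrightarrow> x \<in> carrier H \<Longrightarrow> run \<sigma> k (straight \<sigma> x)"
  unfolding straight_def using run_map_mult[of x \<sigma> "past \<sigma>" k] run_past past_V S_sub by auto

text \<open>The restriction to lists of at least \<open>k + 1\<close> positions matches
  \<open>K_memory\<close>, which says nothing about earlier times.\<close>

definition forgets :: "('a list \<Rightarrow> ennreal) \<Rightarrow> bool" where
  "forgets F \<longleftrightarrow> (\<forall>p q. Suc k \<le> length p \<longrightarrow> Suc k \<le> length q \<longrightarrow> take (Suc k) p = take (Suc k) q \<longrightarrow> F p = F q)"

lemma forgets_step:
  assumes "forgets F"
  shows "forgets (\<lambda>p. \<integral>\<^sup>+q. G (hd q) (F q) \<partial>step p)"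
  unfolding forgets_def
proof (intro allI impI)
  fix p q :: "'a list"
  assume l: "Suc k \<le> length p" "Suc k \<le> length q" and eq: "take (Suc k) p = take (Suc k) q"
  have "take k p = take k q" using eq by (metis min.absorb1 lessI less_imp_le take_take)
  then have F: "F (z # p) = F (z # q)" for z using assms l by (auto simp: forgets_def)
  have "\<kappa> p = \<kappa> q" using \<kappa>_take[OF l(1)] \<kappa>_take[OF l(2)] eq by simp
  then show "(\<integral>\<^sup>+q. G (hd q) (F q) \<partial>step p) = (\<integral>\<^sup>+q. G (hd q) (F q) \<partial>step q)"
    by (simp add: step_def  F)
qed

text \<open>Regeneration: after a run of length \<open>k\<close> the window is determined by its
  direction and its end point.\<close>

lemma forgets_straight:
  assumes "forgets F" "q \<in> V" "run \<sigma> k q" "\<sigma> \<in> carrier H"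
  shows "F q = F (straight \<sigma> (hd q))"
proof -
  have l: "Suc k \<le> length q" using assms(3) by (simp add: run_def)
  have "take (Suc k) q = take (Suc k) (straight \<sigma> (hd q))"
  proof (rule nth_equalityI)
    show "length (take (Suc k) q) = length (take (Suc k) (straight \<sigma> (hd q)))"
      using l by (simp add: straight_def length_past)
    fix i assume "i < length (take (Suc k) q)"
    then have i: "i \<le> k" using l by simp
    then show "take (Suc k) q ! i = take (Suc k) (straight \<sigma> (hd q)) ! i"
      using assms(3) by (simp add: straight_def past_nth length_past run_def)
  qed
  moreover have "Suc k \<le> length (straight \<sigma> (hd q))" by (simp add: straight_def length_past)
  ultimately show ?thesis using assms(1) l unfolding forgets_def by blast
qed

end

section \<open>Cycle lengths and the step law of the embedded walk\<close>

context direction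
begin

lemma inv_s_carrier: "inv s \<in> carrier H"
  using sc by simp

text \<open>Writing n^2 as the sum of 2 m + 1 over m < n turns the second moment into a weighted sum
  of tails. These decay geometrically per block of \<open>N0\<close> steps, uniformly in the
  starting path.\<close>

lemma second_moment:
  "\<exists>B<\<infinity>. \<forall>p\<in>V. (\<integral>\<^sup>+q. ennreal ((real (length q - length p))\<^sup>2) \<partial>hit step (run s k) p) \<le> B"
proof -
  define B where "B = (\<Sum>m. ennreal ((2 * real m + 1) * (1 - \<epsilon>) ^ (m div N0)))"
  have "2 \<le> N0" using k by (simp add: N0_def L_def)
  then have sm: "summable (\<lambda>m. (2 * real m + 1) * (1 - \<epsilon>) ^ (m div N0))"
    by (rule summable_linear_geometric_div[OF \<epsilon>_pos \<epsilon>_le_1])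
  have "B \<noteq> \<infinity>" unfolding B_def
    unfolding infinity_ennreal_def by (rule ennreal_suminf_neq_top[OF sm]) (use \<epsilon>_le_1 in simp)
  then have B: "B < \<infinity>" by (simp add: less_top)
  have "(\<integral>\<^sup>+q. ennreal ((real (length q - length p))\<^sup>2) \<partial>hit step (run s k) p) \<le> B" if p: "p \<in> V" for p
  proof -
    have sq: "ennreal ((real n)\<^sup>2) = (\<Sum>m. ennreal (2 * real m + 1) * (if m < n then 1 else 0))" for n
    proof -
      have "(\<Sum>m. ennreal (2 * real m + 1) * (if m < n then 1 else 0)) = (\<Sum>m<n. ennreal (2 * real m + 1) * (if m < n then 1 else 0))"
        by (rule suminf_finite) auto
      also have "\<dots> = ennreal (\<Sum>m<n. 2 * real m + 1)"
        by (subst sum_ennreal[symmetric]) auto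
      also have "(\<Sum>m<n. 2 * real m + 1) = (real n)\<^sup>2"
        by (induction n) (auto simp: power2_eq_square algebra_simps)
      finally show ?thesis by simp
    qed
    have "(\<integral>\<^sup>+q. ennreal ((real (length q - length p))\<^sup>2) \<partial>hit step (run s k) p)
       = (\<Sum>m. ennreal (2 * real m + 1) * (\<integral>\<^sup>+q. (if m < length q - length p then 1 else 0) \<partial>hit step (run s k) p))"
      unfolding sq by (simp add: nn_integral_suminf nn_integral_cmult)
    also have "\<dots> \<le> B"
      unfolding B_def
    proof (rule suminf_le)
      fix m
      have "(\<integral>\<^sup>+q. (if m < length q - length p then 1 else 0) \<partial>hit step (run s k) p) \<le> surv step (run s k) m p"
        by (rule hit_length_tail[OF hitting_run p])
      also have "\<dots> \<le> surv step (run s k) ((m div N0) * N0) p" by (rule surv_antimono) simp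
      also have "\<dots> \<le> ennreal (1 - \<epsilon>) ^ (m div N0)" by (rule surv_power_le[OF V_closed surv_run p])
      also have "\<dots> = ennreal ((1 - \<epsilon>) ^ (m div N0))" using \<epsilon>_le_1 by (simp add: ennreal_power)
      finally have le: "(\<integral>\<^sup>+q. (if m < length q - length p then 1 else 0) \<partial>hit step (run s k) p) \<le> ennreal ((1 - \<epsilon>) ^ (m div N0))" .
      have "ennreal ((2 * real m + 1) * (1 - \<epsilon>) ^ (m div N0)) = ennreal (2 * real m + 1) * ennreal ((1 - \<epsilon>) ^ (m div N0))"
        using \<epsilon>_le_1 by (intro ennreal_mult) auto
      then show "ennreal (2 * real m + 1) * (\<integral>\<^sup>+q. (if m < length q - length p then 1 else 0) \<partial>hit step (run s k) p)
        \<le> ennreal ((2 * real m + 1) * (1 - \<epsilon>) ^ (m div N0))"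
        using mult_left_mono[OF le, of "ennreal (2 * real m + 1)"] by (simp only: zero_le)
    qed (rule summableI)+
    finally show ?thesis .
  qed
  then show ?thesis by (intro exI[of _ B] conjI ballI B)
qed

abbreviation P :: "'a list \<Rightarrow> bool" where "P \<equiv> run s k"
abbreviation M :: "'a list \<Rightarrow> bool" where "M \<equiv> run (inv s) k"

lemma hitting_M: "hitting step M V"
  by (rule direction.hitting_run[OF direction_inv])

lemma second_moment_M:
  "\<exists>B<\<infinity>. \<forall>p\<in>V. (\<integral>\<^sup>+q. ennreal ((real (length q - length p))\<^sup>2) \<partial>hit step M p) \<le> B"
  by (rule direction.second_moment[OF direction_inv])

text \<open>The displacement from a straight run along \<open>s\<close> to the next straight run along \<open>inv s\<close>. By
  inversion, the next such displacement is distributed as the inverse of an independent copy of the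
  first; so the walk observed at every second change of direction has the symmetric steps \<open>\<mu>\<close>.\<close>

definition \<nu> :: "'a pmf" where
  "\<nu> = map_pmf hd (hit step M (past s))"

definition \<mu> :: "'a pmf" where
  "\<mu> = bind_pmf \<nu> (\<lambda>a. map_pmf (\<lambda>b. a \<otimes> inv b) \<nu>)"

lemma \<nu>_carrier: "set_pmf \<nu> \<subseteq> carrier H"
  using hit_append[OF hitting_M past_V[OF s]] V_hd_carrier by (auto simp: \<nu>_def)

lemma nn_integral_\<mu>: "(\<integral>\<^sup>+h. F h \<partial>\<mu>) = (\<integral>\<^sup>+a. \<integral>\<^sup>+b. F (a \<otimes> inv b) \<partial>\<nu> \<partial>\<nu>)"
  by (simp add: \<mu>_def )

text \<open>Inversion takes a b^-1 to b a^-1, which exchanges the two independent factors.\<close>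

lemma sym_walk_\<mu>: "sym_walk H S \<mu>"
proof
  show "set_pmf \<mu> \<subseteq> carrier H" using \<nu>_carrier by (auto simp: \<mu>_def)
  have "map_pmf (\<lambda>h. inv h) \<mu> = bind_pmf \<nu> (\<lambda>a. bind_pmf \<nu> (\<lambda>b. return_pmf (b \<otimes> inv a)))"
    unfolding \<mu>_def map_bind_pmf map_pmf_comp unfolding map_pmf_def
    using \<nu>_carrier by (intro bind_pmf_cong refl) (simp add: inv_mult m_comm subset_iff)
  also have "\<dots> = \<mu>"
    unfolding \<mu>_def map_pmf_def by (rule bind_commute_pmf)
  finally show "map_pmf (\<lambda>h. inv h) \<mu> = \<mu>" .
qed

lemma nn_integral_hit_M:
  assumes F: "forgets F" and x: "x \<in> carrier H"
  shows "(\<integral>\<^sup>+q. F q \<partial>hit step M (straight s x)) = (\<integral>\<^sup>+a. F (straight (inv s) (x \<otimes> a)) \<partial>\<nu>)"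
proof -
  have "hit step M (straight s x) = map_pmf (map (\<lambda>y. x \<otimes> y)) (hit step M (past s))"
    unfolding straight_def
    by (rule hit_equivariant[OF hitting_M hitting_M equivariant_mult[OF x]])
      (use x inv_s_carrier run_map_mult past_V[OF s] in auto)
  then have "(\<integral>\<^sup>+q. F q \<partial>hit step M (straight s x)) = (\<integral>\<^sup>+q. F (map (\<lambda>y. x \<otimes> y) q) \<partial>hit step M (past s))"
    by simp
  also have "\<dots> = (\<integral>\<^sup>+q. F (straight (inv s) (x \<otimes> hd q)) \<partial>hit step M (past s))"
  proof (rule nn_integral_pmf_cong)
    fix q assume "q \<in> set_pmf (hit step M (past s))"
    then have q: "q \<in> V" "M q" using hit_append[OF hitting_M past_V[OF s]] by auto
    have "map (\<lambda>y. x \<otimes> y) q \<in> V" using equivariant_mult[OF x] q by (simp add: equivariant_def)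
    moreover have "M (map (\<lambda>y. x \<otimes> y) q)" using run_map_mult[OF x inv_s_carrier q(1)] q(2) by simp
    ultimately show "F (map (\<lambda>y. x \<otimes> y) q) = F (straight (inv s) (x \<otimes> hd q))"
      using forgets_straight[OF F _ _ inv_s_carrier] V_nonempty[OF q(1)] by (auto simp: hd_map)
  qed
  also have "\<dots> = (\<integral>\<^sup>+a. F (straight (inv s) (x \<otimes> a)) \<partial>\<nu>)"
    by (simp add: \<nu>_def )
  finally show ?thesis .
qed

text \<open>The map from y to x y^-1 carries the model history along \<open>s\<close> to the one
  along \<open>inv s\<close> that ends at \<open>x\<close>, and it exchanges \<open>M\<close> with
  \<open>P\<close>. So the second half of a cycle is governed by the same \<open>\<nu>\<close>,
  inverted.\<close>

lemma nn_integral_hit_P: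
  assumes F: "forgets F" and x: "x \<in> carrier H"
  shows "(\<integral>\<^sup>+q. F q \<partial>hit step P (straight (inv s) x)) = (\<integral>\<^sup>+a. F (straight s (x \<otimes> inv a)) \<partial>\<nu>)"
proof -
  define \<theta> where "\<theta> = (\<lambda>y. x \<otimes> inv y)"
  have \<theta>: "map \<theta> q = map (\<lambda>y. x \<otimes> y) (map (\<lambda>y. inv y) q)" for q by (simp add: \<theta>_def)
  have iV: "map (\<lambda>y. inv y) q \<in> V" if "q \<in> V" for q using equivariant_inv that by (simp add: equivariant_def)
  have \<theta>V: "map \<theta> q \<in> V" if "q \<in> V" for q
    unfolding \<theta> using equivariant_mult[OF x] iV[OF that] by (simp add: equivariant_def del: map_map)
  have eq: "equivariant \<theta>"
    unfolding equivariant_def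
  proof (intro conjI allI impI ballI)
    fix t :: nat and X assume X: "\<forall>i\<le>t. X i \<in> carrier H"
    have "K t (\<lambda>i. \<theta> (X i)) = map_pmf (\<lambda>y. x \<otimes> y) (K t (\<lambda>i. inv (X i)))"
      unfolding \<theta>_def using X x by (intro K_trans) auto
    also have "K t (\<lambda>i. inv (X i)) = map_pmf (\<lambda>y. inv y) (K t X)"
      using X by (intro K_inv) auto
    finally show "K t (\<lambda>i. \<theta> (X i)) = map_pmf \<theta> (K t X)" by (simp add: map_pmf_comp \<theta>_def)
  qed (rule \<theta>V)
  have PM: "P (map \<theta> q) \<longleftrightarrow> M q" if q: "q \<in> V" for q
    unfolding \<theta> using run_map_mult[OF x sc iV[OF q]] run_map_inv[OF inv_s_carrier q, of k] sc by simp
  have "straight (inv s) x = map \<theta> (past s)" unfolding straight_def \<theta> past_inv[OF sc] ..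
  then have "hit step P (straight (inv s) x) = map_pmf (map \<theta>) (hit step M (past s))"
    using hit_equivariant[OF hitting_M hitting_run eq PM past_V[OF s]] by simp
  then have "(\<integral>\<^sup>+q. F q \<partial>hit step P (straight (inv s) x)) = (\<integral>\<^sup>+q. F (map \<theta> q) \<partial>hit step M (past s))"
    by simp
  also have "\<dots> = (\<integral>\<^sup>+q. F (straight s (x \<otimes> inv (hd q))) \<partial>hit step M (past s))"
  proof (rule nn_integral_pmf_cong)
    fix q assume "q \<in> set_pmf (hit step M (past s))"
    then have q: "q \<in> V" "M q" using hit_append[OF hitting_M past_V[OF s]] by auto
    show "F (map \<theta> q) = F (straight s (x \<otimes> inv (hd q)))"
      using forgets_straight[OF F \<theta>V[OF q(1)] _ sc] PM[OF q(1)] q V_nonempty[OF q(1)] by (simp add: hd_map \<theta>_def)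
  qed
  also have "\<dots> = (\<integral>\<^sup>+a. F (straight s (x \<otimes> inv a)) \<partial>\<nu>)"
    by (simp add: \<nu>_def )
  finally show ?thesis .
qed

abbreviation E :: "('a \<Rightarrow> real) \<Rightarrow> ennreal" where
  "E f \<equiv> \<integral>\<^sup>+h. D h f \<partial>\<mu>"

text \<open>A displacement made in n steps costs n^2 by \<open>D_words\<close>, so the second moment
  bounds the form of \<open>\<nu>\<close>; splitting a b^-1 with \<open>D_mult_2\<close> contributes
  the factor 2 + 2 = 4.\<close>

lemma E_\<mu>_le_energy: "\<exists>C\<ge>0. \<forall>f. E f \<le> ennreal C * energy f"
proof -
  obtain B where B: "B < \<infinity>" "\<And>p. p \<in> V \<Longrightarrow> (\<integral>\<^sup>+q. ennreal ((real (length q - length p))\<^sup>2) \<partial>hit step M p) \<le> B"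
    using second_moment_M by blast
  obtain b where b: "B = ennreal b" "0 \<le> b" using B(1) by (cases B) auto
  have \<nu>: "(\<integral>\<^sup>+h. D h f \<partial>\<nu>) \<le> B * energy f" for f
  proof -
    have "(\<integral>\<^sup>+h. D h f \<partial>\<nu>) = (\<integral>\<^sup>+q. D (hd q) f \<partial>hit step M (past s))"
      by (simp add: \<nu>_def )
    also have "\<dots> \<le> (\<integral>\<^sup>+q. ennreal ((real (length q - length (past s)))\<^sup>2) * energy f \<partial>hit step M (past s))"
    proof (rule nn_integral_pmf_mono)
      fix q assume "q \<in> set_pmf (hit step M (past s))"
      then obtain w where w: "q \<in> V" "q = w @ past s" "hd q \<otimes> inv (hd (past s)) \<in> words (length w)"
        using hit_append[OF hitting_M past_V[OF s]] by blast
      then have "hd q \<in> words (length q - length (past s))"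
        using V_hd_carrier[OF w(1)] sc by (simp add: hd_past)
      then show "D (hd q) f \<le> ennreal ((real (length q - length (past s)))\<^sup>2) * energy f"
        by (rule D_words)
    qed
    also have "\<dots> \<le> B * energy f"
      by (simp add: nn_integral_multc mult_right_mono B(2) past_V[OF s])
    finally show ?thesis .
  qed
  have "E f \<le> ennreal (4 * b) * energy f" for f
  proof -
    have "E f \<le> (\<integral>\<^sup>+a. \<integral>\<^sup>+c. 2 * D c f + 2 * D a f \<partial>\<nu> \<partial>\<nu>)"
      unfolding nn_integral_\<mu>
    proof (intro nn_integral_pmf_mono)
      fix a c assume "a \<in> set_pmf \<nu>" "c \<in> set_pmf \<nu>"
      then have "a \<in> carrier H" "c \<in> carrier H" using \<nu>_carrier by auto
      then show "D (a \<otimes> inv c) f \<le> 2 * D c f + 2 * D a f"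
        using D_mult_2[of a "inv c" f] by (simp add: D_inv)
    qed
    also have "\<dots> = 4 * (\<integral>\<^sup>+h. D h f \<partial>\<nu>)"
      by (simp add: nn_integral_add nn_integral_cmult distrib_right[symmetric])
    also have "\<dots> \<le> 4 * (B * energy f)" by (rule mult_left_mono[OF \<nu>]) simp
    also have "\<dots> = ennreal (4 * b) * energy f" using b by (simp add: ennreal_mult mult.assoc)
    finally show ?thesis .
  qed
  then show ?thesis using b(2) by (intro exI[of _ "4 * b"]) auto
qed

end

section \<open>The symmetric walk at changes of direction\<close>

context direction
begin

lemma run_ConsD:
  assumes q: "q \<in> V" and t: "t \<in> S" and \<tau>: "\<tau> \<in> carrier H" and run: "run \<tau> (Suc n) ((hd q \<otimes> t) # q)"
  shows "run \<tau> n q" "t = \<tau>"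
proof -
  let ?q = "(hd q \<otimes> t) # q"
  have c: "t \<in> carrier H" "hd q \<in> carrier H" using t S_sub V_hd_carrier[OF q] by auto
  have nth: "?q ! j = hd q \<otimes> t \<otimes> inv (\<tau> [^] j)" if "j \<le> Suc n" for j
    using run that by (simp add: run_def)
  have "hd q = hd q \<otimes> t \<otimes> inv \<tau>"
    using nth[of 1] V_nonempty[OF q] \<tau> by (simp add: hd_conv_nth[symmetric])
  then have "hd q \<otimes> \<tau> = hd q \<otimes> t" using c \<tau> by (metis inv_solve_right m_closed)
  then show t\<tau>: "t = \<tau>" using c \<tau> by simp
  have "q ! j = hd q \<otimes> inv (\<tau> [^] j)" if "j \<le> n" for j
  proof -
    have "q ! j = hd q \<otimes> \<tau> \<otimes> inv (\<tau> [^] Suc j)" using nth[of "Suc j"] that t\<tau> by simp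
    also have "\<dots> = hd q \<otimes> inv (\<tau> [^] j)"
    proof -
      have "inv (\<tau> [^] Suc j) = inv \<tau> \<otimes> inv (\<tau> [^] j)" using \<tau> by (simp add: inv_mult_group)
      then show ?thesis using c \<tau> by (simp add: m_assoc) (simp add: m_assoc[symmetric])
    qed
    finally show ?thesis .
  qed
  then show "run \<tau> n q" using run by (simp add: run_def)
qed

lemma not_M_Cons:
  assumes "q \<in> V" "t \<in> S" "t \<noteq> inv s"
  shows "\<not> M ((hd q \<otimes> t) # q)"
proof
  assume "M ((hd q \<otimes> t) # q)"
  moreover obtain k' where "k = Suc k'" using k by (cases k) auto
  ultimately show False using run_ConsD(2)[OF assms(1,2) inv_s_carrier] assms(3) by auto
qed

lemma step_fresh:
  assumes "p \<in> V" "t \<in> S" "hd p \<otimes> t \<notin> recent p"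
  shows "(hd p \<otimes> t) # p \<in> set_pmf (step p)"
proof -
  have "0 < 1 / real (card S)" using card_S_pos by simp
  also have "\<dots> \<le> pmf (step p) ((hd p \<otimes> t) # p)" by (rule pmf_step_fresh[OF assms])
  finally show ?thesis by (simp add: set_pmf_iff)
qed

text \<open>A step other than \<open>inv s\<close> cannot complete a run along \<open>inv s\<close>.
  Hence \<open>M\<close> does not occur during the prefix, and the first hit after it is the first
  hit from \<open>p\<close>.\<close>

lemma hit_M_ext:
  assumes "p \<in> V" "fresh p \<sigma>s" "inv s \<notin> set \<sigma>s" "q \<in> set_pmf (hit step M (ext p \<sigma>s))"
  shows "q \<in> set_pmf (hit step M p)"
  using assms
proof (induction \<sigma>s arbitrary: p)
  case (Cons \<sigma> \<sigma>s)
  interpret hm: hitting step M V by (rule hitting_M)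
  let ?p = "(hd p \<otimes> \<sigma>) # p"
  have "q \<in> set_pmf (hit step M ?p)" using Cons V_Cons by auto
  moreover have "\<not> M ?p" using Cons.prems by (intro not_M_Cons) auto
  ultimately show ?case
    using Cons.prems by (intro hm.in_set_hit[where q = ?p]) (auto intro: step_fresh)
qed simp

text \<open>The negated hypothesis says that the run along \<open>inv s\<close> present at
  \<open>q\<close> has length at most \<open>k - m\<close>. Each of the \<open>m\<close> steps
  lengthens it by one, so \<open>M\<close> is met at the end of the script and not earlier.\<close>

lemma hit_M_straight:
  assumes "q \<in> V" "1 \<le> m" "m \<le> k" "fresh q (replicate m (inv s))"
    "\<not> run (inv s) (Suc (k - m)) q" "M (ext q (replicate m (inv s)))"
  shows "ext q (replicate m (inv s)) \<in> set_pmf (hit step M q)"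
  using assms
proof (induction m arbitrary: q)
  case (Suc m)
  interpret hm: hitting step M V by (rule hitting_M)
  let ?q = "(hd q \<otimes> inv s) # q"
  have st: "?q \<in> set_pmf (step q)" using Suc.prems by (intro step_fresh) auto
  have qV: "?q \<in> V" using Suc.prems inv_s by (simp add: V_Cons)
  show ?case
  proof (cases "m = 0")
    case True
    then have "M ?q" using Suc.prems(6) by simp
    then show ?thesis using True st by (intro hm.in_set_hit[OF Suc.prems(1) st]) simp
  next
    case False
    have "k - m = Suc (k - Suc m)" using Suc.prems(3) by simp
    then have nr: "\<not> run (inv s) (Suc (k - m)) ?q"
      using Suc.prems(5) run_ConsD(1)[OF Suc.prems(1) inv_s inv_s_carrier, of "k - m"] by auto
    have "\<not> M ?q"
    proof
      assume "M ?q"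
      then have "run (inv s) (Suc (k - m)) ?q" by (rule run_mono) (use False Suc.prems(3) in auto)
      with nr show False ..
    qed
    moreover have "ext ?q (replicate m (inv s)) \<in> set_pmf (hit step M ?q)"
      by (rule Suc.IH) (use Suc.prems False qV nr in auto)
    ultimately show ?thesis by (intro hm.in_set_hit[OF Suc.prems(1) st]) auto
  qed
qed simp

lemma hd_ext_replicate: "\<sigma> \<in> S \<Longrightarrow> p \<in> V \<Longrightarrow> hd (ext p (replicate n \<sigma>)) = hd p \<otimes> \<sigma> [^] n"
proof (induction n arbitrary: p)
  case (Suc n)
  have c: "\<sigma> \<in> carrier H" "hd p \<in> carrier H" using Suc.prems S_sub V_hd_carrier by auto
  have "hd (ext p (replicate (Suc n) \<sigma>)) = hd p \<otimes> \<sigma> \<otimes> \<sigma> [^] n"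
    using Suc.IH[OF Suc.prems(1), of "(hd p \<otimes> \<sigma>) # p"] V_Cons[OF Suc.prems(2,1)] by simp
  also have "\<dots> = hd p \<otimes> \<sigma> [^] Suc n" using c by (simp add: m_ac)
  finally show ?case .
qed (simp add: V_hd_carrier)

lemma turn_in_hit:
  assumes p: "p \<in> V" and line: "line p" and \<rho>: "\<rho> \<in> S" "\<And>m::int. \<rho> \<noteq> s [^] m"
  shows "hd p \<otimes> \<rho> \<otimes> inv s [^] k \<in> hd ` set_pmf (hit step M p)"
proof -
  let ?q = "(hd p \<otimes> \<rho>) # p"
  have ns: "\<rho> \<noteq> inv s" using \<rho>(2)[of "- 1"] sc by (auto simp: int_pow_neg)
  have f: "fresh p (\<rho> # replicate k (inv s))" by (rule fresh_turn[OF p line \<rho>]) simp_all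
  have qV: "?q \<in> V" using p \<rho> by (simp add: V_Cons)
  have "ext ?q (replicate k (inv s)) \<in> set_pmf (hit step M ?q)"
  proof (rule hit_M_straight[OF qV k order_refl])
    show "\<not> run (inv s) (Suc (k - k)) ?q" using run_ConsD(2)[OF p \<rho>(1) inv_s_carrier] ns by blast
    show "M (ext ?q (replicate k (inv s)))" by (rule run_replicate'[OF qV inv_s])
  qed (use f in simp)
  then have "ext ?q (replicate k (inv s)) \<in> set_pmf (hit step M p)"
    using hit_M_ext[OF p, of "[\<rho>]"] f ns by simp
  moreover have "hd (ext ?q (replicate k (inv s))) = hd p \<otimes> \<rho> \<otimes> inv s [^] k"
    using hd_ext_replicate[OF inv_s qV] by simp
  ultimately show ?thesis by force
qed

lemma s_neq_inv_s: "s \<noteq> inv s"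
  using \<phi>_inv[OF sc] \<phi>s by auto

lemma \<nu>_via_ext:
  assumes f: "fresh (past s) \<sigma>s" and n: "inv s \<notin> set \<sigma>s" and line: "line (ext (past s) \<sigma>s)"
    and \<rho>: "\<rho> \<in> S" "\<And>m::int. \<rho> \<noteq> s [^] m"
  shows "hd (ext (past s) \<sigma>s) \<otimes> \<rho> \<otimes> inv s [^] k \<in> set_pmf \<nu>"
proof -
  have "ext (past s) \<sigma>s \<in> V" by (rule ext_V[OF past_V[OF s] f])
  then obtain q where "q \<in> set_pmf (hit step M (ext (past s) \<sigma>s))"
    "hd (ext (past s) \<sigma>s) \<otimes> \<rho> \<otimes> inv s [^] k = hd q"
    using turn_in_hit[OF _ line \<rho>] by blast
  then show ?thesis using hit_M_ext[OF past_V[OF s] f n] by (auto simp: \<nu>_def)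
qed

lemma fresh_along:
  assumes p: "p \<in> V" and run: "run s k p"
  shows "hd p \<otimes> s \<notin> recent p"
proof
  assume "hd p \<otimes> s \<in> recent p"
  then obtain j where j: "j \<le> k" "p ! j = hd p \<otimes> s" by (auto simp: in_set_conv_nth less_Suc_eq_le)
  then have "hd p \<otimes> inv (s [^] j) = hd p \<otimes> s" using run by (simp add: run_def)
  then have "inv (s [^] j) = s" using V_hd_carrier[OF p] sc by simp
  then have "\<phi> s = - (int j * \<phi> s)" using \<phi>_inv[of "s [^] j"] \<phi>_pow[OF sc, of j] sc by simp
  moreover have "0 \<le> int j * \<phi> s" using \<phi>s by simp
  ultimately show False using \<phi>s by linarith
qed

text \<open>The support of \<open>\<mu>\<close> consists of the quotients of displacements in the
  support of \<open>\<nu>\<close>. The displacements s r s^-k and r s^-k have quotient s. For a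
  generator \<open>\<rho>\<close> outside the subgroup of \<open>s\<close>, the displacements \<rho>
  s^k r s^-k and r s^-k have quotient \<rho> s^k, which together with s yields \<rho>. The scripts
  avoid \<open>inv s\<close> until the final run, so they do end at the first occurrence of
  \<open>M\<close>.\<close>

lemma \<mu>_generates:
  assumes B: "subgroup B H" and sub: "set_pmf \<mu> \<subseteq> B"
  shows "carrier H \<subseteq> B"
proof -
  have BH: "B \<subseteq> carrier H" using B by (rule subgroup.subset)
  have diff: "a \<otimes> inv b \<in> B" if "a \<in> set_pmf \<nu>" "b \<in> set_pmf \<nu>" for a b
    using that sub by (auto simp: \<mu>_def)
  have p: "past s \<in> V" and rp: "run s k (past s)" using past_V[OF s] run_past[OF sc] by auto
  have lp: "line (past s)" using line_run rp by blast
  have base: "r \<otimes> inv s [^] k \<in> set_pmf \<nu>"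
    using \<nu>_via_ext[of "[]", OF _ _ _ r r_notin] lp rc sc by (simp add: hd_past)
  have fs: "fresh (past s) [s]"
    using fresh_along[OF p rp] s by simp
  have "line (ext (past s) [s])"
    using line_run[of s] run_mono[OF run_Cons[OF p s rp], of k] by simp
  then have "s \<otimes> r \<otimes> inv s [^] k \<in> set_pmf \<nu>"
    using \<nu>_via_ext[OF fs _ _ r r_notin] s_neq_inv_s sc by (simp add: hd_past)
  then have "s \<otimes> r \<otimes> inv s [^] k \<otimes> inv (r \<otimes> inv s [^] k) \<in> B" by (rule diff[OF _ base])
  moreover have "s \<otimes> r \<otimes> inv s [^] k \<otimes> inv (r \<otimes> inv s [^] k) = s"
    using sc rc by (simp add: m_assoc)
  ultimately have sB: "s \<in> B" by simp
  have powB: "s [^] m \<in> B" for m :: int by (rule subgroup_int_pow_closed[OF B sB])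
  have "S \<subseteq> B"
  proof
    fix \<rho> assume \<rho>: "\<rho> \<in> S"
    show "\<rho> \<in> B"
    proof (cases "\<exists>m::int. \<rho> = s [^] m")
      case True then show ?thesis using powB by auto
    next
      case False
      then have \<rho>n: "\<rho> \<noteq> s [^] m" for m :: int by auto
      have \<rho>c: "\<rho> \<in> carrier H" using \<rho> S_sub by auto
      let ?\<sigma> = "\<rho> # replicate k s"
      have f: "fresh (past s) ?\<sigma>" by (rule fresh_turn[OF p lp \<rho> \<rho>n]) simp
      have n: "inv s \<notin> set ?\<sigma>" using s_neq_inv_s \<rho>n[of "- 1"] sc by (auto simp: int_pow_neg)
      have qV: "(hd (past s) \<otimes> \<rho>) # past s \<in> V" using p \<rho> by (rule V_Cons)
      have "line (ext (past s) ?\<sigma>)" using line_run[of s] run_replicate'[OF qV s, of k] by simp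
      then have "\<rho> \<otimes> s [^] k \<otimes> r \<otimes> inv s [^] k \<in> set_pmf \<nu>"
        using \<nu>_via_ext[OF f n _ r r_notin] hd_ext_replicate[OF s qV, of k] \<rho>c sc by (simp add: hd_past)
      then have "\<rho> \<otimes> s [^] k \<otimes> r \<otimes> inv s [^] k \<otimes> inv (r \<otimes> inv s [^] k) \<in> B" by (rule diff[OF _ base])
      moreover have "\<rho> \<otimes> s [^] k \<otimes> r \<otimes> inv s [^] k \<otimes> inv (r \<otimes> inv s [^] k) = \<rho> \<otimes> s [^] k"
        using sc rc \<rho>c by (simp add: m_assoc)
      ultimately have "\<rho> \<otimes> s [^] k \<in> B" by simp
      moreover have "inv (s [^] k) \<in> B" using powB[of "int k"] B by (simp add: int_pow_int subgroup.m_inv_closed)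
      ultimately have "\<rho> \<otimes> s [^] k \<otimes> inv (s [^] k) \<in> B" using B by (rule subgroup.m_closed[rotated])
      then show ?thesis using \<rho>c sc by (simp add: m_assoc)
    qed
  qed
  then show ?thesis using S_gen generate_subgroup_incl[OF _ B] by blast
qed

text \<open>By \<open>D_mult_2\<close> the elements whose form is dominated by \<open>E\<close> are
  a subgroup. It contains each atom of \<open>\<mu>\<close>, with the reciprocal of the mass as
  constant, hence all of \<open>H\<close>; the constants for the finitely many generators add
  up.\<close>

lemma energy_le_E_\<mu>: "\<exists>C. \<forall>f. energy f \<le> ennreal C * E f"
proof -
  define B where "B = {h \<in> carrier H. \<exists>c\<ge>0. \<forall>f. D h f \<le> ennreal c * E f}"
  have "subgroup B H"
  proof (rule subgroupI)
    show "B \<subseteq> carrier H" by (auto simp: B_def)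
    have "\<one> \<in> B" by (auto simp: B_def D_one)
    then show "B \<noteq> {}" by blast
    show "inv a \<in> B" if "a \<in> B" for a using that by (auto simp: B_def D_inv)
    show "a \<otimes> b \<in> B" if a: "a \<in> B" and b: "b \<in> B" for a b
    proof -
      obtain c d where c: "c \<ge> 0" "\<And>f. D a f \<le> ennreal c * E f"
        and d: "d \<ge> 0" "\<And>f. D b f \<le> ennreal d * E f"
        using a b unfolding B_def by blast
      have ab: "a \<in> carrier H" "b \<in> carrier H" using a b by (auto simp: B_def)
      have "D (a \<otimes> b) f \<le> ennreal (2 * d + 2 * c) * E f" for f
      proof -
        have "D (a \<otimes> b) f \<le> 2 * D b f + 2 * D a f" by (rule D_mult_2[OF ab])
        also have "\<dots> \<le> 2 * (ennreal d * E f) + 2 * (ennreal c * E f)"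
          by (intro add_mono mult_left_mono c d) auto
        also have "\<dots> = ennreal (2 * d + 2 * c) * E f"
          using c(1) d(1) by (simp add: ennreal_mult distrib_right mult.assoc)
        finally show ?thesis .
      qed
      then show ?thesis using ab c(1) d(1) unfolding B_def by (intro CollectI conjI exI[of _ "2 * d + 2 * c"]) auto
    qed
  qed
  moreover have "set_pmf \<mu> \<subseteq> B"
  proof
    fix h assume h: "h \<in> set_pmf \<mu>"
    have hc: "h \<in> carrier H" using h sym_walk.mu_carrier[OF sym_walk_\<mu>] by auto
    have pos: "0 < pmf \<mu> h" using h by (rule pmf_positive)
    have "D h f \<le> ennreal (1 / pmf \<mu> h) * E f" for f
    proof -
      have "D h f = ennreal (1 / pmf \<mu> h) * (ennreal (pmf \<mu> h) * D h f)"
        using pos by (simp add: mult.assoc[symmetric] ennreal_mult[symmetric])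
      also have "\<dots> \<le> ennreal (1 / pmf \<mu> h) * E f"
        by (intro mult_left_mono nn_integral_pmf_ge) auto
      finally show ?thesis .
    qed
    then show "h \<in> B" unfolding B_def using hc pos by (intro CollectI conjI exI[of _ "1 / pmf \<mu> h"]) auto
  qed
  ultimately have "carrier H \<subseteq> B" by (rule \<mu>_generates)
  then have "\<forall>t\<in>S. \<exists>c\<ge>0. \<forall>f. D t f \<le> ennreal c * E f" using S_sub by (auto simp: B_def)
  then obtain c where c: "\<And>t. t \<in> S \<Longrightarrow> 0 \<le> c t" "\<And>t f. t \<in> S \<Longrightarrow> D t f \<le> ennreal (c t) * E f"
    by metis
  have "energy f \<le> ennreal (\<Sum>t\<in>S. c t) * E f" for f
  proof -
    have "energy f \<le> (\<Sum>t\<in>S. ennreal (c t) * E f)"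
      unfolding energy_def by (rule sum_mono) (rule c)
    also have "\<dots> = ennreal (\<Sum>t\<in>S. c t) * E f"
      by (simp add: sum_distrib_right[symmetric] sum_ennreal c(1))
    finally show ?thesis .
  qed
  then show ?thesis by blast
qed

section \<open>Probability of hitting a vertex\<close>

definition u :: "'a \<Rightarrow> 'a list \<Rightarrow> ennreal" where
  "u v p = (SUP n. reach step (\<lambda>q. hd q = v) n p)"

lemma u_le_1: "u v p \<le> 1"
  unfolding u_def by (rule SUP_least) (rule reach_le_1)

lemma u_eq: "u v p = (\<integral>\<^sup>+q. (if hd q = v then 1 else u v q) \<partial>step p)"
proof -
  have mono: "incseq (\<lambda>n. reach step (\<lambda>q. hd q = v) n p)" for p
    by (rule incseq_SucI) (rule reach_Suc_mono)
  have "u v p = (SUP n. reach step (\<lambda>q. hd q = v) (Suc n) p)"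
    unfolding u_def
  proof (rule antisym; rule SUP_mono)
    show "\<exists>m\<in>UNIV. reach step (\<lambda>q. hd q = v) n p \<le> reach step (\<lambda>q. hd q = v) (Suc m) p" for n
      by (rule bexI[of _ n]) (rule reach_Suc_mono, simp)
    show "\<exists>m\<in>UNIV. reach step (\<lambda>q. hd q = v) (Suc n) p \<le> reach step (\<lambda>q. hd q = v) m p" for n
      by (rule bexI[of _ "Suc n"]) simp_all
  qed
  also have "\<dots> = (\<integral>\<^sup>+q. (SUP n. (if hd q = v then 1 else reach step (\<lambda>q. hd q = v) n q)) \<partial>step p)"
    unfolding reach.simps
    by (rule nn_integral_monotone_convergence_SUP[symmetric])
      (use mono in \<open>auto simp: incseq_def le_fun_def\<close>)
  also have "\<dots> = (\<integral>\<^sup>+q. (if hd q = v then 1 else u v q) \<partial>step p)"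
    by (rule nn_integral_cong) (simp add: u_def)
  finally show ?thesis .
qed

lemma forgets_u: "forgets (u v)"
proof -
  have "forgets (reach step (\<lambda>q. hd q = v) n)" for n
  proof (induction n)
    case (Suc n)
    then show ?case
      using forgets_step[where G = "\<lambda>z y. if z = v then 1 else y" and F = "reach step (\<lambda>q. hd q = v) n"]
      by simp
  qed (simp add: forgets_def)
  then have "reach step (\<lambda>q. hd q = v) n p = reach step (\<lambda>q. hd q = v) n q"
    if "Suc k \<le> length p" "Suc k \<le> length q" "take (Suc k) p = take (Suc k) q" for n p q
    using that unfolding forgets_def by blast
  then show ?thesis unfolding forgets_def u_def by (intro allI impI SUP_cong refl)
qed

lemma u_super: "(\<integral>\<^sup>+q. u v q \<partial>step p) \<le> u v p"
  by (subst (2) u_eq) (auto intro!: nn_integral_mono u_le_1)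

text \<open>Optional stopping is applied to the second half of the cycle only. The first half
  remains an integral over the hitting law, because \<open>u_eq_1\<close> later compares this
  integral with the mean after a single step.\<close>

lemma u_\<mu>_le:
  assumes x: "x \<in> carrier H"
  shows "(\<integral>\<^sup>+h. u v (straight s (x \<otimes> h)) \<partial>\<mu>) \<le> (\<integral>\<^sup>+q. u v q \<partial>hit step M (straight s x))"
proof -
  interpret hp: hitting step P V by (rule hitting_run)
  have "(\<integral>\<^sup>+h. u v (straight s (x \<otimes> h)) \<partial>\<mu>) \<le> (\<integral>\<^sup>+a. u v (straight (inv s) (x \<otimes> a)) \<partial>\<nu>)"
    unfolding nn_integral_\<mu>
  proof (rule nn_integral_pmf_mono)
    fix a assume "a \<in> set_pmf \<nu>"
    then have a: "a \<in> carrier H" using \<nu>_carrier by auto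
    have "(\<integral>\<^sup>+b. u v (straight s (x \<otimes> (a \<otimes> inv b))) \<partial>\<nu>) = (\<integral>\<^sup>+b. u v (straight s (x \<otimes> a \<otimes> inv b)) \<partial>\<nu>)"
      by (rule nn_integral_pmf_cong) (use a x \<nu>_carrier in \<open>auto simp: m_assoc subset_iff\<close>)
    also have "\<dots> = (\<integral>\<^sup>+q. u v q \<partial>hit step P (straight (inv s) (x \<otimes> a)))"
      using a x by (intro nn_integral_hit_P[symmetric] forgets_u) simp
    also have "\<dots> \<le> u v (straight (inv s) (x \<otimes> a))"
      using a x by (intro hp.hit_supermartingale u_le_1 u_super straight_V inv_s) simp
    finally show "(\<integral>\<^sup>+b. u v (straight s (x \<otimes> (a \<otimes> inv b))) \<partial>\<nu>) \<le> u v (straight (inv s) (x \<otimes> a))" .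
  qed
  also have "\<dots> = (\<integral>\<^sup>+q. u v q \<partial>hit step M (straight s x))"
    using x by (intro nn_integral_hit_M[symmetric] forgets_u)
  finally show ?thesis .
qed

text \<open>Sampled at straight runs along \<open>s\<close>, the hitting probability is
  superharmonic for \<open>\<mu>\<close>, so it does not decrease along steps in the support; as
  these come with their inverses it is invariant, and by generation it is a constant
  \<open>c\<close>. A start one step before \<open>v\<close> forces \<open>c = 1\<close>, and any
  other past leads to a straight run almost surely.\<close>

lemma u_eq_1:
  assumes rec: "\<not> pos_capacity" and v: "v \<in> carrier H" and p: "p \<in> V"
  shows "u v p = 1"
proof -
  interpret hp: hitting step P V by (rule hitting_run)
  interpret hm: hitting step M V by (rule hitting_M)
  interpret sw: sym_walk H S \<mu> by (rule sym_walk_\<mu>)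
  define U where "U x = enn2real (u v (straight s x))" for x
  have U: "ennreal (U x) = u v (straight s x)" for x
    unfolding U_def using u_le_1[of v "straight s x"] by (intro ennreal_enn2real) (auto simp: less_top[symmetric] top_unique)
  have U0: "0 \<le> U x" for x by (simp add: U_def)
  have super: "(\<integral>\<^sup>+h. ennreal (U (x \<otimes> h)) \<partial>\<mu>) \<le> ennreal (U x)" if x: "x \<in> carrier H" for x
  proof -
    have "(\<integral>\<^sup>+q. u v q \<partial>hit step M (straight s x)) \<le> u v (straight s x)"
      using x by (intro hm.hit_supermartingale u_le_1 u_super straight_V s)
    then show ?thesis unfolding U using u_\<mu>_le[OF x, of v] by (rule order_trans[rotated])
  qed
  obtain C where C: "0 \<le> C" "\<And>f. E f \<le> ennreal C * energy f"
    using E_\<mu>_le_energy by blast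
  have mono: "U x \<le> U (x \<otimes> h)" if "x \<in> carrier H" "h \<in> set_pmf \<mu>" for x h
    by (rule sw.superharmonic_mono[OF rec _ C(1) U0 super that]) (simp add: sw.E\<mu>_def C(2))
  define B where "B = {h \<in> carrier H. \<forall>x\<in>carrier H. U (x \<otimes> h) = U x}"
  have "subgroup B H"
  proof (rule subgroupI)
    show "B \<subseteq> carrier H" by (auto simp: B_def)
    have "\<one> \<in> B" by (auto simp: B_def)
    then show "B \<noteq> {}" by blast
    show "inv a \<in> B" if a: "a \<in> B" for a
    proof -
      have ac: "a \<in> carrier H" using a by (simp add: B_def)
      have "U (x \<otimes> inv a) = U x" if x: "x \<in> carrier H" for x
      proof -
        have "U (x \<otimes> inv a \<otimes> a) = U (x \<otimes> inv a)" using a x ac by (simp add: B_def)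
        then show ?thesis using x ac by (simp add: m_assoc)
      qed
      then show ?thesis using ac by (simp add: B_def)
    qed
    show "a \<otimes> b \<in> B" if "a \<in> B" "b \<in> B" for a b
      using that by (auto simp: B_def m_assoc[symmetric])
  qed
  moreover have "set_pmf \<mu> \<subseteq> B"
  proof
    fix h assume h: "h \<in> set_pmf \<mu>"
    have hc: "h \<in> carrier H" using h sw.mu_carrier by auto
    have h': "inv h \<in> set_pmf \<mu>"
      using h by (subst sw.mu_sym[symmetric]) auto
    have "U (x \<otimes> h) = U x" if x: "x \<in> carrier H" for x
    proof (rule antisym)
      show "U x \<le> U (x \<otimes> h)" by (rule mono[OF x h])
      show "U (x \<otimes> h) \<le> U x" using mono[of "x \<otimes> h", OF _ h'] x hc by (simp add: m_assoc)
    qed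
    then show "h \<in> B" using hc by (simp add: B_def)
  qed
  ultimately have "carrier H \<subseteq> B" by (rule \<mu>_generates)
  then have const: "U x = U \<one>" if "x \<in> carrier H" for x
    using that unfolding B_def by (force dest: bspec[of _ _ \<one>])
  define c where "c = U \<one>"
  have uc: "u v (straight s x) = ennreal c" if "x \<in> carrier H" for x
    unfolding U[symmetric] const[OF that] c_def ..
  have c01: "0 \<le> c" "c \<le> 1"
    using U0[of \<one>] u_le_1[of v "straight s \<one>", folded U] by (auto simp: c_def ennreal_le_1)
  have "c = 1"
  proof -
    \<comment> \<open>Continuing the run from \<open>x\<close> by one step hits \<open>v\<close>,
      which has positive probability \<open>\<delta>\<close>; compared with the constant this gains
      \<open>(1 - c) * \<delta>\<close>.\<close>
    define x where "x = v \<otimes> inv s"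
    have x: "x \<in> carrier H" using v sc by (simp add: x_def)
    let ?p = "straight s x"
    have pV: "?p \<in> V" by (rule straight_V[OF s x])
    have hdp: "hd ?p = x" by (rule hd_straight[OF sc x])
    have xs: "x \<otimes> s = v" using v sc by (simp add: x_def m_assoc)
    let ?q = "v # ?p"
    have fr: "hd ?p \<otimes> s \<notin> recent ?p"
      by (rule fresh_along[OF pV run_straight[OF s x]])
    have qe: "?q = (hd ?p \<otimes> s) # ?p" by (simp add: hdp xs)
    have qV: "?q \<in> V" unfolding qe by (rule V_Cons[OF pV s])
    have rq: "run s k ?q" unfolding qe using run_Cons[OF pV s run_straight[OF s x]] by (rule run_mono) simp
    have uq: "u v ?q = ennreal c" using forgets_straight[OF forgets_u qV rq sc] uc[OF v] by simp
    define \<delta> where "\<delta> = pmf (step ?p) ?q"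
    have \<delta>: "0 < \<delta>" unfolding \<delta>_def qe by (rule pmf_positive[OF step_fresh[OF pV s fr]])
    \<comment> \<open>The constant \<open>c\<close> is also the mean at the end of a full cycle, so
      the supermartingale loses nothing on the way; in particular its mean after one step is at
      least \<open>c\<close>.\<close>
    have low: "ennreal c \<le> (\<integral>\<^sup>+q. u v q \<partial>step ?p)"
    proof -
      have "ennreal c = (\<integral>\<^sup>+h. u v (straight s (x \<otimes> h)) \<partial>\<mu>)"
      proof -
        have "(\<integral>\<^sup>+h. u v (straight s (x \<otimes> h)) \<partial>\<mu>) = (\<integral>\<^sup>+h. ennreal c \<partial>\<mu>)"
          by (rule sw.nn_integral_mu_cong) (simp add: uc x)
        then show ?thesis by simp
      qed
      also have "\<dots> \<le> (\<integral>\<^sup>+q. u v q \<partial>hit step M ?p)" by (rule u_\<mu>_le[OF x])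
      also have "\<dots> \<le> (\<integral>\<^sup>+q. u v q \<partial>step ?p)"
      \<comment> \<open>The comparison function is the mean of \<open>u v\<close> one step ahead. It
        is a supersolution because \<open>u v\<close> is superharmonic for
        \<open>step\<close>.\<close>
      proof (rule hm.hit_le_supersolution[OF u_le_1 _ pV])
        fix p
        show "(\<integral>\<^sup>+q. (if M q then u v q else (\<integral>\<^sup>+q. u v q \<partial>step q)) \<partial>step p) \<le> (\<integral>\<^sup>+q. u v q \<partial>step p)"
          by (rule nn_integral_mono) (simp add: u_super)
      qed
      finally show ?thesis .
    qed
    have ind: "(\<integral>\<^sup>+q. ennreal (1 - c) * indicator {?q} q \<partial>step ?p) = ennreal ((1 - c) * \<delta>)"
      using c01 \<delta> by (subst nn_integral_cmult_indicator) (auto simp: emeasure_pmf_single \<delta>_def ennreal_mult)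
    have "ennreal c + ennreal ((1 - c) * \<delta>) \<le> (\<integral>\<^sup>+q. u v q \<partial>step ?p) + ennreal ((1 - c) * \<delta>)"
      by (rule add_right_mono[OF low])
    also have "\<dots> = (\<integral>\<^sup>+q. u v q + ennreal (1 - c) * indicator {?q} q \<partial>step ?p)"
      unfolding ind[symmetric] by (rule nn_integral_add[symmetric]) auto
    also have "\<dots> \<le> (\<integral>\<^sup>+q. (if hd q = v then 1 else u v q) \<partial>step ?p)"
    proof (rule nn_integral_mono)
      fix q
      have "ennreal c + ennreal (1 - c) = 1" using c01 by (simp add: ennreal_plus[symmetric] del: ennreal_plus)
      then show "u v q + ennreal (1 - c) * indicator {?q} q \<le> (if hd q = v then 1 else u v q)"
        using uq u_le_1[of v q] by (auto split: split_indicator)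
    qed
    also have "\<dots> = ennreal c" using u_eq[of v ?p] uc[OF x] by simp
    finally have "ennreal (c + (1 - c) * \<delta>) \<le> ennreal c"
      using c01 \<delta> by (simp add: ennreal_plus)
    then have "(1 - c) * \<delta> \<le> 0" using c01 \<delta> by (simp add: ennreal_le_iff)
    then have "1 - c \<le> 0" using \<delta> by (metis mult_le_0_iff not_le)
    then show "c = 1" using c01 by simp
  qed
  have "1 = (\<integral>\<^sup>+q. 1 \<partial>hit step P p)" by simp
  also have "\<dots> = (\<integral>\<^sup>+q. u v q \<partial>hit step P p)"
  proof (rule nn_integral_pmf_cong)
    fix q assume "q \<in> set_pmf (hit step P p)"
    then have q: "q \<in> V" "P q" using hit_append[OF hitting_run p] by auto
    show "1 = u v q"
      using forgets_straight[OF forgets_u q sc, of v] uc[OF V_hd_carrier[OF q(1)]] \<open>c = 1\<close> by simp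
  qed
  also have "\<dots> \<le> u v p" by (rule hp.hit_supermartingale[OF u_le_1 u_super p])
  finally show ?thesis using u_le_1 by (simp add: antisym)
qed

end

section \<open>Expected numbers of visits\<close>

context memory_walk
begin

primrec visits :: "'a \<Rightarrow> nat \<Rightarrow> 'a list \<Rightarrow> ennreal" where
  "visits v 0 p = 0"
| "visits v (Suc n) p = (\<integral>\<^sup>+q. (if hd q = v then 1 else 0) + visits v n q \<partial>step p)"

lemma visits_Suc_mono: "visits v n p \<le> visits v (Suc n) p"
proof (induction n arbitrary: p)
  case (Suc n)
  show ?case
    unfolding visits.simps(2)[of v n p] visits.simps(2)[of v "Suc n" p] by (intro nn_integral_mono add_left_mono Suc)
qed simp

lemma visits_le: "visits v n p \<le> of_nat n"
proof (induction n arbitrary: p)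
  case (Suc n)
  have "visits v (Suc n) p \<le> (\<integral>\<^sup>+q. 1 + of_nat n \<partial>step p)"
    unfolding visits.simps by (intro nn_integral_mono add_mono Suc) simp
  then show ?case by simp
qed simp

lemma forgets_visits: "forgets (visits v n)"
proof (induction n)
  case (Suc n)
  then show ?case
    using forgets_step[where G = "\<lambda>z y. (if z = v then 1 else 0) + y" and F = "visits v n"] by simp
qed (simp add: forgets_def)

lemma finite_words: "finite (words n)"
proof (induction n)
  case (Suc n)
  have "words (Suc n) = (\<lambda>(w, s). w \<otimes> s) ` (words n \<times> S)" by auto
  then show ?case using Suc finite_S by (metis finite_SigmaI finite_imageI)
qed simp

lemma words_Cons: "s \<in> S \<Longrightarrow> w \<in> words n \<Longrightarrow> s \<otimes> w \<in> words (Suc n)"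
  using words_carrier[of w n] S_sub by (auto simp: m_comm[of s w] subset_iff)

text \<open>In \<open>n\<close> steps the walk covers word distance at most \<open>n\<close>, so for
  fixed \<open>v\<close> and \<open>n\<close> only finitely many starting points contribute. This
  supplies the finite support of a test function.\<close>

lemma visits_nonzero:
  assumes "p \<in> V" "visits v n p \<noteq> 0"
  shows "\<exists>m\<le>n. \<exists>w\<in>words m. v = hd p \<otimes> w"
  using assms
proof (induction n arbitrary: p)
  case (Suc n)
  have "\<exists>q\<in>set_pmf (step p). (if hd q = v then 1 else 0) + visits v n q \<noteq> 0"
  proof (rule ccontr)
    assume "\<not> ?thesis"
    then have "visits v (Suc n) p = (\<integral>\<^sup>+q. 0 \<partial>step p)"
      unfolding visits.simps by (intro nn_integral_pmf_cong) auto
    with Suc.prems show False by simp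
  qed
  then obtain q where q: "q \<in> set_pmf (step p)" "(if hd q = v then 1 else 0) + visits v n q \<noteq> 0" by blast
  obtain t where t: "t \<in> S" "q = (hd p \<otimes> t) # p" using set_step[OF Suc.prems(1) q(1)] by blast
  have c: "t \<in> carrier H" "hd p \<in> carrier H" using t S_sub V_hd_carrier[OF Suc.prems(1)] by auto
  show ?case
  proof (cases "hd q = v")
    case True
    have "t \<in> words 1" using words_Cons[OF t(1), of \<one> 0] c by simp
    then show ?thesis using True t by (intro exI[of _ 1] conjI bexI[of _ t]) auto
  next
    case False
    then obtain m w where m: "m \<le> n" "w \<in> words m" "v = hd q \<otimes> w"
      using Suc.IH[OF V_closed[OF Suc.prems(1) q(1)]] q(2) by auto
    have "v = hd p \<otimes> (t \<otimes> w)" using m t c words_carrier[OF m(2)] by (simp add: m_assoc)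
    then show ?thesis using words_Cons[OF t(1) m(2)] m(1) by (intro exI[of _ "Suc m"] conjI bexI[of _ "t \<otimes> w"]) auto
  qed
qed simp

text \<open>The prefix of \<open>q\<close> that is counted consists of the new positions: the start
  is left out, the position at the hit is included.\<close>

definition visits_until :: "('a list \<Rightarrow> bool) \<Rightarrow> 'a \<Rightarrow> 'a list \<Rightarrow> ennreal" where
  "visits_until A v p = (\<integral>\<^sup>+q. of_nat (count_list (take (length q - length p) q) v) \<partial>hit step A p)"

lemma visits_until_eq:
  assumes h: "hitting step A V" and p: "p \<in> V"
  shows "visits_until A v p = (\<integral>\<^sup>+q. (if hd q = v then 1 else 0) + (if A q then 0 else visits_until A v q) \<partial>step p)"
proof -
  interpret hitting step A V by fact
  have "visits_until A v p = (\<integral>\<^sup>+q. (if A q then of_nat (count_list (take (length q - length p) q) v)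
      else (\<integral>\<^sup>+q'. of_nat (count_list (take (length q' - length p) q') v) \<partial>hit step A q)) \<partial>step p)"
    unfolding visits_until_def by (rule nn_integral_hit[OF p])
  also have "\<dots> = (\<integral>\<^sup>+q. (if hd q = v then 1 else 0) + (if A q then 0 else visits_until A v q) \<partial>step p)"
  proof (rule nn_integral_pmf_cong)
    fix q assume q: "q \<in> set_pmf (step p)"
    then obtain z where z: "q = z # p" using set_step[OF p] by blast
    have qV: "q \<in> V" by (rule V_closed[OF p q])
    have "(\<integral>\<^sup>+q'. of_nat (count_list (take (length q' - length p) q') v) \<partial>hit step A q)
       = (\<integral>\<^sup>+q'. (if z = v then 1 else 0) + of_nat (count_list (take (length q' - length q) q') v) \<partial>hit step A q)"
    proof (rule nn_integral_pmf_cong)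
      fix q' assume "q' \<in> set_pmf (hit step A q)"
      then obtain w where "q' = w @ q" using hit_append[OF h qV] by blast
      then show "(of_nat (count_list (take (length q' - length p) q') v) :: ennreal)
        = (if z = v then 1 else 0) + of_nat (count_list (take (length q' - length q) q') v)"
        by (simp add: z)
    qed
    also have "\<dots> = (if z = v then 1 else 0) + visits_until A v q"
      by (simp add: nn_integral_add visits_until_def)
    finally show "(if A q then of_nat (count_list (take (length q - length p) q) v)
      else (\<integral>\<^sup>+q'. of_nat (count_list (take (length q' - length p) q') v) \<partial>hit step A q))
      = (if hd q = v then 1 else 0) + (if A q then 0 else visits_until A v q)"
      by (simp add: z)
  qed
  finally show ?thesis .
qed

text \<open>After the hit the full horizon \<open>n\<close> is granted anew. This gives an
  inequality instead of an identity but avoids keeping track of the time already spent.\<close>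

lemma visits_le_until:
  assumes h: "hitting step A V" and p: "p \<in> V"
  shows "visits v n p \<le> visits_until A v p + (\<integral>\<^sup>+q. visits v n q \<partial>hit step A p)"
  using p
proof (induction n arbitrary: p)
  case (Suc n)
  interpret hitting step A V by fact
  have "visits v (Suc n) p \<le> (\<integral>\<^sup>+q. ((if hd q = v then 1 else 0) + (if A q then 0 else visits_until A v q))
      + (if A q then visits v (Suc n) q else (\<integral>\<^sup>+q'. visits v (Suc n) q' \<partial>hit step A q)) \<partial>step p)"
    unfolding visits.simps(2)[of v n p]
  proof (rule nn_integral_pmf_mono)
    fix q assume q: "q \<in> set_pmf (step p)"
    show "(if hd q = v then 1 else 0) + visits v n q \<le> ((if hd q = v then 1 else 0) + (if A q then 0 else visits_until A v q))
      + (if A q then visits v (Suc n) q else (\<integral>\<^sup>+q'. visits v (Suc n) q' \<partial>hit step A q))"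
    proof (cases "A q")
      case True
      then show ?thesis using add_left_mono[OF visits_Suc_mono] by (simp del: visits.simps)
    next
      case False
      have "visits v n q \<le> visits_until A v q + (\<integral>\<^sup>+q. visits v n q \<partial>hit step A q)"
        by (rule Suc.IH[OF V_closed[OF Suc.prems q]])
      also have "\<dots> \<le> visits_until A v q + (\<integral>\<^sup>+q. visits v (Suc n) q \<partial>hit step A q)"
        by (intro add_left_mono nn_integral_mono visits_Suc_mono)
      finally show ?thesis using False by (simp add: add.assoc add_left_mono del: visits.simps)
    qed
  qed
  also have "\<dots> = visits_until A v p + (\<integral>\<^sup>+q. visits v (Suc n) q \<partial>hit step A p)"
    unfolding visits_until_eq[OF h Suc.prems] nn_integral_hit[OF Suc.prems, of "visits v (Suc n)"]
    by (rule nn_integral_add) auto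
  finally show ?case .
qed simp

lemma sum_count_list:
  assumes "set l \<subseteq> carrier H" "v \<in> carrier H"
  shows "sum_carrier (\<lambda>x. of_nat (count_list (map (\<lambda>y. x \<otimes> y) l) v)) = of_nat (length l)"
  using assms(1)
proof (induction l)
  case (Cons y l)
  have y: "y \<in> carrier H" using Cons.prems by simp
  have "sum_carrier (\<lambda>x. of_nat (count_list (map (\<lambda>y. x \<otimes> y) (y # l)) v))
     = sum_carrier (\<lambda>x. indicator {v \<otimes> inv y} x + of_nat (count_list (map (\<lambda>y. x \<otimes> y) l) v))"
  proof (rule nn_integral_cong)
    fix x assume "x \<in> space (count_space (carrier H))"
    then have "x \<otimes> y = v \<longleftrightarrow> x = v \<otimes> inv y" using y assms(2) by (auto simp: inv_solve_right' m_assoc)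
    then show "(of_nat (count_list (map (\<lambda>y. x \<otimes> y) (y # l)) v) :: ennreal)
      = indicator {v \<otimes> inv y} x + of_nat (count_list (map (\<lambda>y. x \<otimes> y) l) v)"
      by (simp split: split_indicator)
  qed
  also have "\<dots> = 1 + of_nat (length l)"
    using Cons y assms(2) by (simp add: nn_integral_add one_ennreal_def)
  finally show ?case by simp
qed simp

text \<open>Mass transport: each new position of an excursion is carried to \<open>v\<close> by
  exactly one translation, so summing over all translates counts every step once.\<close>

lemma sum_visits_until:
  assumes h: "hitting step A V" and p: "p \<in> V" and v: "v \<in> carrier H"
    and A: "\<And>x q. x \<in> carrier H \<Longrightarrow> q \<in> V \<Longrightarrow> A (map (\<lambda>y. x \<otimes> y) q) \<longleftrightarrow> A q"
  shows "sum_carrier (\<lambda>x. visits_until A v (map (\<lambda>y. x \<otimes> y) p)) = (\<integral>\<^sup>+q. of_nat (length q - length p) \<partial>hit step A p)"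
proof -
  have "sum_carrier (\<lambda>x. visits_until A v (map (\<lambda>y. x \<otimes> y) p))
     = sum_carrier (\<lambda>x. \<integral>\<^sup>+q. of_nat (count_list (map (\<lambda>y. x \<otimes> y) (take (length q - length p) q)) v) \<partial>hit step A p)"
  proof (rule nn_integral_cong)
    fix x assume "x \<in> space (count_space (carrier H))"
    then have x: "x \<in> carrier H" by simp
    have eq: "hit step A (map (\<lambda>y. x \<otimes> y) p) = map_pmf (map (\<lambda>y. x \<otimes> y)) (hit step A p)"
      by (rule hit_equivariant[OF h h equivariant_mult[OF x] A[OF x] p])
    show "visits_until A v (map (\<lambda>y. x \<otimes> y) p)
      = (\<integral>\<^sup>+q. of_nat (count_list (map (\<lambda>y. x \<otimes> y) (take (length q - length p) q)) v) \<partial>hit step A p)"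
      unfolding visits_until_def eq by (simp add:  take_map)
  qed
  also have "\<dots> = (\<integral>\<^sup>+q. sum_carrier (\<lambda>x. of_nat (count_list (map (\<lambda>y. x \<otimes> y) (take (length q - length p) q)) v)) \<partial>hit step A p)"
    by (rule nn_integral_count_space_nn_integral[symmetric]) (auto simp: countable_carrier)
  also have "\<dots> = (\<integral>\<^sup>+q. of_nat (length q - length p) \<partial>hit step A p)"
  proof (rule nn_integral_pmf_cong)
    fix q assume "q \<in> set_pmf (hit step A p)"
    then have "q \<in> V" using hit_append[OF h p] by blast
    then have "set (take (length q - length p) q) \<subseteq> carrier H"
      using V_carrier set_take_subset by (meson subset_iff)
    from sum_count_list[OF this v]
    show "sum_carrier (\<lambda>x. of_nat (count_list (map (\<lambda>y. x \<otimes> y) (take (length q - length p) q)) v))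
      = of_nat (length q - length p)" by simp
  qed
  finally show ?thesis .
qed

end

context direction
begin

lemma mean_hit:
  "\<exists>B<\<infinity>. \<forall>p\<in>V. (\<integral>\<^sup>+q. of_nat (length q - length p) \<partial>hit step (run s k) p) \<le> B"
proof -
  have "(of_nat n :: ennreal) \<le> ennreal ((real n)\<^sup>2)" for n
  proof -
    have "real n \<le> (real n)\<^sup>2" by (cases n) (auto simp: power2_eq_square)
    then show ?thesis by (metis ennreal_leI ennreal_of_nat_eq_real_of_nat)
  qed
  then have "(\<integral>\<^sup>+q. of_nat (length q - length p) \<partial>hit step (run s k) p)
      \<le> (\<integral>\<^sup>+q. ennreal ((real (length q - length p))\<^sup>2) \<partial>hit step (run s k) p)" for p
    by (intro nn_integral_mono)
  then show ?thesis using second_moment by (meson order_trans)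
qed

text \<open>For a fixed horizon, the expected number of visits started from a straight run is a
  finitely supported function bounded by \<open>b\<close> plus its mean under \<open>\<mu>\<close>,
  where \<open>b\<close> counts the visits within one cycle. By mass transport the total of
  \<open>b\<close> is at most the sum of bounds for the two mean half-cycle lengths, so
  \<open>bounded_of_pos_capacity\<close> gives a constant that does not depend on the
  horizon.\<close>

lemma visits_bounded:
  assumes trans: pos_capacity and v: "v \<in> carrier H"
  shows "\<exists>B<\<infinity>. \<forall>n. visits v n [v] \<le> B"
proof -
  interpret sw: sym_walk H S \<mu> by (rule sym_walk_\<mu>)
  obtain BP where BP: "BP < \<infinity>" "\<And>p. p \<in> V \<Longrightarrow> (\<integral>\<^sup>+q. of_nat (length q - length p) \<partial>hit step P p) \<le> BP"
    using mean_hit by blast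
  obtain BM where BM: "BM < \<infinity>" "\<And>p. p \<in> V \<Longrightarrow> (\<integral>\<^sup>+q. of_nat (length q - length p) \<partial>hit step M p) \<le> BM"
    using direction.mean_hit[OF direction_inv] by blast
  define aM where "aM x = visits_until M v (straight s x)" for x
  define aP where "aP x = visits_until P v (straight (inv s) x)" for x
  define b where "b x = aM x + (\<integral>\<^sup>+a. aP (x \<otimes> a) \<partial>\<nu>)" for x
  have M: "sum_carrier aM \<le> BM"
  proof -
    have "sum_carrier aM = (\<integral>\<^sup>+q. of_nat (length q - length (past s)) \<partial>hit step M (past s))"
      unfolding aM_def straight_def
      by (rule sum_visits_until[OF hitting_M past_V[OF s] v run_map_mult]) (use inv_s_carrier in auto)
    also have "\<dots> \<le> BM" by (rule BM(2)[OF past_V[OF s]])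
    finally show ?thesis .
  qed
  have P: "sum_carrier aP \<le> BP"
  proof -
    have "sum_carrier aP = (\<integral>\<^sup>+q. of_nat (length q - length (past (inv s))) \<partial>hit step P (past (inv s)))"
      unfolding aP_def straight_def
      by (rule sum_visits_until[OF hitting_run past_V[OF inv_s] v run_map_mult]) (use sc in auto)
    also have "\<dots> \<le> BP" by (rule BP(2)[OF past_V[OF inv_s]])
    finally show ?thesis .
  qed
  have "sum_carrier b = sum_carrier aM + sum_carrier (\<lambda>x. \<integral>\<^sup>+a. aP (x \<otimes> a) \<partial>\<nu>)"
    unfolding b_def by (rule nn_integral_add) auto
  also have "sum_carrier (\<lambda>x. \<integral>\<^sup>+a. aP (x \<otimes> a) \<partial>\<nu>) = (\<integral>\<^sup>+a. sum_carrier (\<lambda>x. aP (x \<otimes> a)) \<partial>\<nu>)"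
    by (rule sum_carrier_commute)
  also have "\<dots> = (\<integral>\<^sup>+a. sum_carrier aP \<partial>\<nu>)"
    by (rule nn_integral_pmf_cong) (use \<nu>_carrier in \<open>auto intro!: sum_carrier_shift\<close>)
  also have "sum_carrier aM + \<dots> \<le> BM + BP" using M P by (simp add: add_mono)
  also have "BM + BP < \<infinity>" using BM BP by simp
  finally have b: "sum_carrier b < \<infinity>" .
  obtain C where C: "\<And>f. energy f \<le> ennreal C * E f" using energy_le_E_\<mu> by blast
  obtain K where K: "\<And>f x. finite_supp f \<Longrightarrow>
      (\<And>x. x \<in> carrier H \<Longrightarrow> ennreal (f x) \<le> b x + (\<integral>\<^sup>+h. ennreal (f (x \<otimes> h)) \<partial>\<mu>)) \<Longrightarrow> x \<in> carrier H \<Longrightarrow> f x \<le> K"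
    using sw.bounded_of_pos_capacity[OF trans _ b, of C] C unfolding sw.E\<mu>_def by blast
  have vK: "visits v n (straight s x) \<le> ennreal K" if x: "x \<in> carrier H" for n x
  proof -
    define f where "f x = enn2real (visits v n (straight s x))" for x
    have f: "ennreal (f x) = visits v n (straight s x)" for x
    proof -
      have "visits v n (straight s x) < \<infinity>"
        using visits_le[of v n "straight s x"] by (rule order.strict_trans1) (simp add: of_nat_less_top)
      then show ?thesis unfolding f_def by (simp add: ennreal_enn2real)
    qed
    have fs: "finite_supp f"
      unfolding finite_supp_def
    proof (intro conjI allI)
      show "0 \<le> f x" for x by (simp add: f_def)
      have "{x \<in> carrier H. f x \<noteq> 0} \<subseteq> (\<lambda>w. v \<otimes> inv w) ` (\<Union>m\<in>{..n}. words m)"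
      proof
        fix x assume x: "x \<in> {x \<in> carrier H. f x \<noteq> 0}"
        then have "visits v n (straight s x) \<noteq> 0" by (auto simp: f_def)
        moreover have xc: "x \<in> carrier H" using x by simp
        ultimately obtain m w where w: "m \<le> n" "w \<in> words m" "v = x \<otimes> w"
          using visits_nonzero[OF straight_V[OF s xc], of v n] hd_straight[OF sc xc] by auto
        then have "x = v \<otimes> inv w" using xc words_carrier[OF w(2)] by (simp add: m_assoc)
        then show "x \<in> (\<lambda>w. v \<otimes> inv w) ` (\<Union>m\<in>{..n}. words m)" using w by auto
      qed
      then show "finite {x \<in> carrier H. f x \<noteq> 0}"
        by (rule finite_subset) (simp add: finite_words)
    qed
    have "ennreal (f x) \<le> b x + (\<integral>\<^sup>+h. ennreal (f (x \<otimes> h)) \<partial>\<mu>)" if x: "x \<in> carrier H" for x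
    proof -
      have "visits v n (straight s x) \<le> aM x + (\<integral>\<^sup>+q. visits v n q \<partial>hit step M (straight s x))"
        unfolding aM_def by (rule visits_le_until[OF hitting_M straight_V[OF s x]])
      also have "(\<integral>\<^sup>+q. visits v n q \<partial>hit step M (straight s x)) = (\<integral>\<^sup>+a. visits v n (straight (inv s) (x \<otimes> a)) \<partial>\<nu>)"
        by (rule nn_integral_hit_M[OF forgets_visits x])
      also have "\<dots> \<le> (\<integral>\<^sup>+a. aP (x \<otimes> a) + (\<integral>\<^sup>+c. visits v n (straight s (x \<otimes> (a \<otimes> inv c))) \<partial>\<nu>) \<partial>\<nu>)"
      proof (rule nn_integral_pmf_mono)
        fix a assume "a \<in> set_pmf \<nu>"
        then have a: "a \<in> carrier H" using \<nu>_carrier by auto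
        have xa: "x \<otimes> a \<in> carrier H" using x a by simp
        have "visits v n (straight (inv s) (x \<otimes> a)) \<le> aP (x \<otimes> a) + (\<integral>\<^sup>+q. visits v n q \<partial>hit step P (straight (inv s) (x \<otimes> a)))"
          unfolding aP_def by (rule visits_le_until[OF hitting_run straight_V[OF inv_s xa]])
        also have "(\<integral>\<^sup>+q. visits v n q \<partial>hit step P (straight (inv s) (x \<otimes> a))) = (\<integral>\<^sup>+c. visits v n (straight s (x \<otimes> a \<otimes> inv c)) \<partial>\<nu>)"
          by (rule nn_integral_hit_P[OF forgets_visits xa])
        also have "\<dots> = (\<integral>\<^sup>+c. visits v n (straight s (x \<otimes> (a \<otimes> inv c))) \<partial>\<nu>)"
          by (rule nn_integral_pmf_cong) (use a x \<nu>_carrier in \<open>auto simp: m_assoc subset_iff\<close>)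
        finally show "visits v n (straight (inv s) (x \<otimes> a)) \<le> aP (x \<otimes> a) + (\<integral>\<^sup>+c. visits v n (straight s (x \<otimes> (a \<otimes> inv c))) \<partial>\<nu>)" .
      qed
      also have "aM x + \<dots> = b x + (\<integral>\<^sup>+h. ennreal (f (x \<otimes> h)) \<partial>\<mu>)"
        unfolding f nn_integral_\<mu> b_def by (simp add: nn_integral_add add.assoc)
      finally show ?thesis unfolding f by (simp add: add_left_mono)
    qed
    then have "f x \<le> K" by (rule K[OF fs _ x])
    then show ?thesis unfolding f[symmetric] by (rule ennreal_leI)
  qed
  have "visits v n [v] \<le> BP + ennreal K" for n
  proof -
    have vV: "[v] \<in> V" by (rule V_singleton[OF v])
    have "visits v n [v] \<le> visits_until P v [v] + (\<integral>\<^sup>+q. visits v n q \<partial>hit step P [v])"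
      by (rule visits_le_until[OF hitting_run vV])
    also have "visits_until P v [v] \<le> (\<integral>\<^sup>+q. of_nat (length q - length [v]) \<partial>hit step P [v])"
      unfolding visits_until_def
    proof (intro nn_integral_mono)
      fix q :: "'a list"
      show "(of_nat (count_list (take (length q - length [v]) q) v) :: ennreal) \<le> of_nat (length q - length [v])"
        using count_le_length[of "take (length q - length [v]) q" v] by (simp add: min_def split: if_splits)
    qed
    also have "\<dots> \<le> BP" by (rule BP(2)[OF vV])
    also have "(\<integral>\<^sup>+q. visits v n q \<partial>hit step P [v]) \<le> (\<integral>\<^sup>+q. ennreal K \<partial>hit step P [v])"
    proof (rule nn_integral_pmf_mono)
      fix q assume "q \<in> set_pmf (hit step P [v])"
      then have q: "q \<in> V" "P q" using hit_append[OF hitting_run vV] by auto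
      show "visits v n q \<le> ennreal K"
        using forgets_straight[OF forgets_visits q sc, of v n] vK[OF V_hd_carrier[OF q(1)]] by simp
    qed
    finally show ?thesis by (simp add: add_mono)
  qed
  moreover have "BP + ennreal K < \<infinity>" using BP(1) by simp
  ultimately show ?thesis by (intro exI[of _ "BP + ennreal K"]) auto
qed

end

section \<open>The law of the trajectory\<close>

context memory_walk
begin

primrec traj :: "nat \<Rightarrow> 'a list \<Rightarrow> 'a list pmf" where
  "traj 0 p = return_pmf p"
| "traj (Suc n) p = bind_pmf (traj n p) step"

lemma traj_add: "traj (t + n) p = bind_pmf (traj t p) (traj n)"
proof (induction n)
  case (Suc n)
  have "traj (t + Suc n) p = bind_pmf (bind_pmf (traj t p) (traj n)) step" using Suc by simp
  also have "\<dots> = bind_pmf (traj t p) (traj (Suc n))" unfolding bind_assoc_pmf by (rule bind_pmf_cong) simp_all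
  finally show ?case .
qed (simp add: bind_return_pmf')

lemma traj_Suc: "traj (Suc n) p = bind_pmf (step p) (traj n)"
  using traj_add[of 1 n p] by (simp add: bind_return_pmf)

lemma set_traj:
  assumes "p \<in> V" "q \<in> set_pmf (traj n p)"
  shows "q \<in> V \<and> (\<exists>w. q = w @ p \<and> length w = n)"
  using assms(2)
proof (induction n arbitrary: q)
  case (Suc n)
  then obtain q' where q': "q' \<in> set_pmf (traj n p)" "q \<in> set_pmf (step q')" by auto
  then obtain w where w: "q' \<in> V" "q' = w @ p" "length w = n" using Suc.IH by blast
  obtain z where "q = z # q'" using set_step[OF w(1) q'(2)] by blast
  then show ?case using w V_closed[OF w(1) q'(2)] by (intro conjI exI[of _ "z # w"]) auto
qed (use assms in simp)

lemma visits_eq_sum: "visits v n p = (\<Sum>i<n. emeasure (traj (Suc i) p) {q. hd q = v})"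
proof (induction n arbitrary: p)
  case (Suc n)
  have "visits v (Suc n) p = (\<integral>\<^sup>+q. indicator {q. hd q = v} q + (\<Sum>i<n. emeasure (traj (Suc i) q) {q. hd q = v}) \<partial>step p)"
    unfolding visits.simps Suc by (intro nn_integral_cong) (simp split: split_indicator)
  also have "\<dots> = emeasure (step p) {q. hd q = v} + (\<Sum>i<n. \<integral>\<^sup>+q. emeasure (traj (Suc i) q) {q. hd q = v} \<partial>step p)"
    by (simp add: nn_integral_add nn_integral_sum del: traj.simps)
  also have "\<dots> = emeasure (traj (Suc 0) p) {q. hd q = v} + (\<Sum>i<n. emeasure (traj (Suc (Suc i)) p) {q. hd q = v})"
    unfolding traj_Suc[of "Suc _"] traj_Suc[of 0] by (simp add: bind_return_pmf' del: traj.simps(2))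
  also have "\<dots> = (\<Sum>i<Suc n. emeasure (traj (Suc i) p) {q. hd q = v})"
    by (rule sum.lessThan_Suc_shift[symmetric])
  finally show ?case .
qed simp

lemma surv_eq_traj:
  assumes "p \<in> V"
  shows "emeasure (traj n p) {q. v \<notin> set (take n q)} = surv step (\<lambda>q. hd q = v) n p"
  using assms
proof (induction n arbitrary: p)
  case (Suc n)
  have "emeasure (traj (Suc n) p) {q. v \<notin> set (take (Suc n) q)}
      = (\<integral>\<^sup>+q. emeasure (traj n q) {q. v \<notin> set (take (Suc n) q)} \<partial>step p)"
    unfolding traj_Suc by simp
  also have "\<dots> = (\<integral>\<^sup>+q. (if hd q = v then 0 else surv step (\<lambda>q. hd q = v) n q) \<partial>step p)"
  proof (rule nn_integral_pmf_cong)
    fix q assume "q \<in> set_pmf (step p)"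
    then have qV: "q \<in> V" by (rule V_closed[OF Suc.prems])
    have "emeasure (traj n q) {q. v \<notin> set (take (Suc n) q)}
        = emeasure (traj n q) (if hd q = v then {} else {q. v \<notin> set (take n q)})"
    proof (rule emeasure_eq_AE, unfold AE_measure_pmf_iff, intro ballI)
      fix q' assume "q' \<in> set_pmf (traj n q)"
      then obtain w where w: "q' = w @ q" "length w = n" using set_traj[OF qV] by blast
      obtain z q0 where "q = z # q0" using V_nonempty[OF qV] by (cases q) auto
      then show "q' \<in> {q. v \<notin> set (take (Suc n) q)} \<longleftrightarrow> q' \<in> (if hd q = v then {} else {q. v \<notin> set (take n q)})"
        using w by auto
    qed auto
    then show "emeasure (traj n q) {q. v \<notin> set (take (Suc n) q)} = (if hd q = v then 0 else surv step (\<lambda>q. hd q = v) n q)"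
      using Suc.IH[OF qV] by simp
  qed
  finally show ?case by simp
qed simp

section \<open>Comparison with the law on infinite trajectories\<close>

definition hist :: "(nat \<Rightarrow> 'a) \<Rightarrow> nat \<Rightarrow> 'a list" where
  "hist X n = rev (map X [0..<Suc n])"

lemma hist_0: "hist X 0 = [X 0]"
  by (simp add: hist_def)

lemma hist_Suc: "hist X (Suc n) = X (Suc n) # hist X n"
  by (simp add: hist_def)

lemma hd_hist: "hd (hist X n) = X n"
  by (simp add: hist_def)

lemma hist_eq_iff: "hist X n = hist Y n \<longleftrightarrow> (\<forall>i\<le>n. X i = Y i)"
  by (auto simp: hist_def less_Suc_eq_le simp del: upt_Suc)

lemma set_hist: "set (hist X n) = X ` {..n}"
  unfolding hist_def set_rev set_map by (simp add: atLeast0LessThan lessThan_Suc_atMost del: upt_Suc)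

lemma take_hist: "set (take n (hist X (t + n))) = X ` {t<..t + n}"
proof (induction n)
  case (Suc n)
  have "{t<..t + Suc n} = insert (t + Suc n) {t<..t + n}" by auto
  then show ?case using Suc by (simp add: hist_Suc)
qed simp

lemma \<kappa>_hist: "\<kappa> (hist X n) = K n X"
proof -
  have "\<kappa> (hist X n) = K n (\<lambda>i. map X [0..<Suc n] ! i)"
    unfolding \<kappa>_def by (simp add: hist_def del: upt_Suc)
  also have "\<dots> = K n X" by (rule K_adapted) (simp del: upt_Suc)
  finally show ?thesis .
qed

lemma pmf_traj_Suc: "pmf (traj (Suc n) p) (z # q) = pmf (traj n p) q * pmf (\<kappa> q) z"
proof -
  have st: "pmf (step q') (z # q) = pmf (\<kappa> q) z * indicator {q} q'" for q'
  proof (cases "q' = q")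
    case True
    then show ?thesis
      unfolding step_def using pmf_map_inj'[of "\<lambda>z. z # q" "\<kappa> q" z] by (simp add: inj_def)
  next
    case False
    then show ?thesis by (auto simp: step_def pmf_eq_0_set_pmf)
  qed
  have "ennreal (pmf (traj (Suc n) p) (z # q)) = (\<integral>\<^sup>+q'. ennreal (pmf (\<kappa> q) z) * indicator {q} q' \<partial>traj n p)"
    unfolding traj.simps ennreal_pmf_bind st by (intro nn_integral_cong) (simp split: split_indicator)
  also have "\<dots> = ennreal (pmf (traj n p) q * pmf (\<kappa> q) z)"
    by (subst nn_integral_cmult_indicator) (auto simp: emeasure_pmf_single ennreal_mult mult.commute)
  finally show ?thesis by simp
qed

context
  fixes G :: "'a ugraph" and v :: 'a
  assumes G: "verts G = carrier H" and wk: "walk_kernel G K" and v: "v \<in> carrier H"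
begin

abbreviation W :: "(nat \<Rightarrow> 'a) measure" where
  "W \<equiv> walk_law G K v"

lemma space_law: "space W = UNIV \<rightarrow>\<^sub>E carrier H"
  using walk_kernel.space_walk_law[OF wk, of v] v G by simp

lemma prob_space_law: "prob_space W"
  using walk_kernel.prob_space_walk_law[OF wk, of v] v G by simp

lemma coordinate_measurable: "(\<lambda>X. X i) \<in> measurable W (count_space (carrier H))"
proof -
  have "sets W = sets (PiM UNIV (\<lambda>_. count_space (carrier H)))"
    using walk_kernel.sets_walk_law[OF wk, of v] v G by simp
  then show ?thesis
    using measurable_cong_sets[of W "PiM UNIV (\<lambda>_. count_space (carrier H))"]
      measurable_component_singleton[of i UNIV "\<lambda>_. count_space (carrier H)"] by simp
qed

lemma hist_measurable: "(\<lambda>X. hist X n) \<in> measurable W (count_space UNIV)"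
proof -
  have "(\<lambda>X. hist X n) \<in> measurable W (count_space (lists (carrier H)))"
  proof (subst measurable_count_space_eq_countable)
    show "countable (lists (carrier H))" by (rule countable_lists[OF countable_carrier])
    show "(\<lambda>X. hist X n) \<in> space W \<rightarrow> lists (carrier H) \<and>
      (\<forall>a\<in>lists (carrier H). (\<lambda>X. hist X n) -` {a} \<inter> space W \<in> sets W)"
    proof (intro conjI ballI)
      show "(\<lambda>X. hist X n) \<in> space W \<rightarrow> lists (carrier H)"
        by (auto simp: space_law set_hist PiE_iff in_lists_conv_set)
      fix a :: "'a list"
      show "(\<lambda>X. hist X n) -` {a} \<inter> space W \<in> sets W"
      proof (induction n arbitrary: a)
        case 0
        have "(\<lambda>X. X 0) -` ({hd a} \<inter> carrier H) \<inter> space W \<in> sets W"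
          by (rule measurable_sets[OF coordinate_measurable]) auto
        moreover have "(\<lambda>X. hist X 0) -` {a} \<inter> space W
          = (if length a = 1 then (\<lambda>X. X 0) -` ({hd a} \<inter> carrier H) \<inter> space W else {})"
          by (auto simp: hist_0 space_law PiE_iff length_Suc_conv)
        ultimately show ?case by auto
      next
        case (Suc n)
        have "(\<lambda>X. X (Suc n)) -` ({hd a} \<inter> carrier H) \<inter> space W \<in> sets W"
          by (rule measurable_sets[OF coordinate_measurable]) auto
        then have "((\<lambda>X. X (Suc n)) -` ({hd a} \<inter> carrier H) \<inter> space W)
            \<inter> ((\<lambda>X. hist X n) -` {tl a} \<inter> space W) \<in> sets W"
          using Suc by (rule sets.Int)
        moreover have "(\<lambda>X. hist X (Suc n)) -` {a} \<inter> space W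
          = (if a \<noteq> [] then ((\<lambda>X. X (Suc n)) -` ({hd a} \<inter> carrier H) \<inter> space W)
            \<inter> ((\<lambda>X. hist X n) -` {tl a} \<inter> space W) else {})"
          by (cases a) (auto simp: hist_Suc space_law PiE_iff)
        ultimately show ?case by auto
      qed
    qed
  qed
  then show ?thesis by (rule measurable_compose) simp
qed

lemma emeasure_law_path:
  assumes "\<And>i. i \<le> n \<Longrightarrow> x i \<in> carrier H"
  shows "emeasure W {X \<in> space W. \<forall>i\<le>n. X i = x i} = ennreal (pmf (traj n [v]) (hist x n))"
  using assms
proof (induction n)
  case 0
  interpret prob_space W by (rule prob_space_law)
  have ae: "AE X in W. X 0 = v"
    using walk_kernel.walk_law_start[OF wk] v G by simp
  have meas: "{X \<in> space W. X 0 = x 0} \<in> sets W"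
  proof -
    have "(\<lambda>X. X 0) -` ({x 0} \<inter> carrier H) \<inter> space W \<in> sets W"
      by (rule measurable_sets[OF coordinate_measurable]) auto
    moreover have "(\<lambda>X. X 0) -` ({x 0} \<inter> carrier H) \<inter> space W = {X \<in> space W. X 0 = x 0}"
      using 0 by auto
    ultimately show ?thesis by simp
  qed
  have "emeasure W {X \<in> space W. X 0 = x 0}
      = emeasure W (if x 0 = v then space W else {})"
    by (rule emeasure_eq_AE) (use ae meas in \<open>auto split: if_splits elim!: AE_mp\<close>)
  then show ?case by (auto simp: hist_0 emeasure_space_1)
next
  case (Suc n)
  have "emeasure W {X \<in> space W. \<forall>i\<le>Suc n. X i = x i}
       = emeasure W {X \<in> space W. \<forall>i\<le>n. X i = x i} * ennreal (pmf (K n x) (x (Suc n)))"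
    using walk_kernel.walk_law_Suc[OF wk, of v n x] v G Suc.prems by simp
  also have "\<dots> = ennreal (pmf (traj n [v]) (hist x n) * pmf (\<kappa> (hist x n)) (x (Suc n)))"
    using Suc by (simp add: ennreal_mult \<kappa>_hist)
  also have "\<dots> = ennreal (pmf (traj (Suc n) [v]) (hist x (Suc n)))"
    unfolding hist_Suc pmf_traj_Suc ..
  finally show ?case .
qed

text \<open>Both laws are carried by the countable set of lists of length \<open>n + 1\<close> over
  the carrier, so agreement on single paths suffices.\<close>

lemma distr_hist: "distr W (count_space UNIV) (\<lambda>X. hist X n) = measure_pmf (traj n [v])"
proof (rule measure_eqI_countable_AE)
  let ?\<Omega> = "{q \<in> lists (carrier H). length q = Suc n}"
  show "countable ?\<Omega>" using countable_lists[OF countable_carrier] by (rule countable_subset[rotated]) auto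
  show "AE q in distr W (count_space UNIV) (\<lambda>X. hist X n). q \<in> ?\<Omega>"
    by (subst AE_distr_iff[OF hist_measurable])
      (auto intro!: AE_I2 simp: space_law set_hist PiE_iff in_lists_conv_set hist_def simp del: upt_Suc)
  show "AE q in measure_pmf (traj n [v]). q \<in> ?\<Omega>"
    using set_traj[OF V_singleton[OF v]] V_carrier by (fastforce simp: AE_measure_pmf_iff in_lists_conv_set)
  fix q assume q: "q \<in> ?\<Omega>"
  define x where "x i = rev q ! i" for i
  have qx: "hist x n = q"
  proof -
    have "map x [0..<Suc n] = rev q"
      by (rule nth_equalityI) (use q in \<open>auto simp: x_def simp del: upt_Suc\<close>)
    then show ?thesis by (simp add: hist_def del: upt_Suc)
  qed
  have x: "x i \<in> carrier H" if "i \<le> n" for i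
  proof -
    have "x i \<in> set (hist x n)" using that by (simp add: set_hist)
    then show ?thesis using q unfolding qx by (auto simp: in_lists_conv_set)
  qed
  have "emeasure (distr W (count_space UNIV) (\<lambda>X. hist X n)) {q}
      = emeasure W ((\<lambda>X. hist X n) -` {q} \<inter> space W)"
    by (rule emeasure_distr[OF hist_measurable]) simp
  also have "(\<lambda>X. hist X n) -` {q} \<inter> space W = {X \<in> space W. \<forall>i\<le>n. X i = x i}"
    unfolding qx[symmetric] by (auto simp: hist_eq_iff)
  also have "emeasure W \<dots> = emeasure (measure_pmf (traj n [v])) {q}"
    using emeasure_law_path[OF x] by (simp add: qx emeasure_pmf_single)
  finally show "emeasure (distr W (count_space UNIV) (\<lambda>X. hist X n)) {q} = emeasure (measure_pmf (traj n [v])) {q}" .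
qed simp_all

lemma hist_sets: "{X \<in> space W. hist X n \<in> B} \<in> sets W"
  using measurable_sets[OF hist_measurable, of B n] by (simp add: vimage_def Int_def conj_commute)

lemma emeasure_hist: "emeasure W {X \<in> space W. hist X n \<in> B} = emeasure (traj n [v]) B"
proof -
  have "emeasure (traj n [v]) B = emeasure W ((\<lambda>X. hist X n) -` B \<inter> space W)"
    unfolding distr_hist[symmetric] by (rule emeasure_distr[OF hist_measurable]) simp
  also have "(\<lambda>X. hist X n) -` B \<inter> space W = {X \<in> space W. hist X n \<in> B}" by auto
  finally show ?thesis ..
qed

text \<open>The expected visits are the partial sums of the probabilities of being at
  \<open>v\<close>. A bound on them is the hypothesis of the Borel-Cantelli lemma, so almost surely
  there are finitely many visits.\<close>

lemma not_recurrent_of_visits_bounded: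
  assumes B: "B < \<infinity>" "\<And>n. visits v n [v] \<le> B"
  shows "\<not> recurrent_vertex G K v"
proof
  interpret prob_space W by (rule prob_space_law)
  let ?A = "\<lambda>i. {X \<in> space W. hist X (Suc i) \<in> {q. hd q = v}}"
  have "(\<Sum>i. emeasure W (?A i)) \<le> B"
    using B(2) unfolding emeasure_hist visits_eq_sum suminf_eq_SUP by (rule SUP_least)
  then have "(\<Sum>i. ennreal (measure W (?A i))) \<noteq> \<infinity>"
    using B(1) by (auto simp: emeasure_eq_measure)
  then have "summable (\<lambda>i. measure W (?A i))"
    by (intro summable_suminf_not_top) auto
  then have "AE X in W. eventually (\<lambda>i. X \<in> space W - ?A i) sequentially"
    by (intro borel_cantelli_AE1 hist_sets) (simp_all add: emeasure_eq_measure)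
  moreover assume "recurrent_vertex G K v"
  then have "AE X in W. infinite {t. X t = v}" by (simp add: recurrent_vertex_def)
  ultimately have "AE X in W. False"
  proof eventually_elim
    case (elim X)
    then obtain N where N: "\<And>i. i \<ge> N \<Longrightarrow> X \<in> space W - ?A i"
      by (auto simp: eventually_sequentially)
    have "{t. X t = v} \<subseteq> {..N}"
    proof
      fix t assume t: "t \<in> {t. X t = v}"
      show "t \<in> {..N}"
      proof (rule ccontr)
        assume "t \<notin> {..N}"
        then obtain i where i: "t = Suc i" "i \<ge> N" by (cases t) auto
        then show False using N[OF i(2)] t by (auto simp: hd_hist)
      qed
    qed
    then show False using elim(2) finite_subset by blast
  qed
  then show False by simp
qed

text \<open>The hypothesis holds for every past, in particular for the random path at time
  \<open>t\<close>. Averaging the survival probability over that path and letting the horizon grow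
  gives a visit after \<open>t\<close> almost surely, and countability gives it for all
  \<open>t\<close> at once.\<close>

lemma recurrent_of_reach:
  assumes r: "\<And>p. p \<in> V \<Longrightarrow> (SUP n. reach step (\<lambda>q. hd q = v) n p) = 1"
  shows "recurrent_vertex G K v"
proof -
  interpret prob_space W by (rule prob_space_law)
  let ?A = "\<lambda>q :: 'a list. hd q = v"
  have vV: "[v] \<in> V" by (rule V_singleton[OF v])
  have surv0: "(\<lambda>n. surv step ?A n p) \<longlonglongrightarrow> 0" if p: "p \<in> V" for p
  proof -
    have "(\<lambda>n. reach step ?A n p) \<longlonglongrightarrow> 1"
      unfolding r[OF p, symmetric] by (rule LIMSEQ_SUP) (auto intro: incseq_SucI reach_Suc_mono)
    then have "(\<lambda>n. 1 - reach step ?A n p) \<longlonglongrightarrow> 1 - 1"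
      by (intro tendsto_diff_ennreal tendsto_const) auto
    then show ?thesis by (simp add: surv_eq)
  qed
  have "AE X in W. \<exists>n>t. X n = v" for t
  proof -
    let ?E = "\<lambda>n. {X \<in> space W. hist X (t + n) \<in> {q. v \<notin> set (take n q)}}"
    have E: "emeasure W (?E n) = (\<integral>\<^sup>+q. surv step ?A n q \<partial>traj t [v])" for n
    proof -
      have "emeasure W (?E n) = (\<integral>\<^sup>+q. emeasure (traj n q) {q. v \<notin> set (take n q)} \<partial>traj t [v])"
        unfolding emeasure_hist traj_add by simp
      also have "\<dots> = (\<integral>\<^sup>+q. surv step ?A n q \<partial>traj t [v])"
        by (rule nn_integral_pmf_cong) (use set_traj[OF vV] surv_eq_traj in auto)
      finally show ?thesis .
    qed
    have "(\<lambda>n. \<integral>\<^sup>+q. surv step ?A n q \<partial>traj t [v]) \<longlonglongrightarrow> (\<integral>\<^sup>+q. 0 \<partial>traj t [v])"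
    proof (rule nn_integral_dominated_convergence[where w = "\<lambda>_. 1"])
      show "AE q in traj t [v]. (\<lambda>n. surv step ?A n q) \<longlonglongrightarrow> 0"
        using set_traj[OF vV] surv0 by (auto simp: AE_measure_pmf_iff)
    qed (auto simp: surv_le_1)
    then have lim: "(\<lambda>n. emeasure W (?E n)) \<longlonglongrightarrow> 0" unfolding E by simp
    let ?N = "\<Inter>n. ?E n"
    have N: "?N \<in> sets W"
      by (rule sets.countable_INT, rule image_subsetI, rule hist_sets, simp)
    have "emeasure W ?N \<le> 0"
    proof (rule LIMSEQ_le_const[OF lim], intro exI allI impI)
      show "emeasure W ?N \<le> emeasure W (?E n)" for n
        by (rule emeasure_mono[OF _ hist_sets]) blast
    qed
    then have "?N \<in> null_sets W" using N by auto
    then have "AE X in W. X \<notin> ?N" by (rule AE_not_in)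
    then show ?thesis
    proof (rule AE_mp, intro AE_I2 impI)
      fix X assume X: "X \<in> space W" "X \<notin> ?N"
      then obtain n where "v \<in> set (take n (hist X (t + n)))" by auto
      then show "\<exists>n>t. X n = v" unfolding take_hist by auto
    qed
  qed
  then have "AE X in W. \<forall>t. \<exists>n>t. X n = v" by (simp add: AE_all_countable)
  then show ?thesis
    unfolding recurrent_vertex_def by eventually_elim (auto simp: infinite_nat_iff_unbounded)
qed

end

end

text \<open>One direction needs transience only at the vertex \<open>\<one>\<close>; the other uses
  \<open>u_eq_1\<close> at every vertex.\<close>

lemma (in direction) recurrent_walk_iff:
  assumes "verts G = carrier H" "walk_kernel G K"
  shows "recurrent_walk G K \<longleftrightarrow> \<not> pos_capacity"
proof
  assume "recurrent_walk G K"
  then have rec: "recurrent_vertex G K \<one>" using assms(1) by (simp add: recurrent_walk_def)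
  show "\<not> pos_capacity"
  proof
    assume pos_capacity
    then obtain B where "B < \<infinity>" "\<And>n. visits \<one> n [\<one>] \<le> B" using visits_bounded[OF _ one_closed] by blast
    then show False using not_recurrent_of_visits_bounded[OF assms one_closed] rec by blast
  qed
next
  assume "\<not> pos_capacity"
  then show "recurrent_walk G K"
    unfolding recurrent_walk_def assms(1)
    using recurrent_of_reach[OF assms] u_eq_1 unfolding u_def by blast
qed

section \<open>Non-backtracking walks on Cayley graphs\<close>

text \<open>Each of the three kernels is uniform on the neighbours that pass a rule
  \<open>ok\<close>, with all neighbours as fallback. The rules compare positions for equality,
  hence are preserved by injections, and the fallback then occurs on both sides at the same time.
  There are at most \<open>card S\<close> candidates, which gives the mass bound.\<close>

lemma (in cayley) memory_walk_uniform:
  fixes k :: nat and ok :: "nat \<Rightarrow> (nat \<Rightarrow> 'a) \<Rightarrow> 'a \<Rightarrow> bool"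
  defines "G \<equiv> cayley_graph H S"
  assumes k: "1 \<le> k" and ne: "S \<noteq> {}" and SS: "set_inv\<^bsub>H\<^esub> S = S"
    and fresh: "\<And>t X z. (\<And>i. t \<le> i + k \<Longrightarrow> i \<le> t \<Longrightarrow> z \<noteq> X i) \<Longrightarrow> ok t X z"
    and adapted: "\<And>t X Y z. (\<And>i. i \<le> t \<Longrightarrow> X i = Y i) \<Longrightarrow> ok t X z = ok t Y z"
    and memory: "\<And>t X z. k \<le> t \<Longrightarrow> ok t X z = ok k (\<lambda>i. X (i + (t - k))) z"
    and inj: "\<And>t X z \<theta>. inj_on \<theta> (carrier H) \<Longrightarrow> (\<And>i. i \<le> t \<Longrightarrow> X i \<in> carrier H) \<Longrightarrow> z \<in> carrier H \<Longrightarrow>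
       ok t (\<lambda>i. \<theta> (X i)) (\<theta> z) = ok t X z"
  shows "memory_walk H S k (\<lambda>t X. uniform_or_neighbor G (X t) {z \<in> neighbors G (X t). ok t X z})"
proof -
  let ?K = "\<lambda>t X. uniform_or_neighbor G (X t) {z \<in> neighbors G (X t). ok t X z}"
  have nb: "neighbors G x = (\<lambda>s. x \<otimes> s) ` S" if "x \<in> carrier H" for x
    unfolding G_def by (rule neighbors_cayley_graph[OF is_group S_sub SS that])
  define R where "R t X = (let A = {z \<in> neighbors G (X t). ok t X z} in if A = {} then neighbors G (X t) else A)" for t X
  have K: "?K t X = pmf_of_set (R t X)" for t X
    by (simp add: uniform_or_neighbor_def R_def Let_def)
  have R: "R t X \<subseteq> (\<lambda>s. X t \<otimes> s) ` S" "R t X \<noteq> {}" "finite (R t X)" if "X t \<in> carrier H" for t X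
  proof -
    show sub: "R t X \<subseteq> (\<lambda>s. X t \<otimes> s) ` S" using nb[OF that] by (auto simp: R_def Let_def)
    show "R t X \<noteq> {}" using nb[OF that] ne by (auto simp: R_def Let_def)
    show "finite (R t X)" using finite_subset[OF sub] finite_S by simp
  qed
  have equi: "?K t (\<lambda>i. \<theta> (X i)) = map_pmf \<theta> (?K t X)"
    if \<theta>: "inj_on \<theta> (carrier H)" and X: "\<And>i. i \<le> t \<Longrightarrow> X i \<in> carrier H" and \<theta>X: "\<theta> (X t) \<in> carrier H"
      and \<theta>N: "(\<lambda>s. \<theta> (X t) \<otimes> s) ` S = \<theta> ` (\<lambda>s. X t \<otimes> s) ` S" for \<theta> t X
  proof -
    have Xt: "X t \<in> carrier H" using X by simp
    have N: "neighbors G (\<theta> (X t)) = \<theta> ` neighbors G (X t)" using \<theta>N nb[OF Xt] nb[OF \<theta>X] by simp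
    have Nc: "neighbors G (X t) \<subseteq> carrier H" using nb[OF Xt] Xt S_sub by auto
    have ok: "ok t (\<lambda>i. \<theta> (X i)) (\<theta> z) = ok t X z" if "z \<in> neighbors G (X t)" for z
      by (rule inj[OF \<theta> X]) (use that Nc in auto)
    have "{z \<in> neighbors G (\<theta> (X t)). ok t (\<lambda>i. \<theta> (X i)) z} = \<theta> ` {z \<in> neighbors G (X t). ok t X z}"
      unfolding N using ok by auto
    then have "R t (\<lambda>i. \<theta> (X i)) = \<theta> ` R t X" unfolding R_def Let_def N by (simp only: image_is_empty if_distrib[of "\<lambda>A. \<theta> ` A"])
    moreover have "inj_on \<theta> (R t X)" using \<theta> by (rule inj_on_subset) (use Nc in \<open>auto simp: R_def Let_def\<close>)
    ultimately show ?thesis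
      unfolding K[where t = t and X = "\<lambda>i. \<theta> (X i)"] K[where t = t and X = X]
      using R[where X = X and t = t, OF Xt] by (simp add: map_pmf_of_set_inj)
  qed
  show ?thesis
  proof
    show "1 \<le> k" "S \<noteq> {}" by fact+
    show "set_pmf (?K t X) \<subseteq> (\<lambda>s. X t \<otimes> s) ` S" if "\<And>i. i \<le> t \<Longrightarrow> X i \<in> carrier H" for t X
      unfolding K using R[of X t] that by simp
    show "1 / real (card S) \<le> pmf (?K t X) (X t \<otimes> s)"
      if X: "\<And>i. i \<le> t \<Longrightarrow> X i \<in> carrier H" and s: "s \<in> S"
        and f: "\<And>i. t \<le> i + k \<Longrightarrow> i \<le> t \<Longrightarrow> X t \<otimes> s \<noteq> X i" for t X s
    proof -
      have Xt: "X t \<in> carrier H" using X by simp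
      have "X t \<otimes> s \<in> R t X" using fresh[OF f] nb[OF Xt] s by (auto simp: R_def Let_def)
      moreover have "card (R t X) \<le> card S"
        using surj_card_le[OF finite_S R(1)[where X = X and t = t, OF Xt]] by simp
      moreover have "0 < card (R t X)" using R[where X = X and t = t, OF Xt] by (simp add: card_gt_0_iff)
      ultimately show ?thesis
        unfolding K using R[where X = X and t = t, OF Xt] by (simp add: frac_le)
    qed
    show "?K t X = ?K t Y" if "\<And>i. i \<le> t \<Longrightarrow> X i = Y i" for t X Y
      using adapted[OF that] that[of t] by simp
    show "?K t X = ?K k (\<lambda>i. X (i + (t - k)))" if "k \<le> t" for t X
      using memory[OF that, of X] that by simp
    show "?K t (\<lambda>i. a \<otimes> X i) = map_pmf (\<lambda>z. a \<otimes> z) (?K t X)"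
      if a: "a \<in> carrier H" and X: "\<And>i. i \<le> t \<Longrightarrow> X i \<in> carrier H" for a t X
    proof (rule equi[OF _ X])
      show "inj_on (\<lambda>z. a \<otimes> z) (carrier H)" using a by (auto simp: inj_on_def)
      show "(\<lambda>s. a \<otimes> X t \<otimes> s) ` S = (\<lambda>z. a \<otimes> z) ` (\<lambda>s. X t \<otimes> s) ` S"
        unfolding image_image using a X S_sub by (intro image_cong) (auto simp: m_assoc)
    qed (use a X in auto)
    show "?K t (\<lambda>i. inv (X i)) = map_pmf (\<lambda>z. inv z) (?K t X)"
      if X: "\<And>i. i \<le> t \<Longrightarrow> X i \<in> carrier H" for t X
    proof (rule equi[OF _ X])
      show "inj_on (\<lambda>z. inv z) (carrier H)" by (rule inv_inj)
      have Xt: "X t \<in> carrier H" using X by simp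
      have IS: "(\<lambda>s. inv s) ` S = S" using SS by (auto simp: SET_INV_def)
      have "(\<lambda>s. inv (X t) \<otimes> s) ` S = (\<lambda>s. inv (X t) \<otimes> s) ` (\<lambda>s. inv s) ` S"
        by (simp only: IS)
      also have "\<dots> = (\<lambda>z. inv z) ` (\<lambda>s. X t \<otimes> s) ` S"
        unfolding image_image using Xt S_sub by (intro image_cong) (auto simp: inv_mult)
      finally show "(\<lambda>s. inv (X t) \<otimes> s) ` S = (\<lambda>z. inv z) ` (\<lambda>s. X t \<otimes> s) ` S" .
    qed (use X in auto)
  qed
qed

lemma edge_nbrw_kernel_altdef:
  "edge_nbrw_kernel k G = (\<lambda>t X. uniform_or_neighbor G (X t) {z \<in> neighbors G (X t).
     \<not> (\<exists>i. {z, X t} = {X (i - 1), X i} \<and> t < i + k \<and> i \<le> t \<and> 1 \<le> i)})"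
  by (simp add: edge_nbrw_kernel_def fun_eq_iff)

lemma vertex_nbrw_kernel_altdef:
  "vertex_nbrw_kernel k G = (\<lambda>t X. uniform_or_neighbor G (X t) {z \<in> neighbors G (X t).
     \<not> (\<exists>i. z = X i \<and> t \<le> i + k \<and> i \<le> t)})"
  by (simp add: vertex_nbrw_kernel_def fun_eq_iff)

lemma srw_kernel_altdef:
  "srw_kernel G = (\<lambda>t X. uniform_or_neighbor G (X t) {z \<in> neighbors G (X t). True})"
  by (simp add: srw_kernel_def uniform_or_neighbor_def fun_eq_iff)

lemma shift_Ex_window:
  fixes k t :: nat
  assumes "k \<le> t"
  shows "(\<exists>i. Q i \<and> t < i + k \<and> i \<le> t \<and> 1 \<le> i) \<longleftrightarrow> (\<exists>j. Q (j + (t - k)) \<and> k < j + k \<and> j \<le> k \<and> 1 \<le> j)"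
    and "(\<exists>i. Q i \<and> t \<le> i + k \<and> i \<le> t) \<longleftrightarrow> (\<exists>j. Q (j + (t - k)) \<and> k \<le> j + k \<and> j \<le> k)"
proof -
  have "\<exists>j. Q (j + (t - k)) \<and> k < j + k \<and> j \<le> k \<and> 1 \<le> j" if "Q i" "t < i + k" "i \<le> t" for i
    using that assms by (intro exI[of _ "i - (t - k)"]) auto
  moreover have "\<exists>i. Q i \<and> t < i + k \<and> i \<le> t \<and> 1 \<le> i" if "Q (j + (t - k))" "j \<le> k" "1 \<le> j" for j
    using that assms by (intro exI[of _ "j + (t - k)"]) auto
  ultimately show "(\<exists>i. Q i \<and> t < i + k \<and> i \<le> t \<and> 1 \<le> i) \<longleftrightarrow> (\<exists>j. Q (j + (t - k)) \<and> k < j + k \<and> j \<le> k \<and> 1 \<le> j)"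
    by blast
  have "\<exists>j. Q (j + (t - k)) \<and> k \<le> j + k \<and> j \<le> k" if "Q i" "t \<le> i + k" "i \<le> t" for i
    using that assms by (intro exI[of _ "i - (t - k)"]) auto
  moreover have "\<exists>i. Q i \<and> t \<le> i + k \<and> i \<le> t" if "Q (j + (t - k))" "j \<le> k" for j
    using that assms by (intro exI[of _ "j + (t - k)"]) auto
  ultimately show "(\<exists>i. Q i \<and> t \<le> i + k \<and> i \<le> t) \<longleftrightarrow> (\<exists>j. Q (j + (t - k)) \<and> k \<le> j + k \<and> j \<le> k)"
    by blast
qed

lemma (in cayley) memory_walks:
  fixes k :: nat
  assumes k: "1 \<le> k" and ne: "S \<noteq> {}" and SS: "set_inv\<^bsub>H\<^esub> S = S"
  shows "memory_walk H S k (srw_kernel (cayley_graph H S))"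
    and "memory_walk H S k (edge_nbrw_kernel k (cayley_graph H S))"
    and "memory_walk H S k (vertex_nbrw_kernel k (cayley_graph H S))"
proof -
  show "memory_walk H S k (srw_kernel (cayley_graph H S))"
    unfolding srw_kernel_altdef by (rule memory_walk_uniform[OF k ne SS]) auto
  show "memory_walk H S k (edge_nbrw_kernel k (cayley_graph H S))"
    unfolding edge_nbrw_kernel_altdef
  proof (rule memory_walk_uniform[OF k ne SS])
    show "\<not> (\<exists>i. {z, X t} = {X (i - 1), X i} \<and> t < i + k \<and> i \<le> t \<and> 1 \<le> i)"
      if f: "\<And>i. t \<le> i + k \<Longrightarrow> i \<le> t \<Longrightarrow> z \<noteq> X i" for t z and X :: "nat \<Rightarrow> 'a"
    proof
      assume "\<exists>i. {z, X t} = {X (i - 1), X i} \<and> t < i + k \<and> i \<le> t \<and> 1 \<le> i"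
      then obtain i where i: "{z, X t} = {X (i - 1), X i}" "t < i + k" "i \<le> t" "1 \<le> i" by blast
      then have "z = X (i - 1) \<or> z = X i" by blast
      \<comment> \<open>The strict \<open>t < i + k\<close> leaves room for \<open>i - 1\<close>: a
        window of \<open>k + 1\<close> positions contains both ends of each of the last
        \<open>k\<close> edges.\<close>
      moreover have "t \<le> (i - 1) + k" "i - 1 \<le> t" "t \<le> i + k" using i(2-4) by linarith+
      ultimately show False using f[of i] f[of "i - 1"] i(3) by blast
    qed
    show "(\<not> (\<exists>i. {z, X t} = {X (i - 1), X i} \<and> t < i + k \<and> i \<le> t \<and> 1 \<le> i))
      = (\<not> (\<exists>i. {z, Y t} = {Y (i - 1), Y i} \<and> t < i + k \<and> i \<le> t \<and> 1 \<le> i))"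
      if e: "\<And>i. i \<le> t \<Longrightarrow> X i = Y i" for t z and X Y :: "nat \<Rightarrow> 'a"
    proof -
      have "{z, X t} = {X (i - 1), X i} \<longleftrightarrow> {z, Y t} = {Y (i - 1), Y i}" if "i \<le> t" for i
        using e[of t] e[of i] e[of "i - 1"] that by simp
      then show ?thesis by blast
    qed
    show "(\<not> (\<exists>i. {z, X t} = {X (i - 1), X i} \<and> t < i + k \<and> i \<le> t \<and> 1 \<le> i))
      = (\<not> (\<exists>j. {z, X (k + (t - k))} = {X (j - 1 + (t - k)), X (j + (t - k))} \<and> k < j + k \<and> j \<le> k \<and> 1 \<le> j))"
      if kt: "k \<le> t" for t z and X :: "nat \<Rightarrow> 'a"
    proof -
      have "j + (t - k) - 1 = j - 1 + (t - k)" if "1 \<le> j" for j using that by simp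
      then show ?thesis
        unfolding shift_Ex_window(1)[OF kt, of "\<lambda>i. {z, X t} = {X (i - 1), X i}"] using kt by (metis le_add_diff_inverse)
    qed
    show "(\<not> (\<exists>i. {\<theta> z, \<theta> (X t)} = {\<theta> (X (i - 1)), \<theta> (X i)} \<and> t < i + k \<and> i \<le> t \<and> 1 \<le> i))
      = (\<not> (\<exists>i. {z, X t} = {X (i - 1), X i} \<and> t < i + k \<and> i \<le> t \<and> 1 \<le> i))"
      if \<theta>: "inj_on \<theta> (carrier H)" and X: "\<And>i. i \<le> t \<Longrightarrow> X i \<in> carrier H" and z: "z \<in> carrier H"
      for t z \<theta> and X :: "nat \<Rightarrow> 'a"
    proof -
      have "{\<theta> z, \<theta> (X t)} = {\<theta> (X (i - 1)), \<theta> (X i)} \<longleftrightarrow> {z, X t} = {X (i - 1), X i}" if i: "i \<le> t" for i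
        using inj_on_image_eq_iff[OF \<theta>, of "{z, X t}" "{X (i - 1), X i}"] X[of t] X[OF i] X[of "i - 1"] i z by simp
      then show ?thesis by blast
    qed
  qed
  show "memory_walk H S k (vertex_nbrw_kernel k (cayley_graph H S))"
    unfolding vertex_nbrw_kernel_altdef
  proof (rule memory_walk_uniform[OF k ne SS])
    show "(\<not> (\<exists>i. z = X i \<and> t \<le> i + k \<and> i \<le> t)) = (\<not> (\<exists>i. z = X (i + (t - k)) \<and> k \<le> i + k \<and> i \<le> k))"
      if kt: "k \<le> t" for t z and X :: "nat \<Rightarrow> 'a"
      unfolding shift_Ex_window(2)[OF kt, of "\<lambda>i. z = X i"] ..
    show "(\<not> (\<exists>i. \<theta> z = \<theta> (X i) \<and> t \<le> i + k \<and> i \<le> t)) = (\<not> (\<exists>i. z = X i \<and> t \<le> i + k \<and> i \<le> t))"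
      if \<theta>: "inj_on \<theta> (carrier H)" and X: "\<And>i. i \<le> t \<Longrightarrow> X i \<in> carrier H" and z: "z \<in> carrier H"
      for t z \<theta> and X :: "nat \<Rightarrow> 'a"
      using inj_on_eq_iff[OF \<theta> z X] by blast
  qed auto
qed

theorem theorem2:
  fixes H :: "('a, 'b) monoid_scheme" and S :: "'a set" and k :: nat
  assumes "comm_group H"
    and "infinite (carrier H)"
    and "\<not> H \<cong> integer_group"
    and "finite S" and "S \<subseteq> carrier H" and "set_inv\<^bsub>H\<^esub> S = S"
    and "generate H S = carrier H" and "\<one>\<^bsub>H\<^esub> \<notin> S"
    and "k \<ge> 1"
  defines "G \<equiv> cayley_graph H S"
  shows "(recurrent_walk G (srw_kernel G) \<longleftrightarrow> recurrent_walk G (edge_nbrw_kernel k G))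
       \<and> (recurrent_walk G (edge_nbrw_kernel k G) \<longleftrightarrow> recurrent_walk G (vertex_nbrw_kernel k G))"
proof -
  interpret comm_group H by fact
  have ne: "S \<noteq> {}" using assms(2,7) generate_empty by (metis finite.emptyI finite_insert)
  have wk: "walk_kernel G (srw_kernel G)" "walk_kernel G (edge_nbrw_kernel k G)" "walk_kernel G (vertex_nbrw_kernel k G)"
    unfolding G_def using walk_kernels_cayley_graph[OF is_group assms(5,4,6) ne assms(7)] by blast+
  have verts: "verts G = carrier H" by (simp add: G_def cayley_graph_def)
  interpret cayley H S
  proof
    show "inv\<^bsub>H\<^esub> s \<in> S" if "s \<in> S" for s using assms(6) that by (auto simp: SET_INV_def)
    show "countable (carrier H)" using walk_kernel.countable_verts[OF wk(1)] verts by simp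
  qed (use assms in auto)
  obtain \<phi> :: "'a \<Rightarrow> int" and s r where dir:
    "\<And>x y. x \<in> carrier H \<Longrightarrow> y \<in> carrier H \<Longrightarrow> \<phi> (x \<otimes>\<^bsub>H\<^esub> y) = \<phi> x + \<phi> y"
    "s \<in> S" "0 < \<phi> s" "\<And>t. t \<in> S \<Longrightarrow> \<phi> t \<le> \<phi> s" "r \<in> S" "\<And>m::int. r \<noteq> s [^]\<^bsub>H\<^esub> m"
    by (rule exists_direction[OF assms(2,3)]) (rule that; assumption)
  \<comment> \<open>\<open>pos_capacity\<close> belongs to the context of \<open>H\<close> and
    \<open>S\<close> and mentions neither \<open>k\<close> nor the kernel, so the three walks can be
    compared through it.\<close>
  have "recurrent_walk G K \<longleftrightarrow> \<not> pos_capacity" if "memory_walk H S k K" "walk_kernel G K" for K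
  proof -
    interpret memory_walk H S k K by fact
    interpret direction H S k K \<phi> s r by unfold_locales (use dir in auto)
    show ?thesis by (rule recurrent_walk_iff[OF verts that(2)])
  qed
  then show ?thesis
    using memory_walks[OF assms(9) ne assms(6), folded G_def] wk by simp
qed

end
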